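(* Let $X,Y$ be connected based CW-complexes and let $n\ge N\mathcal{E}(X)$. Suppose that every self-map of $Y$ that factors through $X$ induces nilpotent-central or radical endomorphisms of the first $n$ homotopy groups of $Y$. Then $\mathcal{A}_\sharp^{n}(X\times Y)$ is reducible if and only if $f\in\mathcal{A}_\sharp^{n}(X\times Y)$ implies that $f_{XX}\in\mathcal{E}(X)$.
   Context: All spaces have the homotopy type of connected based CW-complexes; all maps are base-point-preserving and are identified with their based homotopy classes. $[X,X]$ is the monoid of based homotopy classes of self-maps of $X$, and $\mathcal{E}(X)\subseteq[X,X]$ is the group of homotopy classes of self-homotopy equivalences. For $n\in\{0,1,2,\dots\}\cup\{\infty\}$, $\mathcal{A}_\sharp^{n}(X)=\{f\in[X,X]:\pi_k(f)\in\mathrm{Aut}(\pi_k(X))\text{ for all } k\le n\}$ (all $k$ if $n=\infty$), so $\mathcal{A}_\sharp^{\infty}(X)=\mathcal{E}(X)$. The self-closeness number is $N\mathcal{E}(X)=\min\{n:\mathcal{A}_\sharp^{n}(X)=\mathcal{E}(X)\}$. For a self-map $f$ of $X\times Y$ write $f=(f_X,f_Y)$ with $f_I=p_I\circ f$, and $f_{IJ}=p_I\circ f\circ i_J\colon J\to I$ for $I,J\in\{X,Y\}$, where $p_I$ and $i_J$ are the canonical projections and inclusions. $\mathcal{A}_\sharp^{n}(X\times Y)$ is reducible if $(f_X,f_Y)\in\mathcal{A}_\sharp^{n}(X\times Y)$ implies $(p_X,f_Y),(f_X,p_Y)\in\mathcal{A}_\sharp^{n}(X\times Y)$; equivalently,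 if $f\in\mathcal{A}_\sharp^{n}(X\times Y)$ implies $f_{XX}\in\mathcal{A}_\sharp^{n}(X)$ and $f_{YY}\in\mathcal{A}_\sharp^{n}(Y)$. The first $n$ homotopy groups of $Y$ are $\pi_k(Y)$ for $1\le k\le n$. A self-map of $Y$ factors through $X$ if it is a composite $Y\to X\to Y$. For a self-map $h$ of $Y$, $\pi_k(h)$ is nilpotent-central if it is nilpotent (some power is the trivial endomorphism) and central, in the sense that it commutes with $\pi_k(g)$ for every $g\in[Y,Y]$. It is radical if it belongs to the Jacobson radical $J(R)$ of the endomorphism ring $R=\mathrm{End}(\pi_k(Y))$, where $J(R)$ consists of the $x\in R$ such that $1+rxs$ is a unit for all $r,s\in R$ (this notion refers to $\pi_k(Y)$ abelian, so that $\mathrm{End}(\pi_k(Y))$ is a ring). *)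

theory Defs
  imports "HOL-Analysis.Analysis" "HOL-Algebra.Coset" "HOL-Algebra.Ring" "HOL-Library.Extended_Nat"
begin

section \<open>Based spaces, based maps and based homotopy classes\<close>

type_synonym 'a based = "'a topology \<times> 'a"

definition based_prod :: "'a based \<Rightarrow> 'b based \<Rightarrow> ('a \<times> 'b) based" (infixr \<open>\<times>\<^sub>b\<close> 80) where
  "X \<times>\<^sub>b Y = (prod_topology (fst X) (fst Y), (snd X, snd Y))"

definition based_maps :: "'a based \<Rightarrow> 'b based \<Rightarrow> ('a \<Rightarrow> 'b) set" where
  "based_maps X Y = {f. continuous_map (fst X) (fst Y) f \<and> f (snd X) = snd Y}"

definition based_homotopic :: "'a based \<Rightarrow> 'b based \<Rightarrow> ('a \<Rightarrow> 'b) \<Rightarrow> ('a \<Rightarrow> 'b) \<Rightarrow> bool" where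
  "based_homotopic X Y = homotopic_with (\<lambda>h. h (snd X) = snd Y) (fst X) (fst Y)"

text \<open>Maps are total functions whose values off the topological space are irrelevant: two based
  maps that agree on the space are homotopic, so they have the same class.\<close>

definition hclass :: "'a based \<Rightarrow> 'b based \<Rightarrow> ('a \<Rightarrow> 'b) \<Rightarrow> ('a \<Rightarrow> 'b) set" where
  "hclass X Y f = {g. based_homotopic X Y f g}"

definition homotopy_equivalence :: "'a based \<Rightarrow> 'b based \<Rightarrow> ('a \<Rightarrow> 'b) \<Rightarrow> bool" where
  "homotopy_equivalence X Y f \<longleftrightarrow> f \<in> based_maps X Y \<and>
     (\<exists>g \<in> based_maps Y X. based_homotopic X X (g \<circ> f) id \<and> based_homotopic Y Y (f \<circ> g) id)"

definition self_equivalences :: "'a based \<Rightarrow> ('a \<Rightarrow> 'a) set set" where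
  "self_equivalences X = {hclass X X f | f. homotopy_equivalence X X f}"

section \<open>Based CW-complexes\<close>

definition cube :: "nat \<Rightarrow> (nat \<Rightarrow> real) topology" where
  "cube k = product_topology (\<lambda>_. top_of_set {0..1}) {..<k}"

definition cube_boundary :: "nat \<Rightarrow> (nat \<Rightarrow> real) set" where
  "cube_boundary k = {t \<in> topspace (cube k). \<exists>i<k. t i = 0 \<or> t i = 1}"

definition cube_interior :: "nat \<Rightarrow> (nat \<Rightarrow> real) set" where
  "cube_interior k = topspace (cube k) - cube_boundary k"

text \<open>A cell is a pair of its dimension and its characteristic map. The pair
  (unit cube, its boundary) serves as the model of (closed disc, sphere), to which it is
  homeomorphic; a 0-dimensional cube is a point with empty boundary.\<close>

definition open_cell :: "nat \<times> ((nat \<Rightarrow> real) \<Rightarrow> 'a) \<Rightarrow> 'a set" where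
  "open_cell c = snd c ` cube_interior (fst c)"

definition closed_cell :: "nat \<times> ((nat \<Rightarrow> real) \<Rightarrow> 'a) \<Rightarrow> 'a set" where
  "closed_cell c = snd c ` topspace (cube (fst c))"

definition CW_structure :: "'a topology \<Rightarrow> (nat \<times> ((nat \<Rightarrow> real) \<Rightarrow> 'a)) set \<Rightarrow> bool" where
  "CW_structure X C \<longleftrightarrow>
     Hausdorff_space X \<and>
     (\<forall>(n, \<phi>) \<in> C. continuous_map (cube n) X \<phi> \<and>
        homeomorphic_map (subtopology (cube n) (cube_interior n))
                         (subtopology X (open_cell (n, \<phi>))) \<phi>) \<and>
     (\<forall>c \<in> C. \<forall>d \<in> C. c \<noteq> d \<longrightarrow> open_cell c \<inter> open_cell d = {}) \<and>
     (\<Union>c \<in> C. open_cell c) = topspace X \<and>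
     (\<forall>(n, \<phi>) \<in> C. \<exists>F \<subseteq> C. finite F \<and> (\<forall>c \<in> F. fst c < n) \<and>
        \<phi> ` cube_boundary n \<subseteq> (\<Union>c \<in> F. open_cell c)) \<and>
     (\<forall>A \<subseteq> topspace X. (\<forall>c \<in> C. closedin X (A \<inter> closed_cell c)) \<longrightarrow> closedin X A)"

text \<open>The base point is a vertex; since the CW-structure is not fixed, this is no restriction
  (a cell can be subdivided at any of its points).\<close>

definition connected_based_CW_complex :: "'a based \<Rightarrow> bool" where
  "connected_based_CW_complex X \<longleftrightarrow> connected_space (fst X) \<and>
     (\<exists>C. CW_structure (fst X) C \<and> (\<exists>\<phi>. (0, \<phi>) \<in> C \<and> snd X \<in> open_cell (0, \<phi>)))"

section \<open>Homotopy groups\<close>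

definition spheroids :: "nat \<Rightarrow> 'a based \<Rightarrow> ((nat \<Rightarrow> real) \<Rightarrow> 'a) set" where
  "spheroids k X = {a. continuous_map (cube k) (fst X) a \<and> (\<forall>t \<in> cube_boundary k. a t = snd X)}"

definition spheroid_class ::
    "nat \<Rightarrow> 'a based \<Rightarrow> ((nat \<Rightarrow> real) \<Rightarrow> 'a) \<Rightarrow> ((nat \<Rightarrow> real) \<Rightarrow> 'a) set" where
  "spheroid_class k X a =
     {b. homotopic_with (\<lambda>h. \<forall>t \<in> cube_boundary k. h t = snd X) (cube k) (fst X) a b}"

definition spheroid_mult ::
    "((nat \<Rightarrow> real) \<Rightarrow> 'a) \<Rightarrow> ((nat \<Rightarrow> real) \<Rightarrow> 'a) \<Rightarrow> (nat \<Rightarrow> real) \<Rightarrow> 'a" where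
  "spheroid_mult a b =
     (\<lambda>t. if t 0 \<le> 1/2 then a (t(0 := 2 * t 0)) else b (t(0 := 2 * t 0 - 1)))"

text \<open>Operations on classes are unions over all representatives (all of which give the same
  class). The group is meant for dimension at least 1 only.\<close>

definition homotopy_group :: "nat \<Rightarrow> 'a based \<Rightarrow> ((nat \<Rightarrow> real) \<Rightarrow> 'a) set monoid" where
  "homotopy_group k X =
     \<lparr>carrier = spheroid_class k X ` spheroids k X,
      mult = (\<lambda>A B. \<Union>a \<in> A. \<Union>b \<in> B. spheroid_class k X (spheroid_mult a b)),
      one = spheroid_class k X (\<lambda>_. snd X)\<rparr>"

definition homotopy_map :: "nat \<Rightarrow> 'a based \<Rightarrow> 'b based \<Rightarrow> ('a \<Rightarrow> 'b) \<Rightarrow>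
    ((nat \<Rightarrow> real) \<Rightarrow> 'a) set \<Rightarrow> ((nat \<Rightarrow> real) \<Rightarrow> 'b) set" where
  "homotopy_map k X Y f =
     (\<lambda>A \<in> carrier (homotopy_group k X). \<Union>a \<in> A. spheroid_class k Y (f \<circ> a))"

section \<open>Self-closeness number and reducibility\<close>

text \<open>The index starts at 1: for the path-connected spaces considered, the condition in
  dimension 0 is vacuous.\<close>

definition A_sharp :: "enat \<Rightarrow> 'a based \<Rightarrow> ('a \<Rightarrow> 'a) set set" where
  "A_sharp n X = {hclass X X f | f. f \<in> based_maps X X \<and>
     (\<forall>k::nat. 1 \<le> k \<and> enat k \<le> n \<longrightarrow>
        homotopy_map k X X f \<in> iso (homotopy_group k X) (homotopy_group k X))}"

definition self_closeness_number :: "'a based \<Rightarrow> enat" where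
  "self_closeness_number X = (LEAST n. A_sharp n X = self_equivalences X)"

definition component_XX :: "'b based \<Rightarrow> ('a \<times> 'b \<Rightarrow> 'a \<times> 'b) \<Rightarrow> 'a \<Rightarrow> 'a" where
  "component_XX Y f = fst \<circ> f \<circ> (\<lambda>x. (x, snd Y))"

definition reducible :: "enat \<Rightarrow> 'a based \<Rightarrow> 'b based \<Rightarrow> bool" where
  "reducible n X Y \<longleftrightarrow>
     (\<forall>f \<in> based_maps (X \<times>\<^sub>b Y) (X \<times>\<^sub>b Y).
        hclass (X \<times>\<^sub>b Y) (X \<times>\<^sub>b Y) f \<in> A_sharp n (X \<times>\<^sub>b Y) \<longrightarrow>
        hclass (X \<times>\<^sub>b Y) (X \<times>\<^sub>b Y) (\<lambda>z. (fst z, snd (f z))) \<in> A_sharp n (X \<times>\<^sub>b Y) \<and>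
        hclass (X \<times>\<^sub>b Y) (X \<times>\<^sub>b Y) (\<lambda>z. (fst (f z), snd z)) \<in> A_sharp n (X \<times>\<^sub>b Y))"

section \<open>Nilpotent-central and radical endomorphisms\<close>

definition factors_through :: "'a based \<Rightarrow> 'b based \<Rightarrow> ('b \<Rightarrow> 'b) \<Rightarrow> bool" where
  "factors_through X Y h \<longleftrightarrow>
     (\<exists>u \<in> based_maps Y X. \<exists>v \<in> based_maps X Y. based_homotopic Y Y h (v \<circ> u))"

definition nilpotent_central_map :: "nat \<Rightarrow> 'a based \<Rightarrow> ('a \<Rightarrow> 'a) \<Rightarrow> bool" where
  "nilpotent_central_map k Y h \<longleftrightarrow>
     (\<exists>m. trivial_homomorphism (homotopy_group k Y) (homotopy_group k Y)
            (homotopy_map k Y Y h ^^ m)) \<and>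
     (\<forall>g \<in> based_maps Y Y. \<forall>a \<in> carrier (homotopy_group k Y).
        homotopy_map k Y Y h (homotopy_map k Y Y g a) = homotopy_map k Y Y g (homotopy_map k Y Y h a))"

text \<open>For abelian \<open>G\<close>. Endomorphisms are functions restricted to the carrier, so that equality of
  endomorphisms is equality of functions.\<close>

definition End_ring :: "('a, 'm) monoid_scheme \<Rightarrow> ('a \<Rightarrow> 'a) ring" where
  "End_ring G =
     \<lparr>carrier = hom G G \<inter> extensional (carrier G),
      mult = compose (carrier G),
      one = (\<lambda>x \<in> carrier G. x),
      zero = (\<lambda>x \<in> carrier G. \<one>\<^bsub>G\<^esub>),
      add = (\<lambda>f g. \<lambda>x \<in> carrier G. f x \<otimes>\<^bsub>G\<^esub> g x)\<rparr>"

definition jacobson_radical :: "('a, 'm) ring_scheme \<Rightarrow> 'a set" where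
  "jacobson_radical R =
     {x \<in> carrier R. \<forall>r \<in> carrier R. \<forall>s \<in> carrier R. \<one>\<^bsub>R\<^esub> \<oplus>\<^bsub>R\<^esub> r \<otimes>\<^bsub>R\<^esub> x \<otimes>\<^bsub>R\<^esub> s \<in> Units R}"

definition radical_map :: "nat \<Rightarrow> 'a based \<Rightarrow> ('a \<Rightarrow> 'a) \<Rightarrow> bool" where
  "radical_map k Y h \<longleftrightarrow> comm_group (homotopy_group k Y) \<and>
     homotopy_map k Y Y h \<in> jacobson_radical (End_ring (homotopy_group k Y))"

end

(* For f in A_sharp^n(X x Y) the matrix (A B; C D) of components of pi_k(f) is bijective for
   k <= n. Replacing a row of it by a row of the identity gives a triangular matrix, so (f_X, p_Y)
   and (p_X, f_Y) are bijective on pi_k iff A and D are. Since n >= NE(X), bijectivity of A for all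
   k <= n means that f_XX is an equivalence, and then the Schur complement S = D - C A^{-1} B is
   bijective, where N = C A^{-1} B is induced by a self-map of Y that factors through X. If N is
   radical, then D = S (1 + S^{-1} N) is bijective. If N is nilpotent and central, then N commutes
   with D, and bijectivity of D follows by descending along the powers of N; since pi_1 may be
   nonabelian, S is only a map of sets in this case.

   The minimum in the definition of NE(X) is attained because of Whitehead's theorem, which is proved
   here by cell-by-cell lifting: a weak equivalence f: Z -> W has the homotopy extension and lifting
   property for (cube, boundary), so every map from a CW-complex to W lifts to Z up to homotopy. This
   yields a right inverse g of f, which is again a weak equivalence and has a right inverse h; then h
   is homotopic to f, and no CW-structure on a cylinder is needed. *)

theory Submission
  imports Defs
begin

section \<open>Homotopy extension for cubes\<close>

text \<open>The hypothesis on Y concerns maps, not homomorphisms, so C A^{-1} B has to be realized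
  by a map. A homotopy inverse g of f_XX induces A^{-1} in every degree at once, and f_YX g f_XY
  factors through X; inverses of A found degree by degree would not give such a map. In the lifting
  argument, the boundary of a cell has no reason to go to the base point, whereas bijectivity on
  homotopy groups only speaks of spheroids. The way out: boundary values in Z extend over the cube
  as soon as their images in W do, and an extension can be contracted to the base point because the
  cube is contractible. This contraction carries the boundary values to the base point, without
  relative homotopy groups, exact sequences or the action of pi_1. The price is a homotopy with the
  wrong boundary track, corrected by extending a homotopy of homotopies; for this reason the
  extension property is established for prisms as well as for cubes.\<close>

abbreviation I01 :: "real topology" where "I01 \<equiv> top_of_set {0..1}"

lemma continuous_map_comp:
  assumes "continuous_map B C h" "continuous_map A B g"
  shows "continuous_map A C (\<lambda>z. h (g z))"
  using continuous_map_compose[OF assms(2,1)] by (simp add: o_def)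

lemma topspace_cube: "topspace (cube k) = {..<k} \<rightarrow>\<^sub>E {0..1}"
  by (simp add: cube_def)

lemma continuous_map_cube_iff:
  "continuous_map Z (cube k) g \<longleftrightarrow>
     g \<in> topspace Z \<rightarrow> extensional {..<k} \<and> (\<forall>i<k. continuous_map Z I01 (\<lambda>z. g z i))"
  by (auto simp: cube_def continuous_map_componentwise image_subset_iff Pi_iff)

lemma continuous_map_cube_coord: "i < k \<Longrightarrow> continuous_map (cube k) I01 (\<lambda>x. x i)"
  unfolding cube_def by (rule continuous_map_product_projection) auto

lemma continuous_map_into_Icc:
  fixes a b :: real
  shows "continuous_map Z (top_of_set {a..b}) g \<longleftrightarrow>
    continuous_map Z euclideanreal g \<and> (\<forall>z\<in>topspace Z. a \<le> g z \<and> g z \<le> b)"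
  by (auto simp: continuous_map_in_subtopology image_subset_iff)

lemma cube_boundary_subset: "cube_boundary k \<subseteq> topspace (cube k)"
  by (auto simp: cube_boundary_def)

lemma compact_space_cube: "compact_space (cube k)"
  by (auto simp: cube_def compact_space_product_topology compact_space_subtopology)

text \<open>The supremum norm of \<open>2 x - 1\<close>: the cube is its unit ball, the boundary its unit sphere.\<close>

primrec cube_norm :: "nat \<Rightarrow> (nat \<Rightarrow> real) \<Rightarrow> real" where
  "cube_norm 0 x = 0"
| "cube_norm (Suc k) x = max (cube_norm k x) \<bar>2 * x k - 1\<bar>"

lemma cube_norm_ge: "i < k \<Longrightarrow> \<bar>2 * x i - 1\<bar> \<le> cube_norm k x"
  by (induction k) (auto simp: less_Suc_eq)

lemma cube_norm_cong: "(\<And>i. i < k \<Longrightarrow> x i = y i) \<Longrightarrow> cube_norm k x = cube_norm k y"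
  by (induction k) auto

lemma cube_norm_attained: "cube_norm k x = 0 \<or> (\<exists>i<k. cube_norm k x = \<bar>2 * x i - 1\<bar>)"
  by (induction k) (auto simp: less_Suc_eq max_def)

text \<open>The argument on the left is the dilation by \<open>1 / m\<close> about the centre of the
  cube, from which the radial projection is built.\<close>

lemma cube_norm_scale:
  "m > 0 \<Longrightarrow> cube_norm k (\<lambda>i. 1/2 + (x i - 1/2) / m) = cube_norm k x / m"
proof (induction k)
  case (Suc k)
  have "2 * (1/2 + (x k - 1/2) / m) - 1 = (2 * x k - 1) / m"
    using Suc.prems by (simp add: field_simps)
  then have "\<bar>2 * (1/2 + (x k - 1/2) / m) - 1\<bar> = \<bar>2 * x k - 1\<bar> / m"
    using Suc.prems by simp
  with Suc show ?case
    by (simp add: max_divide_distrib_right)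
qed simp

lemma cube_norm_le_1: "x \<in> topspace (cube k) \<Longrightarrow> cube_norm k x \<le> 1"
  using cube_norm_attained[of k x] by (fastforce simp: topspace_cube PiE_iff abs_le_iff)

lemma cube_norm_boundary: "x \<in> topspace (cube k) \<Longrightarrow> cube_norm k x = 1 \<longleftrightarrow> x \<in> cube_boundary k"
proof
  assume x: "x \<in> topspace (cube k)" and "cube_norm k x = 1"
  then obtain i where "i < k" "\<bar>2 * x i - 1\<bar> = 1"
    using cube_norm_attained[of k x] by force
  with x show "x \<in> cube_boundary k"
    by (force simp: cube_boundary_def abs_if split: if_splits)
next
  assume x: "x \<in> topspace (cube k)" and "x \<in> cube_boundary k"
  then obtain i where "i < k" "\<bar>2 * x i - 1\<bar> = 1"
    by (auto simp: cube_boundary_def)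
  then show "cube_norm k x = 1"
    using cube_norm_ge[of i k x] cube_norm_le_1[OF x] by linarith
qed

lemma continuous_map_cube_norm: "continuous_map (cube k) euclideanreal (cube_norm k)"
proof -
  have "continuous_map (cube k) euclideanreal (cube_norm j)" if "j \<le> k" for j
    using that
  proof (induction j)
    case (Suc j)
    have "continuous_map (cube k) euclideanreal (\<lambda>x. x j)"
      using continuous_map_cube_coord[of j k] Suc.prems by (simp add: continuous_map_into_Icc)
    then show ?case
      using Suc by (auto intro!: continuous_intros)
  qed (simp add: cube_norm.simps(1)[abs_def])
  then show ?thesis by simp
qed

lemma closedin_cube_boundary: "closedin (cube k) (cube_boundary k)"
proof -
  have "cube_boundary k = {x \<in> topspace (cube k). cube_norm k x \<in> {1}}"
    using cube_norm_boundary cube_boundary_subset by (auto simp: subset_iff)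
  then show ?thesis
    using closedin_continuous_map_preimage[OF continuous_map_cube_norm, of "{1}" k] by simp
qed

text \<open>The homotopy extension property of the pair (cube, boundary). The cylinder is retracted by radial
  projection from the point at height \<open>2\<close> over the centre of the cube.\<close>

lemma cube_HEP:
  assumes phi: "continuous_map (cube k) W \<phi>"
    and H: "continuous_map (prod_topology I01 (subtopology (cube k) (cube_boundary k))) W H"
    and eq: "\<And>b. b \<in> cube_boundary k \<Longrightarrow> H (0, b) = \<phi> b"
  obtains G where "continuous_map (prod_topology I01 (cube k)) W G"
    "\<And>x. x \<in> topspace (cube k) \<Longrightarrow> G (0, x) = \<phi> x"
    "\<And>t b. \<lbrakk>t \<in> {0..1}; b \<in> cube_boundary k\<rbrakk> \<Longrightarrow> G (t, b) = H (t, b)"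
proof -
  let ?P = "prod_topology I01 (cube k)"
  define m where "m z = max (1 - fst z / 2) (cube_norm k (snd z))" for z :: "real \<times> (nat \<Rightarrow> real)"
  define r where "r z = (\<lambda>i\<in>{..<k}. 1/2 + (snd z i - 1/2) / m z)" for z
  define r0 where "r0 z = 2 - (2 - fst z) / m z" for z
  define G where "G z = (if cube_norm k (snd z) \<le> 1 - fst z / 2 then \<phi> (r z) else H (r0 z, r z))" for z
  have m_pos: "m z > 0" if "z \<in> topspace ?P" for z
    using that by (auto simp: m_def)
  have m_nz: "m z \<noteq> 0" if "z \<in> topspace ?P" for z
    using m_pos[OF that] by simp
  have fst_cont: "continuous_map ?P euclideanreal fst"
    using continuous_map_fst continuous_map_in_subtopology by blast
  have norm_cont: "continuous_map ?P euclideanreal (\<lambda>z. cube_norm k (snd z))"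
    by (rule continuous_map_comp[OF continuous_map_cube_norm continuous_map_snd])
  have m_cont: "continuous_map ?P euclideanreal m"
    unfolding m_def by (intro continuous_intros fst_cont norm_cont) auto
  have coord_cont: "continuous_map ?P euclideanreal (\<lambda>z. snd z i)" if "i < k" for i
  proof -
    have "continuous_map ?P I01 (\<lambda>z. snd z i)"
      by (rule continuous_map_comp[OF continuous_map_cube_coord[OF that] continuous_map_snd])
    then show ?thesis
      by (simp only: continuous_map_into_Icc)
  qed
  have r_norm: "cube_norm k (r z) = cube_norm k (snd z) / m z" if "z \<in> topspace ?P" for z
    using cube_norm_scale[OF m_pos[OF that], of k "snd z"] cube_norm_cong[of k "r z"] by (simp add: r_def)
  have r_coord: "0 \<le> r z i \<and> r z i \<le> 1" if z: "z \<in> topspace ?P" and i: "i < k" for z i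
  proof -
    have "\<bar>2 * r z i - 1\<bar> \<le> 1"
    proof -
      have "cube_norm k (snd z) \<le> m z"
        by (simp add: m_def)
      then have "cube_norm k (r z) \<le> 1"
        using m_pos[OF z] by (simp add: r_norm[OF z] divide_le_eq_1)
      then show ?thesis
        using cube_norm_ge[OF i, of "r z"] by linarith
    qed
    then show ?thesis by linarith
  qed
  have r_cont: "continuous_map ?P (cube k) r"
    unfolding continuous_map_cube_iff
  proof (intro conjI allI impI)
    fix i assume i: "i < k"
    have "continuous_map ?P euclideanreal (\<lambda>z. 1/2 + (snd z i - 1/2) / m z)"
      by (intro continuous_intros coord_cont[OF i] m_cont m_nz)
    then have "continuous_map ?P euclideanreal (\<lambda>z. r z i)"
      using i by (simp add: r_def)
    then show "continuous_map ?P I01 (\<lambda>z. r z i)"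
      using r_coord i by (simp add: continuous_map_into_Icc)
  qed (auto simp: r_def)
  have r0_cont: "continuous_map ?P euclideanreal r0"
    unfolding r0_def by (intro continuous_intros fst_cont m_cont m_nz)
  define R where "R = {z \<in> topspace ?P. 1 - fst z / 2 \<le> cube_norm k (snd z)}"
  have R_m: "m z = cube_norm k (snd z)" if "z \<in> R" for z
    using that by (simp add: R_def m_def)
  have r_bd: "r z \<in> cube_boundary k" if "z \<in> R" for z
  proof -
    have z: "z \<in> topspace ?P" using that by (simp add: R_def)
    have "r z \<in> topspace (cube k)" 
      using r_cont z by (auto simp: continuous_map_def)
    moreover have "cube_norm k (r z) = 1"
      using r_norm[OF z] R_m[OF that] m_pos[OF z] by simp
    ultimately show ?thesis using cube_norm_boundary by blast
  qed
  have r0_I: "0 \<le> r0 z \<and> r0 z \<le> 1" if "z \<in> R" for z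
  proof -
    have z: "z \<in> topspace ?P" "1 - fst z / 2 \<le> m z" using that R_m[OF that] by (auto simp: R_def)
    moreover have "m z \<le> 1" using z cube_norm_le_1 by (auto simp: m_def)
    moreover have "fst z \<le> 1" using z by auto
    ultimately show ?thesis using m_pos[of z] by (simp add: r0_def field_simps)
  qed
  show thesis
  proof
    show "continuous_map ?P W G"
      unfolding G_def
    proof (rule continuous_map_cases_le)
      show "continuous_map ?P euclideanreal (\<lambda>z. 1 - fst z / 2)"
        by (intro continuous_intros fst_cont) auto
      show "continuous_map (subtopology ?P {x \<in> topspace ?P. cube_norm k (snd x) \<le> 1 - fst x / 2}) W (\<lambda>z. \<phi> (r z))"
        by (intro continuous_map_from_subtopology continuous_map_comp[OF phi r_cont])
      have "continuous_map (subtopology ?P R) (prod_topology I01 (subtopology (cube k) (cube_boundary k))) (\<lambda>z. (r0 z, r z))"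
      proof (subst continuous_map_paired, intro conjI)
        show "continuous_map (subtopology ?P R) I01 r0"
          by (subst continuous_map_into_Icc, intro conjI ballI continuous_map_from_subtopology r0_cont)
            (simp_all only: topspace_subtopology Int_iff r0_I)
        show "continuous_map (subtopology ?P R) (subtopology (cube k) (cube_boundary k)) r"
          by (rule continuous_map_into_subtopology[OF continuous_map_from_subtopology[OF r_cont]])
            (simp add: Pi_iff r_bd del: topspace_prod_topology)
      qed
      then show "continuous_map (subtopology ?P {x \<in> topspace ?P. 1 - fst x / 2 \<le> cube_norm k (snd x)}) W (\<lambda>z. H (r0 z, r z))"
        using continuous_map_comp[OF H] unfolding R_def by blast
      fix z assume z: "z \<in> topspace ?P" and e: "cube_norm k (snd z) = 1 - fst z / 2"
      then have "z \<in> R" by (simp add: R_def)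
      moreover have "m z = 1 - fst z / 2" by (simp add: m_def e)
      then have "r0 z = 0" using m_pos[OF z] by (simp add: r0_def field_simps)
      ultimately show "\<phi> (r z) = H (r0 z, r z)" using eq r_bd by simp
    qed (fact norm_cont)
    \<comment> \<open>Points of the bottom and of the side have \<open>m = 1\<close> and are
      therefore fixed by the projection.\<close>
    have r_id: "r (t, x) = x" if "m (t,x) = 1" "x \<in> topspace (cube k)" for t x
      using that by (auto simp: r_def topspace_cube PiE_def extensional_def fun_eq_iff)
    fix x assume x: "x \<in> topspace (cube k)"
    then have "m (0,x) = 1" using cube_norm_le_1 by (simp add: m_def)
    with x show "G (0, x) = \<phi> x"
      using cube_norm_le_1[OF x] r_id by (simp add: G_def)
  next
    fix t b assume t: "t \<in> {0..1::real}" and b: "b \<in> cube_boundary k"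
    then have bx: "b \<in> topspace (cube k)" and n1: "cube_norm k b = 1"
      using cube_boundary_subset cube_norm_boundary by blast+
    then have m1: "m (t,b) = 1" using t by (auto simp: m_def)
    then have "r (t,b) = b" using bx by (auto simp: r_def topspace_cube PiE_def extensional_def fun_eq_iff)
    with m1 n1 t eq[OF b] show "G (t, b) = H (t, b)"
      by (auto simp: G_def r0_def)
  qed
qed

section \<open>Prisms over cubes\<close>

lemma continuous_map_comp2:
  assumes "continuous_map (prod_topology A B) C h" "continuous_map Z A a" "continuous_map Z B b"
  shows "continuous_map Z C (\<lambda>z. h (a z, b z))"
  by (rule continuous_map_comp[OF assms(1)]) (simp add: continuous_map_paired assms)

lemma continuous_map_slice:
  assumes "continuous_map (prod_topology A B) C h" "t \<in> topspace A"
  shows "continuous_map B C (\<lambda>x. h (t, x))"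
  by (rule continuous_map_comp2[OF assms(1)]) (simp_all add: assms(2))

lemma continuous_map_closed_Un:
  assumes "closedin X S" "closedin X T" "topspace X \<subseteq> S \<union> T"
    and "continuous_map (subtopology X S) Y f" "continuous_map (subtopology X T) Y f"
  shows "continuous_map X Y f"
proof (rule pasting_lemma_closed[where I = "{S, T}" and T = id and f = "\<lambda>_. f"])
  show "\<exists>j. j \<in> {S, T} \<and> x \<in> id j \<and> f x = f x" if "x \<in> topspace X" for x
    using assms(3) that by auto
qed (use assms in auto)

abbreviation prism :: "nat \<Rightarrow> (real \<times> (nat \<Rightarrow> real)) topology" where
  "prism m \<equiv> prod_topology I01 (cube m)"

definition prism_boundary :: "nat \<Rightarrow> (real \<times> (nat \<Rightarrow> real)) set" where
  "prism_boundary m = {(t, x) \<in> topspace (prism m). t = 0 \<or> t = 1 \<or> x \<in> cube_boundary m}"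

text \<open>Coordinate \<open>m\<close>, the last one of the larger cube, becomes the height. The
  restriction is there because points of \<open>cube m\<close> are extensional functions.\<close>

definition to_prism :: "nat \<Rightarrow> (nat \<Rightarrow> real) \<Rightarrow> real \<times> (nat \<Rightarrow> real)" where
  "to_prism m y = (y m, restrict y {..<m})"

definition of_prism :: "nat \<Rightarrow> real \<times> (nat \<Rightarrow> real) \<Rightarrow> nat \<Rightarrow> real" where
  "of_prism m p = (snd p)(m := fst p)"

lemma to_prism_continuous: "continuous_map (cube (Suc m)) (prism m) (to_prism m)"
  unfolding to_prism_def continuous_map_paired continuous_map_cube_iff
  by (auto simp: continuous_map_cube_coord)

lemma of_prism_continuous: "continuous_map (prism m) (cube (Suc m)) (of_prism m)"
  unfolding continuous_map_cube_iff
proof (intro conjI allI impI)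
  show "of_prism m \<in> topspace (prism m) \<rightarrow> extensional {..<Suc m}"
    by (auto simp: of_prism_def topspace_cube PiE_def extensional_def)
  fix i assume "i < Suc m"
  then consider "i = m" | "i < m" by linarith
  then show "continuous_map (prism m) I01 (\<lambda>z. of_prism m z i)"
  proof cases
    case 1
    then show ?thesis by (simp add: of_prism_def continuous_map_fst)
  next
    case 2
    then have "continuous_map (prism m) I01 (\<lambda>z. snd z i)"
      by (intro continuous_map_comp[OF continuous_map_cube_coord continuous_map_snd])
    with 2 show ?thesis by (simp add: of_prism_def)
  qed
qed

lemma to_of_prism: "p \<in> topspace (prism m) \<Longrightarrow> to_prism m (of_prism m p) = p"
  by (auto simp: to_prism_def of_prism_def topspace_cube PiE_def extensional_def fun_eq_iff prod_eq_iff)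

lemma of_to_prism: "y \<in> topspace (cube (Suc m)) \<Longrightarrow> of_prism m (to_prism m y) = y"
  by (auto simp: to_prism_def of_prism_def topspace_cube PiE_def extensional_def fun_eq_iff)

lemma to_prism_boundary: "y \<in> cube_boundary (Suc m) \<Longrightarrow> to_prism m y \<in> prism_boundary m"
  by (auto simp: cube_boundary_def prism_boundary_def to_prism_def topspace_cube PiE_iff less_Suc_eq)

lemma of_prism_boundary: "p \<in> prism_boundary m \<Longrightarrow> of_prism m p \<in> cube_boundary (Suc m)"
  unfolding cube_boundary_def prism_boundary_def of_prism_def topspace_cube
  by (auto simp: PiE_iff less_Suc_eq extensional_def topspace_cube)

lemma prism_boundary_subset: "prism_boundary m \<subseteq> topspace (prism m)"
  by (auto simp: prism_boundary_def)

text \<open>\<open>cube_HEP\<close> is transported along the homeomorphism with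
  \<open>cube (Suc m)\<close>, which matches the boundaries. Since a prism is the domain of a
  homotopy between maps of a cube, this serves to deform homotopies.\<close>

lemma prism_HEP:
  assumes phi: "continuous_map (prism m) W \<phi>"
    and H: "continuous_map (prod_topology I01 (subtopology (prism m) (prism_boundary m))) W H"
    and eq: "\<And>b. b \<in> prism_boundary m \<Longrightarrow> H (0, b) = \<phi> b"
  obtains G where "continuous_map (prod_topology I01 (prism m)) W G"
    "\<And>x. x \<in> topspace (prism m) \<Longrightarrow> G (0, x) = \<phi> x"
    "\<And>t b. \<lbrakk>t \<in> {0..1}; b \<in> prism_boundary m\<rbrakk> \<Longrightarrow> G (t, b) = H (t, b)"
proof -
  let ?Q = "cube (Suc m)" and ?B = "cube_boundary (Suc m)"
  have phi': "continuous_map ?Q W (\<lambda>y. \<phi> (to_prism m y))"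
    by (rule continuous_map_comp[OF phi to_prism_continuous])
  have "continuous_map (subtopology ?Q ?B) (subtopology (prism m) (prism_boundary m)) (to_prism m)"
    by (rule continuous_map_into_subtopology[OF continuous_map_from_subtopology[OF to_prism_continuous]])
      (auto simp: to_prism_boundary)
  then have H': "continuous_map (prod_topology I01 (subtopology ?Q ?B)) W (\<lambda>z. H (fst z, to_prism m (snd z)))"
    by (intro continuous_map_comp2[OF H] continuous_map_fst continuous_map_comp[OF _ continuous_map_snd])
  obtain G where G: "continuous_map (prod_topology I01 ?Q) W G"
    and G0: "\<And>x. x \<in> topspace ?Q \<Longrightarrow> G (0, x) = \<phi> (to_prism m x)"
    and GB: "\<And>t b. \<lbrakk>t \<in> {0..1}; b \<in> ?B\<rbrakk> \<Longrightarrow> G (t, b) = H (fst (t, b), to_prism m (snd (t, b)))"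
    by (rule cube_HEP[OF phi' H']) (auto simp: to_prism_boundary eq)
  show thesis
  proof
    show "continuous_map (prod_topology I01 (prism m)) W (\<lambda>z. G (fst z, of_prism m (snd z)))"
      by (intro continuous_map_comp2[OF G] continuous_map_fst continuous_map_comp[OF of_prism_continuous continuous_map_snd])
  next
    fix x assume x: "x \<in> topspace (prism m)"
    then have "of_prism m x \<in> topspace ?Q"
      using of_prism_continuous[of m] by (auto simp: continuous_map_def)
    then show "G (fst (0, x), of_prism m (snd (0, x))) = \<phi> x"
      using G0 to_of_prism[OF x] by simp
  next
    fix t :: real and b assume "t \<in> {0..1}" and b: "b \<in> prism_boundary m"
    then show "G (fst (t, b), of_prism m (snd (t, b))) = H (t, b)"
      using GB[of t "of_prism m b"] to_of_prism[of b m] of_prism_boundary[OF b] prism_boundary_subset[of m]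
      by auto
  qed
qed

lemma continuous_map_subtopology_id: "continuous_map (subtopology X S) X (\<lambda>x. x)"
  by (simp add: continuous_map_from_subtopology)

lemma prism_boundary_cylinder_projections:
  fixes m defines "IB \<equiv> prod_topology I01 (subtopology (prism m) (prism_boundary m))"
  shows "continuous_map IB (prism m) snd"
    and "continuous_map IB I01 (\<lambda>z. fst (snd z))" "continuous_map IB (cube m) (\<lambda>z. snd (snd z))"
proof -
  show *: "continuous_map IB (prism m) snd"
    unfolding IB_def by (rule continuous_map_comp[OF continuous_map_subtopology_id continuous_map_snd])
  show "continuous_map IB I01 (\<lambda>z. fst (snd z))" "continuous_map IB (cube m) (\<lambda>z. snd (snd z))"
    by (rule continuous_map_comp[OF _ *], simp add: continuous_map_fst continuous_map_snd)+
qed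

lemma prism_boundary_cylinder_closed:
  fixes m defines "IB \<equiv> prod_topology I01 (subtopology (prism m) (prism_boundary m))"
  shows "closedin IB {z \<in> topspace IB. fst (snd z) = 0}" "closedin IB {z \<in> topspace IB. fst (snd z) = 1}"
    and "closedin IB {z \<in> topspace IB. snd (snd z) \<in> cube_boundary m}"
proof -
  have "closedin I01 {0}" "closedin I01 {1}"
    by (auto simp: Hausdorff_space_subtopology closedin_Hausdorff_singleton)
  then show "closedin IB {z \<in> topspace IB. fst (snd z) = 0}" "closedin IB {z \<in> topspace IB. fst (snd z) = 1}"
    unfolding IB_def
    using closedin_continuous_map_preimage[OF prism_boundary_cylinder_projections(2)]
    by (simp_all only: flip: singleton_iff[of _ "0::real"] singleton_iff[of _ "1::real"])
  show "closedin IB {z \<in> topspace IB. snd (snd z) \<in> cube_boundary m}"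
    unfolding IB_def
    by (rule closedin_continuous_map_preimage[OF prism_boundary_cylinder_projections(3) closedin_cube_boundary])
qed

section \<open>Homotopies of spheroids as maps of prisms\<close>

abbreviation spheroid_homotopic ::
    "nat \<Rightarrow> 'a based \<Rightarrow> ((nat \<Rightarrow> real) \<Rightarrow> 'a) \<Rightarrow> ((nat \<Rightarrow> real) \<Rightarrow> 'a) \<Rightarrow> bool" where
  "spheroid_homotopic k X \<equiv> homotopic_with (\<lambda>h. \<forall>t\<in>cube_boundary k. h t = snd X) (cube k) (fst X)"

lemma spheroid_homotopicI:
  assumes h: "continuous_map (prism k) (fst X) h"
    and "\<And>x. x \<in> topspace (cube k) \<Longrightarrow> h (0, x) = a x" "\<And>x. x \<in> topspace (cube k) \<Longrightarrow> h (1, x) = b x"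
    and "\<And>t x. \<lbrakk>t \<in> {0..1}; x \<in> cube_boundary k\<rbrakk> \<Longrightarrow> h (t, x) = snd X"
  shows "spheroid_homotopic k X a b"
proof (subst homotopic_with)
  show "(\<forall>t\<in>cube_boundary k. f t = snd X) \<longleftrightarrow> (\<forall>t\<in>cube_boundary k. g t = snd X)"
    if "\<And>x. x \<in> topspace (cube k) \<Longrightarrow> f x = g x" for f g :: "(nat \<Rightarrow> real) \<Rightarrow> 'a"
    using that cube_boundary_subset[of k] by (metis subsetD)
qed (use assms in blast)

lemma spheroid_homotopicE:
  assumes "spheroid_homotopic k X a b"
  obtains h where "continuous_map (prism k) (fst X) h" "\<And>x. h (0, x) = a x" "\<And>x. h (1, x) = b x"
    "\<And>t x. \<lbrakk>t \<in> {0..1}; x \<in> cube_boundary k\<rbrakk> \<Longrightarrow> h (t, x) = snd X"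
  using assms unfolding homotopic_with_def by blast

lemma contractible_space_cube: "contractible_space (cube k)"
  unfolding cube_def by (simp add: contractible_space_product_topology convex_imp_contractible)

lemma homotopy_concat:
  assumes G: "continuous_map (prod_topology I01 Q) W G" and G': "continuous_map (prod_topology I01 Q) W G'"
    and eq: "\<And>x. x \<in> topspace Q \<Longrightarrow> G (1, x) = G' (0, x)"
  shows "continuous_map (prod_topology I01 Q) W
    (\<lambda>z. if fst z \<le> 1/2 then G (2 * fst z, snd z) else G' (2 * fst z - 1, snd z))"
proof (rule continuous_map_cases_le)
  let ?P = "prod_topology I01 Q"
  show fst: "continuous_map ?P euclideanreal fst"
    using continuous_map_fst continuous_map_in_subtopology by blast
  show "continuous_map (subtopology ?P {x \<in> topspace ?P. fst x \<le> 1/2}) W (\<lambda>z. G (2 * fst z, snd z))"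
  proof (rule continuous_map_comp2[OF G])
    show "continuous_map (subtopology ?P {x \<in> topspace ?P. fst x \<le> 1/2}) I01 (\<lambda>z. 2 * fst z)"
      by (subst continuous_map_into_Icc, intro conjI continuous_intros continuous_map_from_subtopology fst) auto
  qed (intro continuous_map_from_subtopology continuous_map_snd)
  show "continuous_map (subtopology ?P {x \<in> topspace ?P. 1/2 \<le> fst x}) W (\<lambda>z. G' (2 * fst z - 1, snd z))"
  proof (rule continuous_map_comp2[OF G'])
    show "continuous_map (subtopology ?P {x \<in> topspace ?P. 1/2 \<le> fst x}) I01 (\<lambda>z. 2 * fst z - 1)"
      by (subst continuous_map_into_Icc, intro conjI continuous_intros continuous_map_from_subtopology fst) auto
  qed (intro continuous_map_from_subtopology continuous_map_snd)
  fix z assume "z \<in> topspace ?P" "fst z = 1/2"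
  then have z: "2 * fst z = 1" "snd z \<in> topspace Q"
    by auto
  show "G (2 * fst z, snd z) = G' (2 * fst z - 1, snd z)"
    unfolding z(1) using eq[OF z(2)] by simp
qed simp

section \<open>Weak equivalences lift maps of cubes\<close>

text \<open>On the injective side only a trivial kernel is asked for, since only null-homotopies
  have to be lifted. Dimension 0 is included, where spheroids are arbitrary points; extension over
  an edge and lifting over a vertex rely on it.\<close>

locale weak_equivalence =
  fixes Z :: "'z based" and W :: "'w based" and f :: "'z \<Rightarrow> 'w"
  assumes f_based: "f \<in> based_maps Z W"
    and path_connected_Z: "path_connected_space (fst Z)" and path_connected_W: "path_connected_space (fst W)"
    and base_Z: "snd Z \<in> topspace (fst Z)"
    and inj: "\<And>m a. \<lbrakk>a \<in> spheroids m Z; spheroid_homotopic m W (\<lambda>_. snd W) (f \<circ> a)\<rbrakk>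
                \<Longrightarrow> spheroid_homotopic m Z (\<lambda>_. snd Z) a"
    and surj: "\<And>m b. b \<in> spheroids m W \<Longrightarrow> \<exists>a\<in>spheroids m Z. spheroid_homotopic m W b (f \<circ> a)"
begin

lemma f_continuous: "continuous_map (fst Z) (fst W) f" and f_base: "f (snd Z) = snd W"
  using f_based by (auto simp: based_maps_def)

text \<open>A map on a contractible domain is homotopic to a constant, and the constant moves along
  a path to the base point. The homotopy is free: it moves the boundary values too, as is
  intended.\<close>

lemma contract_to_base:
  assumes e: "continuous_map P (fst Z) e" and P: "contractible_space P"
  obtains A where "continuous_map (prod_topology I01 P) (fst Z) A"
    "\<And>p. A (0, p) = e p" "\<And>p. A (1, p) = snd Z"
proof -
  obtain c where c: "homotopic_with (\<lambda>x. True) P (fst Z) e (\<lambda>x. c)"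
    using nullhomotopic_from_contractible_space[OF e P] by blast
  have "homotopic_with (\<lambda>x. True) P (fst Z) (\<lambda>x. c) (\<lambda>x. snd Z)"
  \<comment> \<open>On an empty domain the constant \<open>c\<close> need not be a point of
    \<open>Z\<close>.\<close>
  proof (cases "P = trivial_topology")
    case False
    then obtain p where "p \<in> topspace P" by fastforce
    with homotopic_with_imp_continuous_maps[OF c] have "c \<in> topspace (fst Z)"
      by (auto simp: continuous_map_def)
    then show ?thesis
      using path_connected_Z base_Z by (simp add: homotopic_constant_maps path_connected_space_iff_path_component)
  qed (simp add: homotopic_on_empty)
  then have "homotopic_with (\<lambda>x. True) P (fst Z) e (\<lambda>x. snd Z)"
    using c homotopic_with_trans by blast
  then show thesis
    using that unfolding homotopic_with_def by blast
qed

text \<open>A homotopy of \<open>\<alpha>\<close> that contracts all of the boundary but the top face turns \<open>\<alpha>\<close> into a spheroid on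
  the top face, which is null-homotopic because its image in \<open>W\<close> is.\<close>

lemma prism_extension:
  assumes alpha: "continuous_map (subtopology (prism m) (prism_boundary m)) (fst Z) \<alpha>"
    and beta: "continuous_map (prism m) (fst W) \<beta>"
    and eq: "\<And>p. p \<in> prism_boundary m \<Longrightarrow> \<beta> p = f (\<alpha> p)"
  obtains E where "continuous_map (prism m) (fst Z) E" "\<And>p. p \<in> prism_boundary m \<Longrightarrow> E p = \<alpha> p"
proof -
  let ?Q = "cube m" and ?B = "cube_boundary m" and ?P = "prism m" and ?bP = "prism_boundary m"
  have bdI: "(t, x) \<in> ?bP" if "t \<in> {0..1}" "x \<in> topspace ?Q" "t = 0 \<or> t = 1 \<or> x \<in> ?B" for t x
    using that by (auto simp: prism_boundary_def)
  have face: "continuous_map ?Q (fst Z) (\<lambda>x. \<alpha> (t, x))" if "t = 0 \<or> t = 1" for t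
  proof (rule continuous_map_comp[OF alpha continuous_map_into_subtopology])
    show "continuous_map ?Q ?P (Pair t)"
      using that by (auto simp: continuous_map_paired)
  qed (use that bdI in auto)
  have "continuous_map (prod_topology I01 (subtopology ?Q ?B)) (subtopology ?P ?bP) (\<lambda>z. (fst z, snd z))"
  proof (rule continuous_map_into_subtopology)
    have "continuous_map (prod_topology I01 (subtopology ?Q ?B)) ?Q snd"
      using continuous_map_snd continuous_map_in_subtopology by blast
    then show "continuous_map (prod_topology I01 (subtopology ?Q ?B)) ?P (\<lambda>z. (fst z, snd z))"
      by (subst continuous_map_paired) (simp add: continuous_map_fst)
  qed (use bdI in auto)
  from continuous_map_comp[OF alpha this]
  have side: "continuous_map (prod_topology I01 (subtopology ?Q ?B)) (fst Z) \<alpha>"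
    by simp
  \<comment> \<open>Bottom and sides are the domain of the data in \<open>cube_HEP\<close>, with the
    height as time. So \<open>e\<close> agrees with \<alpha> on the boundary except possibly inside
    the top face.\<close>
  obtain e where e: "continuous_map ?P (fst Z) e"
    and e0: "\<And>x. x \<in> topspace ?Q \<Longrightarrow> e (0, x) = \<alpha> (0, x)"
    and eB: "\<And>t b. \<lbrakk>t \<in> {0..1}; b \<in> ?B\<rbrakk> \<Longrightarrow> e (t, b) = \<alpha> (t, b)"
    by (rule cube_HEP[OF face side]) auto
  have "contractible_space ?P"
    by (simp add: contractible_space_prod_topology contractible_space_cube convex_imp_contractible)
  with e obtain A where A: "continuous_map (prod_topology I01 ?P) (fst Z) A"
    and A0: "\<And>p. A (0, p) = e p" and A1: "\<And>p. A (1, p) = snd Z"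
    using contract_to_base by blast
  have "continuous_map (prod_topology I01 (subtopology ?Q ?B)) ?P (\<lambda>z. (1, snd z))"
    unfolding continuous_map_paired
    by (auto intro: continuous_map_comp[OF continuous_map_subtopology_id continuous_map_snd])
  then have A_side: "continuous_map (prod_topology I01 (subtopology ?Q ?B)) (fst Z) (\<lambda>z. A (fst z, (1, snd z)))"
    by (intro continuous_map_comp2[OF A] continuous_map_fst)
  \<comment> \<open>Inside the top face \<open>e\<close> may differ from \<alpha>, so the
    contraction of \<open>e\<close> does not start at \<alpha> there. The top face is deformed
    separately, following \<open>A\<close> on its rim.\<close>
  obtain C where C: "continuous_map ?P (fst Z) C"
    and C0: "\<And>x. x \<in> topspace ?Q \<Longrightarrow> C (0, x) = \<alpha> (1, x)"
    and CB: "\<And>s b. \<lbrakk>s \<in> {0..1}; b \<in> ?B\<rbrakk> \<Longrightarrow> C (s, b) = A (s, (1, b))"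
    by (rule cube_HEP[OF face[of 1] A_side]) (auto simp: A0 eB)
  \<comment> \<open>\<open>D\<close> deforms \<alpha> into the map that is the spheroid
    \<open>C (1, x)\<close> on the top face and the base point on the rest of the boundary.\<close>
  define D where "D z = (if fst (snd z) = 1 then C (fst z, snd (snd z)) else A z)" for z
  let ?IB = "prod_topology I01 (subtopology ?P ?bP)"
  note bP_proj = prism_boundary_cylinder_projections(2,3,1)[of m]
  have D: "continuous_map ?IB (fst Z) D"
  proof (rule continuous_map_closed_Un)
    let ?S = "{z \<in> topspace ?IB. fst (snd z) = 1}"
    let ?T = "{z \<in> topspace ?IB. fst (snd z) = 0} \<union> {z \<in> topspace ?IB. snd (snd z) \<in> ?B}"
    show "closedin ?IB ?S" "closedin ?IB ?T"
      by (intro closedin_Un prism_boundary_cylinder_closed)+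
    show "topspace ?IB \<subseteq> ?S \<union> ?T"
      by (auto simp: prism_boundary_def)
    show "continuous_map (subtopology ?IB ?S) (fst Z) D"
    proof (rule continuous_map_eq)
      show "continuous_map (subtopology ?IB ?S) (fst Z) (\<lambda>z. C (fst z, snd (snd z)))"
        by (intro continuous_map_from_subtopology continuous_map_comp2[OF C] continuous_map_fst bP_proj)
    qed (auto simp: D_def)
    show "continuous_map (subtopology ?IB ?T) (fst Z) D"
    proof (rule continuous_map_eq)
      show "continuous_map (subtopology ?IB ?T) (fst Z) (\<lambda>z. A (fst z, snd z))"
        by (intro continuous_map_from_subtopology continuous_map_comp2[OF A] continuous_map_fst bP_proj)
    qed (auto simp: D_def CB)
  qed
  have D0: "D (0, p) = \<alpha> p" if "p \<in> ?bP" for p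
    using that by (auto simp: D_def prism_boundary_def A0 C0 e0 eB)
  have D1: "D (1, (t, x)) = (if t = 1 then C (1, x) else snd Z)" for t x
    by (simp add: D_def A1)
  have fD: "continuous_map ?IB (fst W) (\<lambda>z. f (D z))"
    by (rule continuous_map_comp[OF f_continuous D])
  \<comment> \<open>At time 1, read along the height of the prism, \<open>E1\<close> is a
    null-homotopy of the image in \<open>W\<close> of the top spheroid.\<close>
  obtain E1 where E1: "continuous_map (prod_topology I01 ?P) (fst W) E1"
    and E1B: "\<And>s p. \<lbrakk>s \<in> {0..1}; p \<in> ?bP\<rbrakk> \<Longrightarrow> E1 (s, p) = f (D (s, p))"
    by (rule prism_HEP[OF beta fD]) (auto simp: D0 eq)
  define a where "a = (\<lambda>x. C (1, x))"
  have aB: "a b = snd Z" if "b \<in> ?B" for b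
    using that by (simp add: a_def CB A1)
  have "a \<in> spheroids m Z"
    using aB continuous_map_slice[OF C, of 1] by (simp add: spheroids_def a_def)
  moreover have "spheroid_homotopic m W (\<lambda>_. snd W) (f \<circ> a)"
  proof (rule spheroid_homotopicI)
    show "continuous_map ?P (fst W) (\<lambda>p. E1 (1, p))"
      by (rule continuous_map_slice[OF E1]) simp
  next
    fix t :: real and b assume "t \<in> {0..1}" and b: "b \<in> ?B"
    then have "(t, b) \<in> ?bP" using bdI cube_boundary_subset by blast
    then show "E1 (1, (t, b)) = snd W"
      using aB[OF b] by (simp add: E1B D1 f_base a_def)
  qed (auto simp: E1B bdI D1 f_base a_def)
  ultimately have "spheroid_homotopic m Z (\<lambda>_. snd Z) a"
    by (rule inj)
  then obtain N where N: "continuous_map ?P (fst Z) N" and N0: "\<And>x. N (0, x) = snd Z"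
    and N1: "\<And>x. N (1, x) = a x" and NB: "\<And>t x. \<lbrakk>t \<in> {0..1}; x \<in> ?B\<rbrakk> \<Longrightarrow> N (t, x) = snd Z"
    by (rule spheroid_homotopicE) blast
  have rev: "continuous_map I01 I01 (\<lambda>s. 1 - s)"
    by (auto simp: continuous_map_into_Icc intro!: continuous_intros)
  have D': "continuous_map ?IB (fst Z) (\<lambda>z. D (1 - fst z, snd z))"
    by (intro continuous_map_comp2[OF D] continuous_map_snd continuous_map_comp[OF rev continuous_map_fst])
  have ND: "N b = D (1, b)" if "b \<in> ?bP" for b
    using that aB by (cases b) (auto simp: prism_boundary_def D1 N0 N1 NB a_def)
  \<comment> \<open>\<open>N\<close> extends the final map of \<open>D\<close> over the prism.
    Running \<open>D\<close> backwards on the boundary turns it into an extension of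
    \<alpha>.\<close>
  obtain E2 where E2: "continuous_map (prod_topology I01 ?P) (fst Z) E2"
    and E2B: "\<And>s p. \<lbrakk>s \<in> {0..1}; p \<in> ?bP\<rbrakk> \<Longrightarrow> E2 (s, p) = D (1 - fst (s, p), snd (s, p))"
    by (rule prism_HEP[OF N D']) (auto simp: ND)
  show thesis
  proof
    show "continuous_map ?P (fst Z) (\<lambda>p. E2 (1, p))"
      by (rule continuous_map_slice[OF E2]) simp
  qed (simp add: E2B D0)
qed

text \<open>\<beta> is only a witness that \<open>f \<circ> \<alpha>\<close> extends over the cube;
  nothing is claimed about \<open>f \<circ> E\<close> in the interior, which is the task of
  \<open>cube_HELP\<close>.\<close>

lemma cube_extension:
  assumes alpha: "continuous_map (subtopology (cube k) (cube_boundary k)) (fst Z) \<alpha>"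
    and beta: "continuous_map (cube k) (fst W) \<beta>"
    and eq: "\<And>b. b \<in> cube_boundary k \<Longrightarrow> \<beta> b = f (\<alpha> b)"
  obtains E where "continuous_map (cube k) (fst Z) E" "\<And>b. b \<in> cube_boundary k \<Longrightarrow> E b = \<alpha> b"
proof (cases k)
  case 0
  show thesis
    by (rule that[of "\<lambda>_. snd Z"]) (auto simp: base_Z 0 cube_boundary_def)
next
  case (Suc m)
  have "continuous_map (subtopology (prism m) (prism_boundary m)) (subtopology (cube k) (cube_boundary k)) (of_prism m)"
    unfolding Suc
    by (rule continuous_map_into_subtopology[OF continuous_map_from_subtopology[OF of_prism_continuous]])
      (auto simp: of_prism_boundary)
  then have a: "continuous_map (subtopology (prism m) (prism_boundary m)) (fst Z) (\<lambda>p. \<alpha> (of_prism m p))"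
    by (rule continuous_map_comp[OF alpha])
  have b: "continuous_map (prism m) (fst W) (\<lambda>p. \<beta> (of_prism m p))"
    using beta unfolding Suc by (rule continuous_map_comp[OF _ of_prism_continuous])
  obtain E where E: "continuous_map (prism m) (fst Z) E"
    and EB: "\<And>p. p \<in> prism_boundary m \<Longrightarrow> E p = \<alpha> (of_prism m p)"
    by (rule prism_extension[OF a b]) (auto simp: eq Suc of_prism_boundary)
  show thesis
  proof
    show "continuous_map (cube k) (fst Z) (\<lambda>x. E (to_prism m x))"
      unfolding Suc by (rule continuous_map_comp[OF E to_prism_continuous])
    fix b assume "b \<in> cube_boundary k"
    then show "E (to_prism m b) = \<alpha> b"
      using subsetD[OF cube_boundary_subset, of b k] of_to_prism[of b m] by (simp add: EB Suc to_prism_boundary)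
  qed
qed

text \<open>The boundary values are first made constant, then the resulting spheroid is lifted, and the lift
  \<open>a\<close> is transported back. The boundary track of the homotopy obtained runs through \<open>M\<close> along \<open>\<rho>\<close> and
  is finally straightened to the given one.\<close>

lemma cube_HELP:
  assumes phi: "continuous_map (cube k) (fst W) \<phi>"
    and alpha: "continuous_map (subtopology (cube k) (cube_boundary k)) (fst Z) \<alpha>"
    and H: "continuous_map (prod_topology I01 (subtopology (cube k) (cube_boundary k))) (fst W) H"
    and H0: "\<And>b. b \<in> cube_boundary k \<Longrightarrow> H (0, b) = \<phi> b"
    and H1: "\<And>b. b \<in> cube_boundary k \<Longrightarrow> H (1, b) = f (\<alpha> b)"
  obtains \<psi> G where "continuous_map (cube k) (fst Z) \<psi>" "\<And>b. b \<in> cube_boundary k \<Longrightarrow> \<psi> b = \<alpha> b"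
    "continuous_map (prism k) (fst W) G"
    "\<And>x. x \<in> topspace (cube k) \<Longrightarrow> G (0, x) = \<phi> x" "\<And>x. x \<in> topspace (cube k) \<Longrightarrow> G (1, x) = f (\<psi> x)"
    "\<And>t b. \<lbrakk>t \<in> {0..1}; b \<in> cube_boundary k\<rbrakk> \<Longrightarrow> G (t, b) = H (t, b)"
proof -
  let ?Q = "cube k" and ?B = "cube_boundary k" and ?P = "prism k" and ?bP = "prism_boundary k"
  let ?QB = "subtopology ?Q ?B"
  let ?T2 = "prod_topology (top_of_set {0..2::real}) ?QB"
  \<comment> \<open>Only the end of \<open>G0\<close> matters: it extends
    \<open>f \<circ> \<alpha>\<close> over the cube, so that \<open>cube_extension\<close> can
    extend \<alpha> itself.\<close>
  obtain G0 where G0: "continuous_map ?P (fst W) G0"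
    and G0B: "\<And>t b. \<lbrakk>t \<in> {0..1}; b \<in> ?B\<rbrakk> \<Longrightarrow> G0 (t, b) = H (t, b)"
    by (rule cube_HEP[OF phi H H0]) auto
  have "continuous_map ?Q (fst W) (\<lambda>x. G0 (1, x))"
    by (rule continuous_map_slice[OF G0]) simp
  then obtain e where e: "continuous_map ?Q (fst Z) e" and eB: "\<And>b. b \<in> ?B \<Longrightarrow> e b = \<alpha> b"
    by (rule cube_extension[OF alpha]) (auto simp: G0B H1)
  obtain A where A: "continuous_map ?P (fst Z) A"
    and A0: "\<And>p. A (0, p) = e p" and A1: "\<And>p. A (1, p) = snd Z"
    by (rule contract_to_base[OF e contractible_space_cube]) blast
  have QB_snd: "continuous_map (prod_topology T ?QB) ?Q snd" for T :: "real topology"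
    by (rule continuous_map_comp[OF continuous_map_subtopology_id continuous_map_snd])
  \<comment> \<open>\<open>M\<close> is a track of length 2 for the boundary values: along
    \<open>H\<close> to \<open>f \<circ> \<alpha>\<close>, then along the image of the contraction
    to the base point.\<close>
  define M where "M z = (if fst z \<le> 1 then H z else f (A (fst z - 1, snd z)))" for z
  have M: "continuous_map ?T2 (fst W) M"
    unfolding M_def
  proof (rule continuous_map_cases_le)
    show fst: "continuous_map ?T2 euclideanreal fst"
      using continuous_map_fst continuous_map_in_subtopology by blast
    have "continuous_map (subtopology ?T2 {x \<in> topspace ?T2. fst x \<le> 1}) (fst W) (\<lambda>z. H (fst z, snd z))"
    proof (rule continuous_map_comp2[OF H])
      show "continuous_map (subtopology ?T2 {x \<in> topspace ?T2. fst x \<le> 1}) I01 fst"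
        by (subst continuous_map_into_Icc, intro conjI continuous_map_from_subtopology fst) auto
    qed (intro continuous_map_from_subtopology continuous_map_snd)
    then show "continuous_map (subtopology ?T2 {x \<in> topspace ?T2. fst x \<le> 1}) (fst W) H"
      by simp
    show "continuous_map (subtopology ?T2 {x \<in> topspace ?T2. 1 \<le> fst x}) (fst W) (\<lambda>z. f (A (fst z - 1, snd z)))"
    proof (rule continuous_map_comp[OF f_continuous continuous_map_comp2[OF A]])
      show "continuous_map (subtopology ?T2 {x \<in> topspace ?T2. 1 \<le> fst x}) I01 (\<lambda>z. fst z - 1)"
        by (subst continuous_map_into_Icc, intro conjI continuous_intros continuous_map_from_subtopology fst) auto
    qed (intro continuous_map_from_subtopology QB_snd)
  qed (auto simp: A0 eB H1)
  have M01: "M (t, b) = H (t, b)" if "t \<le> 1" for t b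
    using that by (simp add: M_def)
  have M12: "M (t, b) = f (A (t - 1, b))" if "1 \<le> t" "b \<in> ?B" for t b
    using that by (auto simp: M_def H1 A0 eB)
  have dbl: "continuous_map I01 (top_of_set {0..2}) (\<lambda>t. 2 * t)"
    by (auto simp: continuous_map_into_Icc intro!: continuous_intros)
  have M2: "continuous_map (prod_topology I01 ?QB) (fst W) (\<lambda>z. M (2 * fst z, snd z))"
    by (intro continuous_map_comp2[OF M] continuous_map_snd continuous_map_comp[OF dbl continuous_map_fst])
  obtain G1 where G1: "continuous_map ?P (fst W) G1"
    and G10: "\<And>x. x \<in> topspace ?Q \<Longrightarrow> G1 (0, x) = \<phi> x"
    and G1B: "\<And>t b. \<lbrakk>t \<in> {0..1}; b \<in> ?B\<rbrakk> \<Longrightarrow> G1 (t, b) = M (2 * fst (t, b), snd (t, b))"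
    by (rule cube_HEP[OF phi M2]) (auto simp: M01 H0)
  have "(\<lambda>x. G1 (1, x)) \<in> spheroids k W"
    using continuous_map_slice[OF G1, of 1] by (auto simp: spheroids_def G1B M12 A1 f_base)
  from surj[OF this] obtain a where a: "a \<in> spheroids k Z"
    and "spheroid_homotopic k W (\<lambda>x. G1 (1, x)) (f \<circ> a)" by blast
  then obtain K where K: "continuous_map ?P (fst W) K" and K0: "\<And>x. K (0, x) = G1 (1, x)"
    and K1: "\<And>x. K (1, x) = f (a x)" and KB: "\<And>t x. \<lbrakk>t \<in> {0..1}; x \<in> ?B\<rbrakk> \<Longrightarrow> K (t, x) = snd W"
    by (elim spheroid_homotopicE) auto
  have aB: "a b = snd Z" if "b \<in> ?B" for b
    using a that by (auto simp: spheroids_def)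
  have a_cont: "continuous_map ?Q (fst Z) a"
    using a by (auto simp: spheroids_def)
  have rev: "continuous_map I01 I01 (\<lambda>s. 1 - s)"
    by (auto simp: continuous_map_into_Icc intro!: continuous_intros)
  have Arev: "continuous_map (prod_topology I01 ?QB) (fst Z) (\<lambda>z. A (1 - fst z, snd z))"
    by (intro continuous_map_comp2[OF A] QB_snd continuous_map_comp[OF rev continuous_map_fst])
  \<comment> \<open>Undoing the contraction on the boundary moves the boundary values of the lift
    \<open>a\<close> from the base point back to \<alpha>.\<close>
  obtain L where L: "continuous_map ?P (fst Z) L"
    and L0: "\<And>x. x \<in> topspace ?Q \<Longrightarrow> L (0, x) = a x"
    and LB: "\<And>t b. \<lbrakk>t \<in> {0..1}; b \<in> ?B\<rbrakk> \<Longrightarrow> L (t, b) = A (1 - fst (t, b), snd (t, b))"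
    by (rule cube_HEP[OF a_cont Arev]) (auto simp: A1 aB)
  define \<psi> where "\<psi> x = L (1, x)" for x
  have \<psi>: "continuous_map ?Q (fst Z) \<psi>"
    unfolding \<psi>_def by (rule continuous_map_slice[OF L]) simp
  have \<psi>B: "\<psi> b = \<alpha> b" if "b \<in> ?B" for b
    using that by (simp add: \<psi>_def LB A0 eB)
  define GK where "GK z = (if fst z \<le> 1/2 then G1 (2 * fst z, snd z) else K (2 * fst z - 1, snd z))" for z
  have GK: "continuous_map ?P (fst W) GK"
    unfolding GK_def by (rule homotopy_concat[OF G1 K]) (simp add: K0)
  \<comment> \<open>The homotopy from \<phi> to \<open>f \<circ> \<psi>\<close> runs through
    \<open>G1\<close>, \<open>K\<close> and \<open>f \<circ> L\<close>; the first two share the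
    first half of the time.\<close>
  define V where "V z = (if fst z \<le> 1/2 then GK (2 * fst z, snd z) else f (L (2 * fst z - 1, snd z)))" for z
  have V: "continuous_map ?P (fst W) V"
    unfolding V_def by (rule homotopy_concat[OF GK continuous_map_comp[OF f_continuous L]]) (simp add: GK_def K1 L0)
  have V0: "V (0, x) = \<phi> x" if "x \<in> topspace ?Q" for x
    using that by (simp add: V_def GK_def G10)
  have V1: "V (1, x) = f (\<psi> x)" for x
    by (simp add: V_def \<psi>_def)
  \<comment> \<open>The position on the track \<open>M\<close> at time \<open>t\<close>: up to 2 at
    speed 8 during \<open>G1\<close>, at rest during \<open>K\<close>, back to 1 at speed 2 during
    \<open>f \<circ> L\<close>.\<close>
  define \<rho> where "\<rho> t = min (min (8 * t) 2) (3 - 2 * t)" for t :: real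
  have \<rho>_range: "0 \<le> \<rho> t \<and> \<rho> t \<le> 2" if "t \<in> {0..1}" for t
    using that by (auto simp: \<rho>_def)
  have VB: "V (t, b) = M (\<rho> t, b)" if "t \<in> {0..1}" "b \<in> ?B" for t b
  proof -
    consider "t \<le> 1/4" | "1/4 < t" "t \<le> 1/2" | "1/2 < t" by linarith
    then show ?thesis
    proof cases
      case 1
      then show ?thesis using that by (simp add: V_def GK_def G1B \<rho>_def min_def)
    next
      case 2
      then show ?thesis using that by (simp add: V_def GK_def KB \<rho>_def min_def M12 A1 f_base)
    next
      case 3
      then have "\<rho> t = 3 - 2 * t" by (simp add: \<rho>_def min_def)
      then show ?thesis using 3 that by (simp add: V_def LB M12)
    qed
  qed
  let ?IB = "prod_topology I01 (subtopology ?P ?bP)"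
  \<comment> \<open>Linear interpolation from \<rho> to the identity. Both go from 0 to 1, so the
    ends of the homotopy \<open>V\<close> stay fixed, and at the positions up to 1 the track
    \<open>M\<close> is \<open>H\<close>.\<close>
  define \<tau> where "\<tau> z = (1 - fst z) * \<rho> (fst (snd z)) + fst z * fst (snd z)" for z :: "real \<times> real \<times> (nat \<Rightarrow> real)"
  define U where "U z = (if snd (snd z) \<in> ?B then M (\<tau> z, snd (snd z)) else V (snd z))" for z
  note proj = prism_boundary_cylinder_projections[of k]
  have \<tau>: "continuous_map ?IB (top_of_set {0..2}) \<tau>"
    unfolding continuous_map_into_Icc
  proof (intro conjI ballI)
    have "continuous_map ?IB euclideanreal fst" "continuous_map ?IB euclideanreal (\<lambda>z. fst (snd z))"
      using continuous_map_fst proj(2) continuous_map_in_subtopology by blast+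
    then show "continuous_map ?IB euclideanreal \<tau>"
      unfolding \<tau>_def \<rho>_def by (intro continuous_intros) auto
  next
    fix z assume "z \<in> topspace ?IB"
    then have z: "fst z \<in> {0..1}" "fst (snd z) \<in> {0..1}" by auto
    have "(1 - fst z) * \<rho> (fst (snd z)) + fst z * fst (snd z) \<in> {0..2}"
      using convexD_alt[of "{0..2::real}" "\<rho> (fst (snd z))" "fst (snd z)" "fst z"] z \<rho>_range[OF z(2)]
      by simp
    then show "0 \<le> \<tau> z" "\<tau> z \<le> 2" by (simp_all add: \<tau>_def)
  qed
  have U_end: "U (s, (t, b)) = V (t, b)" if "s \<in> {0..1}" "t = 0 \<or> t = 1" "b \<in> topspace ?Q" for s t b
    using that by (auto simp: U_def \<tau>_def \<rho>_def M01 H0 H1 V0 V1 \<psi>B)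
  have U: "continuous_map ?IB (fst W) U"
  proof (rule continuous_map_closed_Un)
    let ?S = "{z \<in> topspace ?IB. fst (snd z) = 0} \<union> {z \<in> topspace ?IB. fst (snd z) = 1}"
    let ?R = "{z \<in> topspace ?IB. snd (snd z) \<in> ?B}"
    show "closedin ?IB ?S" "closedin ?IB ?R"
      by (intro closedin_Un prism_boundary_cylinder_closed)+
    show "topspace ?IB \<subseteq> ?S \<union> ?R"
      by (auto simp: prism_boundary_def)
    show "continuous_map (subtopology ?IB ?S) (fst W) U"
    proof (rule continuous_map_eq)
      show "continuous_map (subtopology ?IB ?S) (fst W) (\<lambda>z. V (snd z))"
        by (intro continuous_map_from_subtopology continuous_map_comp[OF V proj(1)])
    qed (auto simp: U_end)
    show "continuous_map (subtopology ?IB ?R) (fst W) U"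
    proof (rule continuous_map_eq)
      have "continuous_map (subtopology ?IB ?R) ?QB (\<lambda>z. snd (snd z))"
        by (intro continuous_map_into_subtopology continuous_map_from_subtopology proj(3)) auto
      then show "continuous_map (subtopology ?IB ?R) (fst W) (\<lambda>z. M (\<tau> z, snd (snd z)))"
        by (rule continuous_map_comp2[OF M continuous_map_from_subtopology[OF \<tau>]])
    qed (auto simp: U_def)
  qed
  have U0: "U (0, p) = V p" if "p \<in> ?bP" for p
    using that by (cases p) (auto simp: U_def \<tau>_def VB prism_boundary_def)
  obtain G where G: "continuous_map (prod_topology I01 ?P) (fst W) G"
    and GB: "\<And>s p. \<lbrakk>s \<in> {0..1}; p \<in> ?bP\<rbrakk> \<Longrightarrow> G (s, p) = U (s, p)"
    by (rule prism_HEP[OF V U U0]) auto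
  show thesis
  proof
    show "continuous_map ?P (fst W) (\<lambda>p. G (1, p))"
      by (rule continuous_map_slice[OF G]) simp
    show "G (1, (0, x)) = \<phi> x" "G (1, (1, x)) = f (\<psi> x)" if "x \<in> topspace ?Q" for x
      using that by (simp_all add: GB prism_boundary_def U_end V0 V1)
    show "G (1, (t, b)) = H (t, b)" if "t \<in> {0..1}" "b \<in> ?B" for t b
    proof -
      have "(t, b) \<in> ?bP"
        using that cube_boundary_subset by (auto simp: prism_boundary_def)
      with that show ?thesis by (simp add: GB U_def \<tau>_def M01)
    qed
  qed (use \<psi> \<psi>B in auto)
qed

end

section \<open>CW-complexes\<close>

locale CW_complex =
  fixes X :: "'a topology" and C
  assumes CW: "CW_structure X C"
begin

lemma Hausdorff: "Hausdorff_space X"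
  using CW by (simp add: CW_structure_def)

lemma cell_continuous: "c \<in> C \<Longrightarrow> continuous_map (cube (fst c)) X (snd c)"
  using CW by (force simp: CW_structure_def)

lemma cell_homeomorphic: "c \<in> C \<Longrightarrow>
    homeomorphic_map (subtopology (cube (fst c)) (cube_interior (fst c))) (subtopology X (open_cell c)) (snd c)"
  using CW by (force simp: CW_structure_def)

lemma cell_inj_on: "c \<in> C \<Longrightarrow> inj_on (snd c) (cube_interior (fst c))"
  using homeomorphic_imp_injective_map[OF cell_homeomorphic]
  by (simp add: cube_interior_def Int_absorb1)

lemma open_cells_disjoint: "\<lbrakk>c \<in> C; d \<in> C; x \<in> open_cell c; x \<in> open_cell d\<rbrakk> \<Longrightarrow> c = d"
  using CW unfolding CW_structure_def by blast

lemma Union_open_cells: "(\<Union>c\<in>C. open_cell c) = topspace X"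
  using CW by (simp add: CW_structure_def)

lemma cell_boundary_finite:
  assumes "c \<in> C"
  obtains F where "F \<subseteq> C" "finite F" "\<And>d. d \<in> F \<Longrightarrow> fst d < fst c"
    "snd c ` cube_boundary (fst c) \<subseteq> (\<Union>d\<in>F. open_cell d)"
proof -
  have "\<forall>(n, \<phi>)\<in>C. \<exists>F\<subseteq>C. finite F \<and> (\<forall>c\<in>F. fst c < n) \<and> \<phi> ` cube_boundary n \<subseteq> (\<Union>c\<in>F. open_cell c)"
    using CW by (simp add: CW_structure_def)
  then have "\<exists>F\<subseteq>C. finite F \<and> (\<forall>d\<in>F. fst d < fst c) \<and> snd c ` cube_boundary (fst c) \<subseteq> (\<Union>d\<in>F. open_cell d)"
    using assms by (cases c) auto
  with that show thesis by metis
qed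

lemma closedin_weak:
  "\<lbrakk>A \<subseteq> topspace X; \<And>c. c \<in> C \<Longrightarrow> closedin X (A \<inter> closed_cell c)\<rbrakk> \<Longrightarrow> closedin X A"
  using CW by (simp add: CW_structure_def)

lemma open_cell_subset: "open_cell c \<subseteq> closed_cell c"
  by (auto simp: open_cell_def closed_cell_def cube_interior_def)

lemma closed_cell_subset: "c \<in> C \<Longrightarrow> closed_cell c \<subseteq> topspace X"
  using cell_continuous by (fastforce simp: closed_cell_def continuous_map_def)

lemma closedin_closed_cell:
  assumes "c \<in> C"
  shows "closedin X (closed_cell c)"
proof -
  have "compactin X (closed_cell c)"
    unfolding closed_cell_def
    by (rule image_compactin[OF _ cell_continuous[OF assms]])
      (use compact_space_cube in \<open>simp add: compact_space_def\<close>)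
  with Hausdorff show ?thesis
    by (rule compactin_imp_closedin)
qed

lemma boundary_point:
  assumes "c \<in> C" "b \<in> cube_boundary (fst c)"
  obtains d where "d \<in> C" "fst d < fst c" "snd c b \<in> open_cell d"
proof -
  obtain F where F: "F \<subseteq> C" "\<And>d. d \<in> F \<Longrightarrow> fst d < fst c" "snd c ` cube_boundary (fst c) \<subseteq> (\<Union>d\<in>F. open_cell d)"
    using cell_boundary_finite[OF assms(1)] by metis
  with assms(2) obtain d where "d \<in> F" "snd c b \<in> open_cell d" by blast
  with F that show thesis by blast
qed

lemma closed_cell_point:
  assumes "c \<in> C" "q \<in> topspace (cube (fst c))"
  obtains d where "d \<in> C" "fst d \<le> fst c" "snd c q \<in> open_cell d"
proof (cases "q \<in> cube_boundary (fst c)")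
  case True
  then obtain d where "d \<in> C" "fst d < fst c" "snd c q \<in> open_cell d"
    by (rule boundary_point[OF assms(1)])
  with that show thesis by simp
next
  case False
  with assms have "snd c q \<in> open_cell c"
    by (auto simp: open_cell_def cube_interior_def)
  with assms that show thesis by blast
qed

lemma cell_quotient_map:
  assumes "c \<in> C"
  shows "quotient_map (cube (fst c)) (subtopology X (closed_cell c)) (snd c)"
proof (rule continuous_imp_quotient_map)
  show "continuous_map (cube (fst c)) (subtopology X (closed_cell c)) (snd c)"
    by (rule continuous_map_into_subtopology[OF cell_continuous[OF assms]]) (auto simp: closed_cell_def)
  show "snd c ` topspace (cube (fst c)) = topspace (subtopology X (closed_cell c))"
    using closed_cell_subset[OF assms] by (auto simp: closed_cell_def)
qed (simp_all add: compact_space_cube Hausdorff_space_subtopology Hausdorff)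

text \<open>Continuity is tested on the closed cell, pulled back along the characteristic map. Maps
  of the complex itself are regarded as homotopies constant in time, so one notion serves for
  both.\<close>

definition cell_continuous_on :: "'b topology \<Rightarrow> (real \<times> 'a \<Rightarrow> 'b) \<Rightarrow> (nat \<times> ((nat \<Rightarrow> real) \<Rightarrow> 'a)) \<Rightarrow> bool" where
  "cell_continuous_on Y H c \<longleftrightarrow> continuous_map (prism (fst c)) Y (\<lambda>z. H (fst z, snd c (snd z)))"

text \<open>The image of the boundary lies in finitely many lower cells, so pasting over their
  closures is possible. On each of them continuity descends from the prism, because the product of a
  quotient map with the locally compact interval is again a quotient map.\<close>

lemma cell_boundary_continuous:
  assumes c: "c \<in> C" and H: "\<And>d. \<lbrakk>d \<in> C; fst d < fst c\<rbrakk> \<Longrightarrow> cell_continuous_on Y H d"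
  shows "continuous_map (prod_topology I01 (subtopology (cube (fst c)) (cube_boundary (fst c)))) Y
           (\<lambda>z. H (fst z, snd c (snd z)))"
proof -
  let ?B = "cube_boundary (fst c)"
  let ?T = "prod_topology I01 (subtopology (cube (fst c)) ?B)"
  obtain F where F: "F \<subseteq> C" "finite F" "\<And>d. d \<in> F \<Longrightarrow> fst d < fst c"
    and cF: "snd c ` ?B \<subseteq> (\<Union>d\<in>F. open_cell d)"
    using cell_boundary_finite[OF c] by metis
  have c_cont: "continuous_map ?T X (\<lambda>z. snd c (snd z))"
    by (intro continuous_map_comp[OF _ continuous_map_snd] continuous_map_from_subtopology cell_continuous c)
  show ?thesis
  proof (rule pasting_lemma_closed[OF F(2), where T = "\<lambda>d. {z \<in> topspace ?T. snd c (snd z) \<in> closed_cell d}"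
        and f = "\<lambda>_ z. H (fst z, snd c (snd z))"])
    fix d assume d: "d \<in> F"
    then have dC: "d \<in> C" using F by blast
    let ?D = "{z \<in> topspace ?T. snd c (snd z) \<in> closed_cell d}"
    show "closedin ?T ?D"
      by (rule closedin_continuous_map_preimage[OF c_cont closedin_closed_cell[OF dC]])
    have q: "quotient_map (prism (fst d)) (prod_topology I01 (subtopology X (closed_cell d))) (\<lambda>(t, x). (t, snd d x))"
      by (rule quotient_map_prod_right[OF _ _ cell_quotient_map[OF dC]])
        (auto simp: compact_imp_locally_compact_space compact_space_subtopology Hausdorff_space_subtopology)
    have "continuous_map (prism (fst d)) Y (H \<circ> (\<lambda>(t, x). (t, snd d x)))"
      using H[OF dC F(3)[OF d]] by (simp add: cell_continuous_on_def o_def case_prod_beta')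
    from continuous_compose_quotient_map[OF q this]
    have Hd: "continuous_map (prod_topology I01 (subtopology X (closed_cell d))) Y H" .
    have "continuous_map (subtopology ?T ?D) (subtopology X (closed_cell d)) (\<lambda>z. snd c (snd z))"
      by (rule continuous_map_into_subtopology[OF continuous_map_from_subtopology[OF c_cont]]) auto
    then show "continuous_map (subtopology ?T ?D) Y (\<lambda>z. H (fst z, snd c (snd z)))"
      by (rule continuous_map_comp2[OF Hd continuous_map_from_subtopology[OF continuous_map_fst]])
  next
    fix z assume z: "z \<in> topspace ?T"
    then have "snd z \<in> ?B" by auto
    then obtain d where "d \<in> F" "snd c (snd z) \<in> open_cell d"
      using cF by blast
    then have "d \<in> F" "snd c (snd z) \<in> closed_cell d"
      using open_cell_subset[of d] by auto
    with z show "\<exists>d. d \<in> F \<and> z \<in> {z \<in> topspace ?T. snd c (snd z) \<in> closed_cell d} \<and>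
        H (fst z, snd c (snd z)) = H (fst z, snd c (snd z))"
      by blast
  qed auto
qed

text \<open>A tube argument replaces the fact that the product with the interval carries the weak topology.\<close>

lemma cellwise_continuous:
  assumes H: "\<And>c. c \<in> C \<Longrightarrow> cell_continuous_on Y H c"
  shows "continuous_map (prod_topology I01 X) Y H"
proof -
  have H_cell: "H (t, snd c q) \<in> topspace Y" if "c \<in> C" "t \<in> {0..1}" "q \<in> topspace (cube (fst c))" for c t q
    using H[OF that(1)] that(2,3) by (force simp: cell_continuous_on_def continuous_map_def)
  have cell: "\<exists>c q. c \<in> C \<and> q \<in> topspace (cube (fst c)) \<and> x = snd c q" if "x \<in> topspace X" for x
    using that Union_open_cells by (force simp: open_cell_def cube_interior_def)
  show ?thesis
    unfolding continuous_map_def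
  proof (intro conjI allI impI)
    show "H \<in> topspace (prod_topology I01 X) \<rightarrow> topspace Y"
    proof
      fix z assume "z \<in> topspace (prod_topology I01 X)"
      then obtain t x where z: "z = (t, x)" "t \<in> {0..1}" "x \<in> topspace X" by (cases z) auto
      with cell[of x] H_cell show "H z \<in> topspace Y" by blast
    qed
    fix U assume U: "openin Y U"
    show "openin (prod_topology I01 X) {z \<in> topspace (prod_topology I01 X). H z \<in> U}"
      unfolding openin_prod_topology_alt
    proof (intro allI impI)
      fix t0 x0 assume "(t0, x0) \<in> {z \<in> topspace (prod_topology I01 X). H z \<in> U}"
      then have t0: "t0 \<in> {0..1}" and x0: "x0 \<in> topspace X" and HU: "H (t0, x0) \<in> U" by auto
      obtain c0 q0 where c0: "c0 \<in> C" and q0: "q0 \<in> topspace (cube (fst c0))" "x0 = snd c0 q0"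
        using cell[OF x0] by blast
      have "continuous_map I01 Y (\<lambda>t. H (t, x0))"
        using continuous_map_comp2[OF H[OF c0, unfolded cell_continuous_on_def], of I01 "\<lambda>t. t" "\<lambda>_. q0"] q0
        by simp
      then have "openin I01 {t \<in> topspace I01. H (t, x0) \<in> U}"
        using U openin_continuous_map_preimage by blast
      then obtain e where e: "e > 0" "cball t0 e \<inter> {0..1} \<subseteq> {t \<in> topspace I01. H (t, x0) \<in> U}"
        using t0 HU unfolding openin_contains_cball by auto
      \<comment> \<open>These are the points whose whole segment over the closed ball lands in
        \<open>U\<close>. On each closed cell the complement of \<open>V\<close> is the image of a
        compact subset of the prism, hence closed; compactness is the reason for taking a closed
        ball.\<close>
      define V where "V = {x \<in> topspace X. \<forall>t \<in> cball t0 e \<inter> {0..1}. H (t, x) \<in> U}"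
      have "closedin X (topspace X - V)"
      proof (rule closedin_weak)
        fix c assume c: "c \<in> C"
        let ?N = "{z \<in> topspace (prism (fst c)). H (fst z, snd c (snd z)) \<in> topspace Y - U}
            \<inter> {z \<in> topspace (prism (fst c)). fst z \<in> cball t0 e \<inter> {0..1}}"
        have "closedin (prism (fst c)) ?N"
        proof (rule closedin_Int)
          show "closedin (prism (fst c)) {z \<in> topspace (prism (fst c)). H (fst z, snd c (snd z)) \<in> topspace Y - U}"
            using H[OF c] U unfolding cell_continuous_on_def
            by (rule closedin_continuous_map_preimage[OF _ closedin_diff[OF closedin_topspace]])
          have "closedin I01 (cball t0 e \<inter> {0..1})"
            using closedin_closed_Int[OF closed_cball] by (metis Int_commute)
          then show "closedin (prism (fst c)) {z \<in> topspace (prism (fst c)). fst z \<in> cball t0 e \<inter> {0..1}}"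
            by (rule closedin_continuous_map_preimage[OF continuous_map_fst])
        qed
        moreover have "compact_space (prism (fst c))"
          by (simp add: compact_space_prod_topology compact_space_cube compact_space_subtopology)
        ultimately have "compactin (prism (fst c)) ?N"
          by (rule closedin_compact_space[rotated])
        then have "compactin X ((\<lambda>z. snd c (snd z)) ` ?N)"
          by (rule image_compactin) (rule continuous_map_comp[OF cell_continuous[OF c] continuous_map_snd])
        moreover have "(\<lambda>z. snd c (snd z)) ` ?N = (topspace X - V) \<inter> closed_cell c"
        proof
          show "(\<lambda>z. snd c (snd z)) ` ?N \<subseteq> (topspace X - V) \<inter> closed_cell c"
            using closed_cell_subset[OF c] by (auto simp: V_def closed_cell_def)
          show "(topspace X - V) \<inter> closed_cell c \<subseteq> (\<lambda>z. snd c (snd z)) ` ?N"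
          proof
            fix x assume "x \<in> (topspace X - V) \<inter> closed_cell c"
            then obtain q t where "q \<in> topspace (cube (fst c))" "x = snd c q"
              "t \<in> cball t0 e \<inter> {0..1}" "H (t, x) \<notin> U"
              by (auto simp: V_def closed_cell_def)
            with H_cell[OF c] show "x \<in> (\<lambda>z. snd c (snd z)) ` ?N"
              by (intro image_eqI[of _ _ "(t, q)"]) auto
          qed
        qed
        ultimately show "closedin X ((topspace X - V) \<inter> closed_cell c)"
          using Hausdorff compactin_imp_closedin by metis
      qed auto
      then have "openin X V"
        by (simp add: V_def openin_closedin_eq)
      moreover have "openin I01 (ball t0 e \<inter> {0..1})"
        using openin_open_Int[OF open_ball] by (metis Int_commute)
      moreover have "x0 \<in> V" using e x0 by (auto simp: V_def)
      ultimately show "\<exists>T V. openin I01 T \<and> openin X V \<and> t0 \<in> T \<and> x0 \<in> V \<and>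
          T \<times> V \<subseteq> {z \<in> topspace (prod_topology I01 X). H z \<in> U}"
        using t0 e(1) by (intro exI[of _ "ball t0 e \<inter> {0..1}"] exI[of _ V]) (force simp: V_def)
    qed
  qed
qed

lemma path_connected_closed_cell:
  assumes "c \<in> C" "x \<in> closed_cell c" "y \<in> closed_cell c"
  shows "path_component_of X x y"
proof -
  have "path_connected_space (cube (fst c))"
    by (simp add: contractible_space_cube contractible_imp_path_connected_space)
  then have "path_connectedin X (closed_cell c)"
    unfolding closed_cell_def
    by (intro path_connectedin_continuous_map_image[OF cell_continuous[OF assms(1)]])
      (simp add: path_connectedin_topspace)
  with assms(2,3) show ?thesis
    unfolding path_component_of_def path_connectedin by meson
qed

text \<open>Closed cells are path-connected, so a path component contains or misses each of them. By
  the weak topology both the component and its complement are then closed.\<close>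

lemma path_connected:
  assumes "connected_space X"
  shows "path_connected_space X"
  unfolding path_connected_space_iff_path_component
proof (intro ballI)
  fix x y assume x: "x \<in> topspace X" and y: "y \<in> topspace X"
  let ?P = "{y. path_component_of X x y}"
  have P_sub: "?P \<subseteq> topspace X"
    using path_component_of_subset_topspace by fastforce
  have cell: "closed_cell c \<subseteq> ?P \<or> closed_cell c \<inter> ?P = {}" if "c \<in> C" for c
  proof (rule disjCI)
    assume "closed_cell c \<inter> ?P \<noteq> {}"
    then obtain y where "y \<in> closed_cell c" "path_component_of X x y" by blast
    then show "closed_cell c \<subseteq> ?P"
      using path_connected_closed_cell[OF that] path_component_of_trans[of X x y] by auto
  qed
  have "closedin X ?P"
  proof (rule closedin_weak[OF P_sub])
    fix c assume c: "c \<in> C"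
    then show "closedin X (?P \<inter> closed_cell c)"
      using cell[OF c] closedin_closed_cell[OF c] by (metis Int_absorb1 Int_commute closedin_empty)
  qed
  moreover have "closedin X (topspace X - ?P)"
  proof (rule closedin_weak)
    fix c assume c: "c \<in> C"
    have "(topspace X - ?P) \<inter> closed_cell c = {} \<or> (topspace X - ?P) \<inter> closed_cell c = closed_cell c"
      using cell[OF c] closed_cell_subset[OF c] by blast
    then show "closedin X ((topspace X - ?P) \<inter> closed_cell c)"
      using closedin_closed_cell[OF c] by (metis closedin_empty)
  qed auto
  moreover have "x \<in> ?P" using x by (simp add: path_component_of_refl)
  ultimately have "?P = topspace X"
    using assms P_sub unfolding connected_space_clopen_in by (metis (no_types, lifting) empty_iff openin_closedin_eq)
  with y show "path_component_of X x y" by blast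
qed

end

section \<open>Lifting maps of CW-complexes\<close>

locale CW_lifting = CW_complex "fst K" C + weak_equivalence Z W f
  for K :: "'k based" and C and Z :: "'z based" and W :: "'w based" and f +
  fixes \<phi> :: "'k \<Rightarrow> 'w" and \<chi>0
  assumes phi_based: "\<phi> \<in> based_maps K W"
    and base_cell: "(0, \<chi>0) \<in> C" "snd K \<in> open_cell (0, \<chi>0)"
begin

text \<open>The values of \<open>\<psi>\<close> and \<open>H\<close> off the cells of dimension less than \<open>n\<close> are irrelevant.\<close>

definition partial_lift :: "nat \<Rightarrow> ('k \<Rightarrow> 'z) \<times> (real \<times> 'k \<Rightarrow> 'w) \<Rightarrow> bool" where
  "partial_lift n s \<longleftrightarrow> (case s of (\<psi>, H) \<Rightarrow>
     (\<forall>c\<in>C. fst c < n \<longrightarrow>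
        cell_continuous_on (fst Z) (\<lambda>z. \<psi> (snd z)) c \<and> cell_continuous_on (fst W) H c \<and>
        (\<forall>x\<in>open_cell c. H (0, x) = \<phi> x \<and> H (1, x) = f (\<psi> x))) \<and>
     (0 < n \<longrightarrow> \<psi> (snd K) = snd Z \<and> (\<forall>t\<in>{0..1}. H (t, snd K) = snd W)))"

definition agree_below :: "nat \<Rightarrow> ('k \<Rightarrow> 'z) \<times> (real \<times> 'k \<Rightarrow> 'w) \<Rightarrow> ('k \<Rightarrow> 'z) \<times> (real \<times> 'k \<Rightarrow> 'w) \<Rightarrow> bool" where
  "agree_below n s s' \<longleftrightarrow> (\<forall>c\<in>C. fst c < n \<longrightarrow>
     (\<forall>x\<in>open_cell c. fst s' x = fst s x \<and> (\<forall>t. snd s' (t, x) = snd s (t, x))))"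

lemma topspace_cube_0: "topspace (cube 0) = {\<lambda>_. undefined}"
  by (auto simp: topspace_cube)

text \<open>Over the base vertex the constants at the base points are prescribed, which keeps the
  lift and the homotopy based. Over any other cell the lower cells supply the boundary data for
  \<open>cube_HELP\<close>.\<close>

lemma lift_over_cell:
  assumes s: "partial_lift n (\<psi>, H)" and c: "c \<in> C" "fst c = n"
  shows "\<exists>p G. continuous_map (cube n) (fst Z) p \<and> continuous_map (prism n) (fst W) G \<and>
    (\<forall>x\<in>topspace (cube n). G (0, x) = \<phi> (snd c x) \<and> G (1, x) = f (p x)) \<and>
    (\<forall>b\<in>cube_boundary n. p b = \<psi> (snd c b) \<and> (\<forall>t\<in>{0..1}. G (t, b) = H (t, snd c b))) \<and>
    (c = (0, \<chi>0) \<longrightarrow> (\<forall>x\<in>topspace (cube n). p x = snd Z \<and> (\<forall>t. G (t, x) = snd W)))"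
proof (cases "c = (0, \<chi>0)")
  case True
  then have n: "n = 0" using c by simp
  have "snd c x = snd K" if "x \<in> topspace (cube n)" for x
    using that base_cell(2) True n by (auto simp: open_cell_def cube_interior_def topspace_cube_0)
  then show ?thesis
  proof (intro exI conjI ballI impI allI)
    show "continuous_map (cube n) (fst Z) (\<lambda>_. snd Z)" "continuous_map (prism n) (fst W) (\<lambda>_. snd W)"
      using base_Z continuous_map_image_subset_topspace[OF f_continuous] f_base by auto
  qed (use phi_based n f_base in \<open>auto simp: based_maps_def cube_boundary_def\<close>)
next
  case False
  have phi: "continuous_map (cube n) (fst W) (\<lambda>x. \<phi> (snd c x))"
    using phi_based cell_continuous[OF c(1)] c(2) by (auto simp: based_maps_def intro: continuous_map_comp)
  let ?QB = "subtopology (cube n) (cube_boundary n)"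
  have lower: "cell_continuous_on (fst Z) (\<lambda>z. \<psi> (snd z)) d" "cell_continuous_on (fst W) H d"
    if "d \<in> C" "fst d < fst c" for d
    using s that c(2) by (auto simp: partial_lift_def)
  have "continuous_map (prod_topology I01 ?QB) (fst Z) (\<lambda>z. \<psi> (snd c (snd z)))"
    using cell_boundary_continuous[OF c(1) lower(1)] c(2) by simp
  from continuous_map_slice[OF this, of 0]
  have alpha: "continuous_map ?QB (fst Z) (\<lambda>x. \<psi> (snd c x))" by simp
  have H: "continuous_map (prod_topology I01 ?QB) (fst W) (\<lambda>z. H (fst z, snd c (snd z)))"
    using cell_boundary_continuous[OF c(1) lower(2)] c(2) by simp
  have ends: "H (0, snd c b) = \<phi> (snd c b)" "H (1, snd c b) = f (\<psi> (snd c b))" if b: "b \<in> cube_boundary n" for b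
  proof -
    obtain d where "d \<in> C" "snd c b \<in> open_cell d" "fst d < n"
      by (rule boundary_point[OF c(1), of b]) (use b c(2) in auto)
    then show "H (0, snd c b) = \<phi> (snd c b)" "H (1, snd c b) = f (\<psi> (snd c b))"
      using s by (auto simp: partial_lift_def)
  qed
  obtain p G where "continuous_map (cube n) (fst Z) p" "\<And>b. b \<in> cube_boundary n \<Longrightarrow> p b = \<psi> (snd c b)"
    "continuous_map (prism n) (fst W) G"
    "\<And>x. x \<in> topspace (cube n) \<Longrightarrow> G (0, x) = \<phi> (snd c x)" "\<And>x. x \<in> topspace (cube n) \<Longrightarrow> G (1, x) = f (p x)"
    "\<And>t b. \<lbrakk>t \<in> {0..1}; b \<in> cube_boundary n\<rbrakk> \<Longrightarrow> G (t, b) = H (fst (t, b), snd c (snd (t, b)))"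
    by (rule cube_HELP[OF phi alpha H]) (auto simp: ends)
  with False show ?thesis
    by (intro exI[of _ p] exI[of _ G]) auto
qed

text \<open>All \<open>n\<close>-cells are treated at once: their open cells are disjoint and their
  boundaries lie in lower cells, so the choices made over them do not interact.\<close>

lemma lift_step:
  assumes s: "partial_lift n s"
  shows "\<exists>s'. partial_lift (Suc n) s' \<and> agree_below n s s'"
proof -
  obtain \<psi> H where sH: "s = (\<psi>, H)" by (cases s)
  obtain p G where pG: "\<And>c. \<lbrakk>c \<in> C; fst c = n\<rbrakk> \<Longrightarrow>
    continuous_map (cube n) (fst Z) (p c) \<and> continuous_map (prism n) (fst W) (G c) \<and>
    (\<forall>x\<in>topspace (cube n). G c (0, x) = \<phi> (snd c x) \<and> G c (1, x) = f (p c x)) \<and>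
    (\<forall>b\<in>cube_boundary n. p c b = \<psi> (snd c b) \<and> (\<forall>t\<in>{0..1}. G c (t, b) = H (t, snd c b))) \<and>
    (c = (0, \<chi>0) \<longrightarrow> (\<forall>x\<in>topspace (cube n). p c x = snd Z \<and> (\<forall>t. G c (t, x) = snd W)))"
    using lift_over_cell[OF s[unfolded sH]] by metis
  \<comment> \<open>A point of an open \<open>n\<close>-cell is traced back to its unique cell and
    to its unique coordinate in the interior of the cube; every other point keeps its old
    value.\<close>
  define cell where "cell x = (SOME c. c \<in> C \<and> fst c = n \<and> x \<in> open_cell c)" for x
  define new where "new x \<longleftrightarrow> (\<exists>c\<in>C. fst c = n \<and> x \<in> open_cell c)" for x
  define coord where "coord x = inv_into (cube_interior n) (snd (cell x)) x" for x
  define \<psi>' where "\<psi>' x = (if new x then p (cell x) (coord x) else \<psi> x)" for x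
  define H' where "H' z = (if new (snd z) then G (cell (snd z)) (fst z, coord (snd z)) else H z)" for z
  have old: "\<not> new x" if "c \<in> C" "fst c < n" "x \<in> open_cell c" for c x
    using that open_cells_disjoint unfolding new_def by blast
  have interior: "new (snd c q)" "cell (snd c q) = c" "coord (snd c q) = q"
    if c: "c \<in> C" "fst c = n" and q: "q \<in> cube_interior n" for c q
  proof -
    have cq: "snd c q \<in> open_cell c"
      using c q by (auto simp: open_cell_def)
    then show "new (snd c q)" using c by (auto simp: new_def)
    show *: "cell (snd c q) = c"
      unfolding cell_def by (rule some_equality) (use c cq open_cells_disjoint in blast)+
    show "coord (snd c q) = q"
      unfolding coord_def * using cell_inj_on[OF c(1)] q c(2) by (simp add: inv_into_f_f)
  qed
  \<comment> \<open>This includes the boundary of the cube. There the image lies in a lower cell and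
    keeps its old value, which is the boundary value that \<open>p\<close> and \<open>G\<close> were
    built with.\<close>
  have new_cell: "\<psi>' (snd c q) = p c q" "t \<in> {0..1} \<Longrightarrow> H' (t, snd c q) = G c (t, q)"
    if c: "c \<in> C" "fst c = n" and q: "q \<in> topspace (cube n)" for c q t
  proof -
    have "\<psi>' (snd c q) = p c q \<and> (t \<in> {0..1} \<longrightarrow> H' (t, snd c q) = G c (t, q))"
    proof (cases "q \<in> cube_boundary n")
      case True
      then obtain d where "d \<in> C" "snd c q \<in> open_cell d" "fst d < n"
        using boundary_point[OF c(1), of q] c(2) by blast
      then have "\<not> new (snd c q)" using old by blast
      then show ?thesis using pG[OF c] True by (simp add: \<psi>'_def H'_def)
    next
      case False
      then have "q \<in> cube_interior n" using q by (simp add: cube_interior_def)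
      from interior[OF c this] show ?thesis by (simp add: \<psi>'_def H'_def)
    qed
    then show "\<psi>' (snd c q) = p c q" "t \<in> {0..1} \<Longrightarrow> H' (t, snd c q) = G c (t, q)" by auto
  qed
  have old_eq: "\<psi>' x = \<psi> x" "H' (t, x) = H (t, x)" if "c \<in> C" "fst c < n" "x \<in> open_cell c" for c x t
    using old[OF that] by (simp_all add: \<psi>'_def H'_def)
  have old_cell: "\<psi>' (snd c q) = \<psi> (snd c q)" "H' (t, snd c q) = H (t, snd c q)"
    if c: "c \<in> C" "fst c < n" and q: "q \<in> topspace (cube (fst c))" for c q t
  proof -
    obtain d where "d \<in> C" "snd c q \<in> open_cell d" "fst d < n"
      using closed_cell_point[OF c(1) q] c(2) by (metis order_le_less_trans)
    then show "\<psi>' (snd c q) = \<psi> (snd c q)" "H' (t, snd c q) = H (t, snd c q)"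
      using old_eq by blast+
  qed
  have "partial_lift (Suc n) (\<psi>', H')"
    unfolding partial_lift_def prod.case
  proof (intro conjI ballI impI)
    fix c assume c: "c \<in> C" "fst c < Suc n"
    show "cell_continuous_on (fst Z) (\<lambda>z. \<psi>' (snd z)) c"
    proof (cases "fst c = n")
      case True
      have "continuous_map (prism n) (fst Z) (\<lambda>z. p c (snd z))"
        by (rule continuous_map_comp[OF conjunct1[OF pG[OF c(1) True]] continuous_map_snd])
      then show ?thesis
        unfolding cell_continuous_on_def True
        by (rule continuous_map_eq) (auto simp: new_cell c(1) True)
    next
      case False
      then have "cell_continuous_on (fst Z) (\<lambda>z. \<psi> (snd z)) c"
        using s c by (auto simp: partial_lift_def sH)
      then show ?thesis
        unfolding cell_continuous_on_def
        by (rule continuous_map_eq) (use c False in \<open>auto simp: old_cell\<close>)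
    qed
    show "cell_continuous_on (fst W) H' c"
    proof (cases "fst c = n")
      case True
      have "continuous_map (prism n) (fst W) (G c)"
        using pG[OF c(1) True] by blast
      then show ?thesis
        unfolding cell_continuous_on_def True
        by (rule continuous_map_eq) (auto simp: new_cell c(1) True)
    next
      case False
      then have "cell_continuous_on (fst W) H c"
        using s c by (auto simp: partial_lift_def sH)
      then show ?thesis
        unfolding cell_continuous_on_def
        by (rule continuous_map_eq) (use c False in \<open>auto simp: old_cell\<close>)
    qed
    fix x assume x: "x \<in> open_cell c"
    have "H' (0, x) = \<phi> x \<and> H' (1, x) = f (\<psi>' x)"
    proof (cases "fst c = n")
      case True
      with x obtain q where "x = snd c q" "q \<in> topspace (cube n)"
        by (auto simp: open_cell_def cube_interior_def)
      then show ?thesis using pG[OF c(1) True] new_cell[OF c(1) True] by auto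
    next
      case False
      with c have "fst c < n" by simp
      with s c(1) x show ?thesis
        by (auto simp: partial_lift_def sH old_eq[OF c(1) _ x])
    qed
    then show "H' (0, x) = \<phi> x" "H' (1, x) = f (\<psi>' x)" by auto
  next
    have "\<psi>' (snd K) = snd Z \<and> (\<forall>t\<in>{0..1}. H' (t, snd K) = snd W)"
    proof (cases "n = 0")
      case True
      from base_cell(2) obtain q where "snd K = \<chi>0 q" "q \<in> topspace (cube n)"
        by (auto simp: open_cell_def cube_interior_def True)
      then show ?thesis
        using pG[OF base_cell(1)] new_cell[OF base_cell(1)] True by auto
    next
      case False
      then show ?thesis
        using s old_eq[OF base_cell(1) _ base_cell(2)] by (auto simp: partial_lift_def sH)
    qed
    then show "\<psi>' (snd K) = snd Z" "\<And>t. t \<in> {0..1} \<Longrightarrow> H' (t, snd K) = snd W" by auto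
  qed
  moreover have "agree_below n s (\<psi>', H')"
    using old_eq by (auto simp: agree_below_def sH)
  ultimately show ?thesis by blast
qed

text \<open>The value at a point is final from stage \<open>Suc d\<close> on, where \<open>d\<close>
  is the dimension of its open cell; the successor is due to stage \<open>n\<close> covering the
  dimensions below \<open>n\<close>. A closed cell only involves dimensions up to its own, so on it
  the limit is a single stage and continuity is inherited.\<close>

theorem lift_up_to_homotopy: "\<exists>\<psi>\<in>based_maps K Z. based_homotopic K W \<phi> (f \<circ> \<psi>)"
proof -
  have "\<exists>s. \<forall>n. partial_lift n (s n) \<and> agree_below n (s n) (s (Suc n))"
  proof (rule dependent_nat_choice)
    show "\<exists>s. partial_lift 0 s" by (simp add: partial_lift_def)
  qed (use lift_step in blast)
  then obtain s where s: "\<And>n. partial_lift n (s n)" and agree_Suc: "\<And>n. agree_below n (s n) (s (Suc n))"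
    by blast
  have agree: "agree_below n (s n) (s m)" if "n \<le> m" for n m
    using that
  proof (induction rule: dec_induct)
    case (step i)
    then show ?case
      using agree_Suc[of i] by (simp add: agree_below_def)
  qed (simp add: agree_below_def)
  define cdim where "cdim x = fst (SOME c. c \<in> C \<and> x \<in> open_cell c)" for x
  define \<psi> where "\<psi> x = fst (s (Suc (cdim x))) x" for x
  define H where "H z = snd (s (Suc (cdim (snd z)))) z" for z
  have cdim: "cdim x = fst c" if "c \<in> C" "x \<in> open_cell c" for c x
    using that open_cells_disjoint unfolding cdim_def by (metis (mono_tags, lifting) someI_ex)
  have stable: "\<psi> x = fst (s (Suc n)) x" "H (t, x) = snd (s (Suc n)) (t, x)"
    if "c \<in> C" "x \<in> open_cell c" "fst c \<le> n" for c x n t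
    using agree[of "Suc (fst c)" "Suc n"] that
    by (auto simp: \<psi>_def H_def cdim agree_below_def)
  have stable_cell: "\<psi> (snd c q) = fst (s (Suc (fst c))) (snd c q)"
      "H (t, snd c q) = snd (s (Suc (fst c))) (t, snd c q)"
    if "c \<in> C" "q \<in> topspace (cube (fst c))" for c q t
    using closed_cell_point[OF that] stable by metis+
  have cont: "cell_continuous_on (fst Z) (\<lambda>z. \<psi> (snd z)) c" "cell_continuous_on (fst W) H c" if c: "c \<in> C" for c
  proof -
    have *: "cell_continuous_on (fst Z) (\<lambda>z. fst (s (Suc (fst c))) (snd z)) c"
      "cell_continuous_on (fst W) (snd (s (Suc (fst c)))) c"
      using s[of "Suc (fst c)"] c by (auto simp: partial_lift_def split: prod.splits)
    show "cell_continuous_on (fst Z) (\<lambda>z. \<psi> (snd z)) c"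
      using *(1) unfolding cell_continuous_on_def by (rule continuous_map_eq) (auto simp: stable_cell c)
    show "cell_continuous_on (fst W) H c"
      using *(2) unfolding cell_continuous_on_def by (rule continuous_map_eq) (auto simp: stable_cell c)
  qed
  have "continuous_map (prod_topology I01 (fst K)) (fst Z) (\<lambda>z. \<psi> (snd z))"
    by (rule cellwise_continuous[OF cont(1)])
  from continuous_map_slice[OF this, of 0] have \<psi>: "continuous_map (fst K) (fst Z) \<psi>" by simp
  have H: "continuous_map (prod_topology I01 (fst K)) (fst W) H"
    by (rule cellwise_continuous[OF cont(2)])
  have base: "\<psi> (snd K) = snd Z" "\<And>t. t \<in> {0..1} \<Longrightarrow> H (t, snd K) = snd W"
    using s[of "Suc 0"] stable[OF base_cell, of 0]
    by (auto simp: partial_lift_def split: prod.splits)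
  have base_K: "snd K \<in> topspace (fst K)"
    using base_cell Union_open_cells by blast
  have "H (0, x) = \<phi> x \<and> H (1, x) = f (\<psi> x)" if x: "x \<in> topspace (fst K)" for x
  proof -
    obtain c where c: "c \<in> C" "x \<in> open_cell c" using x Union_open_cells by blast
    show ?thesis
      using s[of "Suc (fst c)"] c stable[OF c, of "fst c"]
      by (auto simp: partial_lift_def split: prod.splits)
  qed
  then have "based_homotopic K W \<phi> (f \<circ> \<psi>)"
    unfolding based_homotopic_def using H base base_K
    by (subst homotopic_with) auto
  with \<psi> base show ?thesis by (auto simp: based_maps_def)
qed

end

section \<open>Homotopy groups\<close>

text \<open>Used from left to right, this extracts membership in \<open>spheroids\<close> from a
  homotopy that has already been constructed.\<close>

lemma spheroid_homotopic_refl: "spheroid_homotopic k X a a \<longleftrightarrow> a \<in> spheroids k X"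
  by (auto simp: spheroids_def)

lemma spheroid_homotopic_spheroids:
  assumes "spheroid_homotopic k X a b"
  shows "a \<in> spheroids k X" "b \<in> spheroids k X"
  using homotopic_with_imp_continuous_maps[OF assms] homotopic_with_imp_property[OF assms]
  by (auto simp: spheroids_def)

lemma spheroid_homotopic_cong:
  assumes "a \<in> spheroids k X" "\<And>t. t \<in> topspace (cube k) \<Longrightarrow> a t = b t"
  shows "spheroid_homotopic k X a b"
  using assms cube_boundary_subset[of k] by (intro homotopic_with_equal) (auto simp: spheroids_def subset_iff)

lemma spheroid_class_eq_iff:
  assumes "a \<in> spheroids k X"
  shows "spheroid_class k X a = spheroid_class k X b \<longleftrightarrow> spheroid_homotopic k X a b"
proof
  assume eq: "spheroid_class k X a = spheroid_class k X b"
  have "a \<in> spheroid_class k X a"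
    using assms by (simp add: spheroid_class_def spheroids_def)
  then show "spheroid_homotopic k X a b"
    unfolding eq by (simp add: spheroid_class_def homotopic_with_symD)
next
  assume "spheroid_homotopic k X a b"
  then show "spheroid_class k X a = spheroid_class k X b"
    unfolding spheroid_class_def by (auto intro: homotopic_with_trans homotopic_with_symD)
qed

lemma spheroid_class_eqI: "spheroid_homotopic k X a b \<Longrightarrow> spheroid_class k X a = spheroid_class k X b"
  using spheroid_class_eq_iff spheroid_homotopic_spheroids(1) by blast

lemma mem_spheroid_class_iff: "b \<in> spheroid_class k X a \<longleftrightarrow> spheroid_homotopic k X a b"
  by (simp add: spheroid_class_def)

lemma spheroid_class_self: "a \<in> spheroids k X \<Longrightarrow> a \<in> spheroid_class k X a"
  by (simp add: spheroid_class_def spheroids_def)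

lemma const_spheroid: "snd X \<in> topspace (fst X) \<Longrightarrow> (\<lambda>_. snd X) \<in> spheroids k X"
  by (simp add: spheroids_def)

lemma carrier_homotopy_group: "carrier (homotopy_group k X) = spheroid_class k X ` spheroids k X"
  by (simp add: homotopy_group_def)

lemma one_homotopy_group: "\<one>\<^bsub>homotopy_group k X\<^esub> = spheroid_class k X (\<lambda>_. snd X)"
  by (simp add: homotopy_group_def)

lemma spheroid_compose: "\<lbrakk>f \<in> based_maps X Y; a \<in> spheroids k X\<rbrakk> \<Longrightarrow> f \<circ> a \<in> spheroids k Y"
  by (auto simp: based_maps_def spheroids_def intro: continuous_map_compose)

lemma spheroid_homotopic_compose:
  assumes "f \<in> based_maps X Y" "spheroid_homotopic k X a b"
  shows "spheroid_homotopic k Y (f \<circ> a) (f \<circ> b)"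
  by (rule homotopic_with_compose_continuous_map_left[OF assms(2)]) (use assms(1) in \<open>auto simp: based_maps_def\<close>)

text \<open>Homotopic representatives have homotopic images, so the union in
  \<open>homotopy_map\<close> is taken over a nonempty family of equal classes.\<close>

lemma homotopy_map_class:
  assumes f: "f \<in> based_maps X Y" and a: "a \<in> spheroids k X"
  shows "homotopy_map k X Y f (spheroid_class k X a) = spheroid_class k Y (f \<circ> a)"
proof -
  have "spheroid_class k Y (f \<circ> b) = spheroid_class k Y (f \<circ> a)" if "b \<in> spheroid_class k X a" for b
    using that unfolding mem_spheroid_class_iff
    by (rule spheroid_class_eqI[OF spheroid_homotopic_compose[OF f], symmetric])
  moreover have "spheroid_class k X a \<noteq> {}" using spheroid_class_self[OF a] by blast
  ultimately have "(\<Union>b\<in>spheroid_class k X a. spheroid_class k Y (f \<circ> b)) = spheroid_class k Y (f \<circ> a)"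
    by blast
  then show ?thesis
    using a by (simp add: homotopy_map_def carrier_homotopy_group)
qed

lemma homotopy_map_extensional: "homotopy_map k X Y f \<in> extensional (carrier (homotopy_group k X))"
  by (simp add: homotopy_map_def)

lemma homotopy_map_closed:
  "\<lbrakk>f \<in> based_maps X Y; A \<in> carrier (homotopy_group k X)\<rbrakk>
    \<Longrightarrow> homotopy_map k X Y f A \<in> carrier (homotopy_group k Y)"
  by (auto simp: carrier_homotopy_group homotopy_map_class spheroid_compose)

lemma homotopy_map_compose:
  assumes "f \<in> based_maps X Y" "g \<in> based_maps Y Z" "A \<in> carrier (homotopy_group k X)"
  shows "homotopy_map k X Z (g \<circ> f) A = homotopy_map k Y Z g (homotopy_map k X Y f A)"
proof -
  have "g \<circ> f \<in> based_maps X Z"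
    using assms(1,2) by (auto simp: based_maps_def intro: continuous_map_compose)
  then show ?thesis
    using assms by (auto simp: carrier_homotopy_group homotopy_map_class spheroid_compose comp_assoc)
qed

lemma id_based: "id \<in> based_maps X X"
  by (simp add: based_maps_def)

lemma based_compose: "\<lbrakk>f \<in> based_maps X Y; g \<in> based_maps Y Z\<rbrakk> \<Longrightarrow> g \<circ> f \<in> based_maps X Z"
  by (auto simp: based_maps_def intro: continuous_map_compose)

lemma homotopy_map_id: "A \<in> carrier (homotopy_group k X) \<Longrightarrow> homotopy_map k X X id A = A"
  by (auto simp: carrier_homotopy_group homotopy_map_class[OF id_based])

section \<open>Based homotopies and their effect on homotopy groups\<close>

lemma based_homotopic_maps:
  assumes "based_homotopic X Y f g"
  shows "f \<in> based_maps X Y" "g \<in> based_maps X Y"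
  using homotopic_with_imp_continuous_maps[OF assms[unfolded based_homotopic_def]]
    homotopic_with_imp_property[OF assms[unfolded based_homotopic_def]]
  by (auto simp: based_maps_def)

lemma based_homotopic_refl: "based_homotopic X Y f f \<longleftrightarrow> f \<in> based_maps X Y"
  by (auto simp: based_homotopic_def based_maps_def)

lemma based_homotopic_sym: "based_homotopic X Y f g \<Longrightarrow> based_homotopic X Y g f"
  unfolding based_homotopic_def by (rule homotopic_with_symD)

lemma based_homotopic_trans: "\<lbrakk>based_homotopic X Y f g; based_homotopic X Y g h\<rbrakk> \<Longrightarrow> based_homotopic X Y f h"
  unfolding based_homotopic_def by (rule homotopic_with_trans)

lemma based_homotopic_compose_left:
  "\<lbrakk>based_homotopic X Y f g; h \<in> based_maps Y Z\<rbrakk> \<Longrightarrow> based_homotopic X Z (h \<circ> f) (h \<circ> g)"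
  unfolding based_homotopic_def
  by (erule homotopic_with_compose_continuous_map_left) (auto simp: based_maps_def)

lemma based_homotopic_compose_right:
  "\<lbrakk>based_homotopic Y Z f g; h \<in> based_maps X Y\<rbrakk> \<Longrightarrow> based_homotopic X Z (f \<circ> h) (g \<circ> h)"
  unfolding based_homotopic_def
  by (erule homotopic_with_compose_continuous_map_right) (auto simp: based_maps_def)

lemma homotopy_map_homotopic:
  assumes "based_homotopic X Y f g"
  shows "homotopy_map k X Y f = homotopy_map k X Y g"
proof (rule extensionalityI[OF homotopy_map_extensional homotopy_map_extensional])
  fix A assume "A \<in> carrier (homotopy_group k X)"
  then obtain a where a: "a \<in> spheroids k X" "A = spheroid_class k X a"
    by (auto simp: carrier_homotopy_group)
  have "spheroid_homotopic k Y (f \<circ> a) (g \<circ> a)"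
    by (rule homotopic_with_compose_continuous_map_right[OF assms[unfolded based_homotopic_def]])
      (use a in \<open>auto simp: spheroids_def\<close>)
  then show "homotopy_map k X Y f A = homotopy_map k X Y g A"
    using based_homotopic_maps[OF assms] a by (simp add: homotopy_map_class spheroid_class_eqI)
qed

section \<open>Concatenation and reparametrization of spheroids\<close>

lemma continuous_map_cube_upd:
  assumes "0 < k" "continuous_map Z (cube k) g" "continuous_map Z I01 r"
  shows "continuous_map Z (cube k) (\<lambda>z. (g z)(0 := r z))"
  using assms unfolding continuous_map_cube_iff
  by (auto simp: extensional_def Pi_iff)

lemma cube_boundary_upd:
  assumes "t \<in> cube_boundary k" "0 < k" "0 \<le> r" "r \<le> 1" "t 0 = 0 \<or> t 0 = 1 \<Longrightarrow> r = 0 \<or> r = 1"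
  shows "t(0 := r) \<in> cube_boundary k"
proof -
  have "t(0 := r) \<in> topspace (cube k)"
    using assms by (auto simp: cube_boundary_def topspace_cube PiE_iff extensional_def)
  moreover obtain i where "i < k" "t i = 0 \<or> t i = 1"
    using assms(1) by (auto simp: cube_boundary_def)
  then have "\<exists>i<k. (t(0 := r)) i = 0 \<or> (t(0 := r)) i = 1"
    using assms(2,5) by (intro exI[of _ i]) auto
  ultimately show ?thesis by (auto simp: cube_boundary_def)
qed

lemma cube_boundary_0I:
  assumes "t \<in> topspace (cube k)" "0 < k" "r = 0 \<or> r = 1"
  shows "t(0 := r) \<in> cube_boundary k"
  using assms by (auto simp: cube_boundary_def topspace_cube PiE_iff extensional_def)

lemma topspace_cube_coord: "\<lbrakk>t \<in> topspace (cube k); i < k\<rbrakk> \<Longrightarrow> 0 \<le> t i \<and> t i \<le> 1"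
  by (auto simp: topspace_cube PiE_iff)

lemma spheroid_mult_boundary:
  assumes k: "0 < k" and t: "t \<in> cube_boundary k"
    and a: "\<And>t. t \<in> cube_boundary k \<Longrightarrow> a t = x" and b: "\<And>t. t \<in> cube_boundary k \<Longrightarrow> b t = x"
  shows "spheroid_mult a b t = x"
proof -
  have t0: "0 \<le> t 0" "t 0 \<le> 1"
    using topspace_cube_coord[of t k 0] t k cube_boundary_subset[of k] by auto
  show ?thesis
  proof (cases "t 0 \<le> 1/2")
    case True
    then have "t(0 := 2 * t 0) \<in> cube_boundary k"
      using t0 by (intro cube_boundary_upd[OF t k]) auto
    with True show ?thesis by (simp add: spheroid_mult_def a)
  next
    case False
    then have "t(0 := 2 * t 0 - 1) \<in> cube_boundary k"
      using t0 by (intro cube_boundary_upd[OF t k]) auto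
    with False show ?thesis by (simp add: spheroid_mult_def b)
  qed
qed

text \<open>The two halves meet where the new coordinate is 1 for \<open>h\<close> and 0 for
  \<open>h'\<close>. Both points lie on the boundary, so both values are \<open>y\<close> and
  pasting applies.\<close>

lemma spheroid_mult_homotopy_continuous:
  assumes k: "0 < k"
    and h: "continuous_map (prism k) Y h" "\<And>s t. \<lbrakk>s \<in> {0..1}; t \<in> cube_boundary k\<rbrakk> \<Longrightarrow> h (s, t) = y"
    and h': "continuous_map (prism k) Y h'" "\<And>s t. \<lbrakk>s \<in> {0..1}; t \<in> cube_boundary k\<rbrakk> \<Longrightarrow> h' (s, t) = y"
  shows "continuous_map (prism k) Y (\<lambda>z. spheroid_mult (\<lambda>t. h (fst z, t)) (\<lambda>t. h' (fst z, t)) (snd z))"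
  unfolding spheroid_mult_def
proof (rule continuous_map_cases_le)
  let ?c = "\<lambda>z. snd z 0 :: real"
  have "continuous_map (prism k) I01 ?c"
    by (rule continuous_map_comp[OF continuous_map_cube_coord[OF k] continuous_map_snd])
  then show c: "continuous_map (prism k) euclideanreal ?c"
    by (simp only: continuous_map_into_Icc)
  have c01: "0 \<le> snd z 0 \<and> snd z 0 \<le> 1" if "z \<in> topspace (prism k)" for z
    using that topspace_cube_coord[of "snd z" k 0] k by auto
  let ?S = "{z \<in> topspace (prism k). ?c z \<le> 1/2}" and ?T = "{z \<in> topspace (prism k). 1/2 \<le> ?c z}"
  have "continuous_map (subtopology (prism k) ?S) I01 (\<lambda>z. 2 * snd z 0)"
    by (subst continuous_map_into_Icc, intro conjI continuous_intros continuous_map_from_subtopology c)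
      (auto dest!: c01 simp del: topspace_prod_topology)
  then show "continuous_map (subtopology (prism k) ?S) Y (\<lambda>z. h (fst z, (snd z)(0 := 2 * snd z 0)))"
    by (intro continuous_map_comp2[OF h(1)] continuous_map_cube_upd[OF k]
        continuous_map_from_subtopology[OF continuous_map_fst] continuous_map_from_subtopology[OF continuous_map_snd])
  have "continuous_map (subtopology (prism k) ?T) I01 (\<lambda>z. 2 * snd z 0 - 1)"
    by (subst continuous_map_into_Icc, intro conjI continuous_intros continuous_map_from_subtopology c)
      (auto dest!: c01 simp del: topspace_prod_topology)
  then show "continuous_map (subtopology (prism k) ?T) Y (\<lambda>z. h' (fst z, (snd z)(0 := 2 * snd z 0 - 1)))"
    by (intro continuous_map_comp2[OF h'(1)] continuous_map_cube_upd[OF k]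
        continuous_map_from_subtopology[OF continuous_map_fst] continuous_map_from_subtopology[OF continuous_map_snd])
  fix z assume z: "z \<in> topspace (prism k)" and e: "snd z 0 = 1/2"
  then have z': "fst z \<in> {0..1}" "snd z \<in> topspace (cube k)" by auto
  have d: "2 * snd z 0 = 1" using e by simp
  show "h (fst z, (snd z)(0 := 2 * snd z 0)) = h' (fst z, (snd z)(0 := 2 * snd z 0 - 1))"
    unfolding d using h(2)[OF z'(1)] h'(2)[OF z'(1)] cube_boundary_0I[OF z'(2) k] by simp
qed simp

lemma spheroid_mult_homotopic:
  assumes k: "0 < k" and "spheroid_homotopic k X a a'" "spheroid_homotopic k X b b'"
  shows "spheroid_homotopic k X (spheroid_mult a b) (spheroid_mult a' b')"
proof -
  obtain h where h: "continuous_map (prism k) (fst X) h" "\<And>x. h (0, x) = a x" "\<And>x. h (1, x) = a' x"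
    "\<And>s t. \<lbrakk>s \<in> {0..1}; t \<in> cube_boundary k\<rbrakk> \<Longrightarrow> h (s, t) = snd X"
    using assms(2) by (rule spheroid_homotopicE) blast
  obtain h' where h': "continuous_map (prism k) (fst X) h'" "\<And>x. h' (0, x) = b x" "\<And>x. h' (1, x) = b' x"
    "\<And>s t. \<lbrakk>s \<in> {0..1}; t \<in> cube_boundary k\<rbrakk> \<Longrightarrow> h' (s, t) = snd X"
    using assms(3) by (rule spheroid_homotopicE) blast
  show ?thesis
  proof (rule spheroid_homotopicI[OF spheroid_mult_homotopy_continuous[OF k h(1,4) h'(1,4)]])
    show "spheroid_mult (\<lambda>x. h (fst (t, x'), x)) (\<lambda>x. h' (fst (t, x'), x)) (snd (t, x')) = snd X"
      if "t \<in> {0..1}" "x' \<in> cube_boundary k" for t x'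
      unfolding fst_conv snd_conv
      by (rule spheroid_mult_boundary[OF k that(2) h(4)[OF that(1)] h'(4)[OF that(1)]])
  qed (auto simp: spheroid_mult_def h h')
qed

lemma spheroid_mult_spheroid:
  assumes "0 < k" "a \<in> spheroids k X" "b \<in> spheroids k X"
  shows "spheroid_mult a b \<in> spheroids k X"
  using spheroid_mult_homotopic[OF assms(1)] assms(2,3) by (simp only: flip: spheroid_homotopic_refl)

lemma homotopy_group_mult:
  assumes k: "0 < k" and a: "a \<in> spheroids k X" and b: "b \<in> spheroids k X"
  shows "spheroid_class k X a \<otimes>\<^bsub>homotopy_group k X\<^esub> spheroid_class k X b = spheroid_class k X (spheroid_mult a b)"
proof -
  have "spheroid_class k X (spheroid_mult a' b') = spheroid_class k X (spheroid_mult a b)"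
    if "a' \<in> spheroid_class k X a" "b' \<in> spheroid_class k X b" for a' b'
    using that unfolding mem_spheroid_class_iff
    by (rule spheroid_class_eqI[OF spheroid_mult_homotopic[OF k], symmetric])
  moreover have "spheroid_class k X a \<noteq> {}" "spheroid_class k X b \<noteq> {}"
    using spheroid_class_self a b by blast+
  ultimately show ?thesis
    by (simp add: homotopy_group_def cong: SUP_cong_simp)
qed

text \<open>The two parameters are joined by linear interpolation. Their common ends in {0, 1} keep
  the two faces of coordinate 0 inside the boundary at all times.\<close>

lemma spheroid_reparametrize:
  assumes k: "0 < k" and a: "a \<in> spheroids k X"
    and r: "continuous_on {0..1} r" "r \<in> {0..1} \<rightarrow> {0..1}" and r': "continuous_on {0..1} r'" "r' \<in> {0..1} \<rightarrow> {0..1}"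
    and ends: "r 0 = r' 0" "r 1 = r' 1" "r 0 \<in> {0, 1}" "r 1 \<in> {0, 1::real}"
  shows "spheroid_homotopic k X (\<lambda>t. a (t(0 := r (t 0)))) (\<lambda>t. a (t(0 := r' (t 0))))"
proof -
  define \<rho> where "\<rho> z = (1 - fst z) * r (snd z 0) + fst z * r' (snd z 0)" for z :: "real \<times> (nat \<Rightarrow> real)"
  have c: "continuous_map (prism k) I01 (\<lambda>z. snd z 0)"
    by (rule continuous_map_comp[OF continuous_map_cube_coord[OF k] continuous_map_snd])
  have fst: "continuous_map (prism k) euclideanreal fst"
    using continuous_map_fst continuous_map_in_subtopology by blast
  have r01: "0 \<le> \<rho> z \<and> \<rho> z \<le> 1" if z: "z \<in> topspace (prism k)" for z
  proof -
    have "fst z \<in> {0..1}" "r (snd z 0) \<in> {0..1}" "r' (snd z 0) \<in> {0..1}"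
      using z topspace_cube_coord[of "snd z" k 0] k r(2) r'(2) by (auto simp: Pi_iff)
    then show ?thesis
      using convexD_alt[of "{0..1::real}" "r (snd z 0)" "r' (snd z 0)" "fst z"] by (simp add: \<rho>_def)
  qed
  have "continuous_map (prism k) euclideanreal \<rho>"
    unfolding \<rho>_def using r(1) r'(1)
    by (intro continuous_intros fst continuous_map_comp[OF _ c]) auto
  then have \<rho>: "continuous_map (prism k) I01 \<rho>"
    using r01 unfolding continuous_map_into_Icc by blast
  have a_cont: "continuous_map (cube k) (fst X) a"
    using a by (simp add: spheroids_def)
  show ?thesis
  proof (rule spheroid_homotopicI)
    show "continuous_map (prism k) (fst X) (\<lambda>z. a ((snd z)(0 := \<rho> z)))"
      by (rule continuous_map_comp[OF a_cont continuous_map_cube_upd[OF k continuous_map_snd \<rho>]])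
    fix s :: real and t assume s: "s \<in> {0..1}" and t: "t \<in> cube_boundary k"
    have "(s, t) \<in> topspace (prism k)" using s t cube_boundary_subset by auto
    moreover have "\<rho> (s, t) = 0 \<or> \<rho> (s, t) = 1" if "t 0 = 0 \<or> t 0 = 1"
      using that ends by (auto simp: \<rho>_def)
    ultimately have "t(0 := \<rho> (s, t)) \<in> cube_boundary k"
      using r01 by (intro cube_boundary_upd[OF t k]) auto
    then show "a ((snd (s, t))(0 := \<rho> (s, t))) = snd X"
      using a by (simp add: spheroids_def)
  qed (simp_all add: \<rho>_def)
qed

text \<open>This form covers associativity, unit and inverse alike: the two sides are one spheroid
  with coordinate 0 reparametrized in two ways, once equality is required on the cube only.\<close>

lemma spheroid_reparametrize_eq:
  assumes "0 < k" "a \<in> spheroids k X"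
    and "continuous_on {0..1} r" "r \<in> {0..1} \<rightarrow> {0..1}" "continuous_on {0..1} r'" "r' \<in> {0..1} \<rightarrow> {0..1}"
    and "r 0 = r' 0" "r 1 = r' 1" "r 0 \<in> {0, 1}" "r 1 \<in> {0, 1::real}"
    and b: "\<And>t. t \<in> topspace (cube k) \<Longrightarrow> b t = a (t(0 := r (t 0)))"
    and c: "\<And>t. t \<in> topspace (cube k) \<Longrightarrow> c t = a (t(0 := r' (t 0)))"
  shows "spheroid_class k X b = spheroid_class k X c"
proof -
  have h: "spheroid_homotopic k X (\<lambda>t. a (t(0 := r (t 0)))) (\<lambda>t. a (t(0 := r' (t 0))))"
    by (rule spheroid_reparametrize) (fact assms)+
  have "spheroid_class k X b = spheroid_class k X (\<lambda>t. a (t(0 := r (t 0))))"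
    by (rule spheroid_class_eqI[OF spheroid_homotopic_cong, symmetric])
      (use spheroid_homotopic_spheroids(1)[OF h] b in auto)
  also have "\<dots> = spheroid_class k X (\<lambda>t. a (t(0 := r' (t 0))))"
    by (rule spheroid_class_eqI[OF h])
  also have "\<dots> = spheroid_class k X c"
    by (rule spheroid_class_eqI[OF spheroid_homotopic_cong])
      (use spheroid_homotopic_spheroids(2)[OF h] c in auto)
  finally show ?thesis .
qed

theorem homotopy_group_is_group:
  assumes k: "0 < k" and x: "snd X \<in> topspace (fst X)"
  shows "group (homotopy_group k X)"
proof (rule groupI)
  let ?G = "homotopy_group k X"
  show "A \<otimes>\<^bsub>?G\<^esub> B \<in> carrier ?G" if "A \<in> carrier ?G" "B \<in> carrier ?G" for A B
    using that by (auto simp: carrier_homotopy_group homotopy_group_mult[OF k] spheroid_mult_spheroid[OF k])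
  show "\<one>\<^bsub>?G\<^esub> \<in> carrier ?G"
    using const_spheroid[OF x] by (auto simp: carrier_homotopy_group one_homotopy_group)
  show "(A \<otimes>\<^bsub>?G\<^esub> B) \<otimes>\<^bsub>?G\<^esub> D = A \<otimes>\<^bsub>?G\<^esub> (B \<otimes>\<^bsub>?G\<^esub> D)"
    if ABD: "A \<in> carrier ?G" "B \<in> carrier ?G" "D \<in> carrier ?G" for A B D
  proof -
    obtain a b d where s: "a \<in> spheroids k X" "b \<in> spheroids k X" "d \<in> spheroids k X"
      and eq: "A = spheroid_class k X a" "B = spheroid_class k X b" "D = spheroid_class k X d"
      using ABD by (auto simp: carrier_homotopy_group)
    have "spheroid_class k X (spheroid_mult (spheroid_mult a b) d) = spheroid_class k X (spheroid_mult a (spheroid_mult b d))"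
    \<comment> \<open>The function \<open>r\<close> sends the breakpoints 1/4 and 1/2 of the left
      bracketing to the breakpoints 1/2 and 3/4 of the right one. Its slopes 2, 1, 1/2 decrease, so
      it is the minimum of its linear pieces.\<close>
    proof (rule spheroid_reparametrize_eq[OF k spheroid_mult_spheroid[OF k s(1) spheroid_mult_spheroid[OF k s(2,3)]],
          where r = "\<lambda>u. min (2 * u) (min (u + 1/4) (u / 2 + 1/2))" and r' = "\<lambda>u. u"])
      fix t assume "t \<in> topspace (cube k)"
      consider "t 0 \<le> 1/4" | "1/4 < t 0" "t 0 \<le> 1/2" | "1/2 < t 0" by linarith
      then show "spheroid_mult (spheroid_mult a b) d t =
          spheroid_mult a (spheroid_mult b d) (t(0 := min (2 * t 0) (min (t 0 + 1/4) (t 0 / 2 + 1/2))))"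
      proof cases
        case 1
        then have "min (2 * t 0) (min (t 0 + 1/4) (t 0 / 2 + 1/2)) = 2 * t 0" by simp
        then show ?thesis using 1 by (simp add: spheroid_mult_def)
      next
        case 2
        then have "min (2 * t 0) (min (t 0 + 1/4) (t 0 / 2 + 1/2)) = t 0 + 1/4" by simp
        then show ?thesis using 2 by (simp add: spheroid_mult_def algebra_simps)
      next
        case 3
        then have "min (2 * t 0) (min (t 0 + 1/4) (t 0 / 2 + 1/2)) = t 0 / 2 + 1/2" by simp
        then show ?thesis using 3 by (simp add: spheroid_mult_def algebra_simps)
      qed
    qed (auto intro!: continuous_intros)
    then show ?thesis
      using s by (simp add: eq homotopy_group_mult[OF k] spheroid_mult_spheroid[OF k])
  qed
  fix A assume "A \<in> carrier ?G"
  then obtain a where a: "a \<in> spheroids k X" and A: "A = spheroid_class k X a"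
    by (auto simp: carrier_homotopy_group)
  have aB: "a t = snd X" if "t \<in> cube_boundary k" for t
    using a that by (auto simp: spheroids_def)
  have "spheroid_class k X (spheroid_mult (\<lambda>_. snd X) a) = spheroid_class k X a"
  \<comment> \<open>The parameter waits at 0 for the first half, where \<open>a\<close> has the base
    point as value.\<close>
  proof (rule spheroid_reparametrize_eq[OF k a, where r = "\<lambda>u. max 0 (2 * u - 1)" and r' = "\<lambda>u. u"])
    show "spheroid_mult (\<lambda>_. snd X) a t = a (t(0 := max 0 (2 * t 0 - 1)))" if "t \<in> topspace (cube k)" for t
      using aB[OF cube_boundary_0I[OF that k]] by (auto simp: spheroid_mult_def max_def)
  qed (auto intro!: continuous_intros)
  then show "\<one>\<^bsub>?G\<^esub> \<otimes>\<^bsub>?G\<^esub> A = A"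
    using a by (simp add: A one_homotopy_group homotopy_group_mult[OF k] const_spheroid[OF x])
  let ?b = "\<lambda>t. a (t(0 := 1 - t 0))"
  have "spheroid_homotopic k X ?b ?b"
    by (rule spheroid_reparametrize[OF k a]) (auto intro!: continuous_intros)
  then have b: "?b \<in> spheroids k X"
    by (simp only: spheroid_homotopic_refl)
  have "spheroid_class k X (spheroid_mult ?b a) = spheroid_class k X (\<lambda>_. snd X)"
  \<comment> \<open>The parameter runs from 1 to 0 and back. It is contracted to the constant 1,
    where \<open>a\<close> has the base point as value.\<close>
  proof (rule spheroid_reparametrize_eq[OF k a, where r = "\<lambda>u. \<bar>2 * u - 1\<bar>" and r' = "\<lambda>_. 1"])
    show "spheroid_mult ?b a t = a (t(0 := \<bar>2 * t 0 - 1\<bar>))" for t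
    proof (cases "t 0 \<le> 1/2")
      case True
      then have "\<bar>2 * t 0 - 1\<bar> = 1 - 2 * t 0" by simp
      with True show ?thesis by (simp add: spheroid_mult_def)
    qed (simp add: spheroid_mult_def)
    show "snd X = a (t(0 := 1))" if "t \<in> topspace (cube k)" for t
      using aB[OF cube_boundary_0I[OF that k]] by simp
  qed (auto intro!: continuous_intros)
  then have "spheroid_class k X ?b \<otimes>\<^bsub>?G\<^esub> A = \<one>\<^bsub>?G\<^esub>"
    using a b by (simp add: A one_homotopy_group homotopy_group_mult[OF k])
  then show "\<exists>B\<in>carrier ?G. B \<otimes>\<^bsub>?G\<^esub> A = \<one>\<^bsub>?G\<^esub>"
    using b by (auto simp: carrier_homotopy_group)
qed

lemma homotopy_map_hom:
  assumes k: "0 < k" and f: "f \<in> based_maps X Y"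
  shows "homotopy_map k X Y f \<in> hom (homotopy_group k X) (homotopy_group k Y)"
proof (rule homI)
  show "homotopy_map k X Y f A \<in> carrier (homotopy_group k Y)" if "A \<in> carrier (homotopy_group k X)" for A
    by (rule homotopy_map_closed[OF f that])
  fix A B assume "A \<in> carrier (homotopy_group k X)" "B \<in> carrier (homotopy_group k X)"
  then obtain a b where ab: "a \<in> spheroids k X" "b \<in> spheroids k X" "A = spheroid_class k X a" "B = spheroid_class k X b"
    by (auto simp: carrier_homotopy_group)
  have "f \<circ> spheroid_mult a b = spheroid_mult (f \<circ> a) (f \<circ> b)"
    by (auto simp: spheroid_mult_def)
  then show "homotopy_map k X Y f (A \<otimes>\<^bsub>homotopy_group k X\<^esub> B) =
      homotopy_map k X Y f A \<otimes>\<^bsub>homotopy_group k Y\<^esub> homotopy_map k X Y f B"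
    using ab by (simp add: homotopy_group_mult[OF k] homotopy_map_class[OF f] spheroid_mult_spheroid[OF k]
        spheroid_compose[OF f])
qed

lemma homotopy_map_iso_iff:
  assumes "0 < k" "f \<in> based_maps X Y"
  shows "homotopy_map k X Y f \<in> iso (homotopy_group k X) (homotopy_group k Y) \<longleftrightarrow>
    bij_betw (homotopy_map k X Y f) (carrier (homotopy_group k X)) (carrier (homotopy_group k Y))"
  using homotopy_map_hom[OF assms] by (simp add: iso_def)

lemma homotopy_equivalence_bij_betw:
  assumes f: "f \<in> based_maps X Y" and g: "g \<in> based_maps Y X"
    and gf: "based_homotopic X X (g \<circ> f) id" and fg: "based_homotopic Y Y (f \<circ> g) id"
  shows "bij_betw (homotopy_map k X Y f) (carrier (homotopy_group k X)) (carrier (homotopy_group k Y))"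
proof (rule bij_betw_byWitness[where f' = "homotopy_map k Y X g"])
  show "\<forall>A\<in>carrier (homotopy_group k X). homotopy_map k Y X g (homotopy_map k X Y f A) = A"
    using homotopy_map_homotopic[OF gf, of k] homotopy_map_id[of _ k X] homotopy_map_compose[OF f g]
    by metis
  show "\<forall>A\<in>carrier (homotopy_group k Y). homotopy_map k X Y f (homotopy_map k Y X g A) = A"
    using homotopy_map_homotopic[OF fg, of k] homotopy_map_id[of _ k Y] homotopy_map_compose[OF g f]
    by metis
qed (use homotopy_map_closed f g in blast)+

section \<open>Whitehead's theorem\<close>

lemma connected_based_CW_complexE:
  assumes "connected_based_CW_complex X"
  obtains C \<chi>0 where "CW_complex (fst X) C" "(0, \<chi>0) \<in> C" "snd X \<in> open_cell (0, \<chi>0)"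
    "path_connected_space (fst X)" "snd X \<in> topspace (fst X)"
proof -
  obtain C \<chi>0 where C: "CW_structure (fst X) C" "(0, \<chi>0) \<in> C" "snd X \<in> open_cell (0, \<chi>0)"
    and "connected_space (fst X)"
    using assms by (auto simp: connected_based_CW_complex_def)
  interpret CW_complex "fst X" C by unfold_locales (fact C)
  show thesis
    using that CW_complex_axioms C path_connected \<open>connected_space (fst X)\<close> Union_open_cells by blast
qed

text \<open>In positive dimensions both conditions come from bijectivity; in dimension 0 a path
  between two points provides them.\<close>

lemma weak_equivalenceI:
  assumes f: "f \<in> based_maps Z W"
    and Z: "path_connected_space (fst Z)" "snd Z \<in> topspace (fst Z)" and W: "path_connected_space (fst W)"
    and bij: "\<And>k. 0 < k \<Longrightarrow> bij_betw (homotopy_map k Z W f) (carrier (homotopy_group k Z)) (carrier (homotopy_group k W))"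
  shows "weak_equivalence Z W f"
proof
  have f_base: "f (snd Z) = snd W" using f by (simp add: based_maps_def)
  have W_base: "snd W \<in> topspace (fst W)"
    using f Z(2) f_base by (force simp: based_maps_def continuous_map_def)
  have zero: "spheroid_homotopic 0 V a b"
    if V: "path_connected_space (fst V)" and ab: "a \<in> spheroids 0 V" "b \<in> spheroids 0 V" for V :: "'v based" and a b
  proof -
    let ?u = "\<lambda>_. undefined :: real"
    have u: "topspace (cube 0) = {?u}" by (auto simp: topspace_cube)
    have "a ?u \<in> topspace (fst V)" "b ?u \<in> topspace (fst V)"
      using ab u by (auto simp: spheroids_def continuous_map_def)
    then obtain p where p: "pathin (fst V) p" "p 0 = a ?u" "p 1 = b ?u"
      using V by (auto simp: path_connected_space_def)
    then show ?thesis
      by (intro spheroid_homotopicI[where h = "\<lambda>z. p (fst z)"])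
        (auto simp: u pathin_def cube_boundary_def intro: continuous_map_comp continuous_map_fst)
  qed
  show "spheroid_homotopic m Z (\<lambda>_. snd Z) a"
    if a: "a \<in> spheroids m Z" and h: "spheroid_homotopic m W (\<lambda>_. snd W) (f \<circ> a)" for m a
  proof (cases "m = 0")
    case True
    then show ?thesis using zero[OF Z(1)] a const_spheroid[OF Z(2)] by blast
  next
    case False
    then have inj: "inj_on (homotopy_map m Z W f) (carrier (homotopy_group m Z))"
      by (intro bij_betw_imp_inj_on[OF bij]) simp
    have "homotopy_map m Z W f (spheroid_class m Z (\<lambda>_. snd Z)) = homotopy_map m Z W f (spheroid_class m Z a)"
      using spheroid_class_eqI[OF h] by (simp add: homotopy_map_class[OF f] a const_spheroid[OF Z(2)] o_def f_base)
    then have "spheroid_class m Z (\<lambda>_. snd Z) = spheroid_class m Z a"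
      by (rule inj_onD[OF inj]) (use a const_spheroid[OF Z(2)] in \<open>auto simp: carrier_homotopy_group\<close>)
    then show ?thesis
      using spheroid_class_eq_iff const_spheroid[OF Z(2)] by blast
  qed
  show "\<exists>a\<in>spheroids m Z. spheroid_homotopic m W b (f \<circ> a)" if b: "b \<in> spheroids m W" for m b
  proof (cases "m = 0")
    case True
    then show ?thesis
      using zero[OF W] b spheroid_compose[OF f const_spheroid[OF Z(2)]] const_spheroid[OF Z(2)] by blast
  next
    case False
    then have "homotopy_map m Z W f ` carrier (homotopy_group m Z) = carrier (homotopy_group m W)"
      by (intro bij_betw_imp_surj_on bij) simp
    moreover have "spheroid_class m W b \<in> carrier (homotopy_group m W)"
      using b by (simp add: carrier_homotopy_group)
    ultimately obtain a where "a \<in> spheroids m Z" "spheroid_class m W b = homotopy_map m Z W f (spheroid_class m Z a)"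
      unfolding carrier_homotopy_group by (metis imageE)
    then show ?thesis
      using spheroid_class_eq_iff[OF b] by (auto simp: homotopy_map_class[OF f])
  qed
qed (fact f Z W)+

text \<open>\<open>g\<close> is a lift of the identity of \<open>W\<close> through \<open>f\<close>.
  On homotopy groups it is a right inverse of a bijection, hence itself a bijection, so the lemma
  can be applied to \<open>g\<close> in turn.\<close>

lemma weak_equivalence_right_inverse:
  assumes Z: "connected_based_CW_complex Z" and W: "connected_based_CW_complex W"
    and f: "f \<in> based_maps Z W"
    and bij: "\<And>k. 0 < k \<Longrightarrow> bij_betw (homotopy_map k Z W f) (carrier (homotopy_group k Z)) (carrier (homotopy_group k W))"
  shows "\<exists>g\<in>based_maps W Z. based_homotopic W W (f \<circ> g) id \<and>
    (\<forall>k>0. bij_betw (homotopy_map k W Z g) (carrier (homotopy_group k W)) (carrier (homotopy_group k Z)))"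
proof -
  obtain C \<chi>0 where C: "CW_complex (fst W) C" "(0, \<chi>0) \<in> C" "snd W \<in> open_cell (0, \<chi>0)"
    and W': "path_connected_space (fst W)"
    using W by (rule connected_based_CW_complexE)
  have Z': "path_connected_space (fst Z)" "snd Z \<in> topspace (fst Z)"
    using Z by (auto elim: connected_based_CW_complexE)
  interpret CW_complex "fst W" C by (fact C)
  interpret weak_equivalence Z W f by (rule weak_equivalenceI) (fact f Z' W' bij)+
  interpret CW_lifting W C Z W f id \<chi>0
    by unfold_locales (simp_all add: id_based C)
  obtain g where g: "g \<in> based_maps W Z" "based_homotopic W W (f \<circ> g) id"
    using lift_up_to_homotopy based_homotopic_sym by blast
  have "bij_betw (homotopy_map k W Z g) (carrier (homotopy_group k W)) (carrier (homotopy_group k Z))" if "0 < k" for k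
  proof -
    let ?f = "homotopy_map k Z W f" and ?g = "homotopy_map k W Z g"
    have fg: "?f (?g A) = A" if "A \<in> carrier (homotopy_group k W)" for A
      using homotopy_map_homotopic[OF g(2), of k] homotopy_map_id[OF that] homotopy_map_compose[OF g(1) f that]
      by simp
    have gf: "?g (?f A) = A" if A: "A \<in> carrier (homotopy_group k Z)" for A
      by (rule inj_onD[OF bij_betw_imp_inj_on[OF bij[OF \<open>0 < k\<close>]]])
        (simp_all add: fg homotopy_map_closed f g(1) A)
    show ?thesis
      by (rule bij_betw_byWitness[where f' = ?f])
        (auto simp: fg gf homotopy_map_closed f g(1))
  qed
  with g show ?thesis by blast
qed

theorem whitehead:
  assumes X: "connected_based_CW_complex X" and Y: "connected_based_CW_complex Y"
    and f: "f \<in> based_maps X Y"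
    and bij: "\<And>k. 0 < k \<Longrightarrow> bij_betw (homotopy_map k X Y f) (carrier (homotopy_group k X)) (carrier (homotopy_group k Y))"
  shows "homotopy_equivalence X Y f"
proof -
  obtain g where g: "g \<in> based_maps Y X" "based_homotopic Y Y (f \<circ> g) id"
    and g_bij: "\<And>k. 0 < k \<Longrightarrow> bij_betw (homotopy_map k Y X g) (carrier (homotopy_group k Y)) (carrier (homotopy_group k X))"
    using weak_equivalence_right_inverse[OF X Y f bij] by blast
  obtain h where h: "h \<in> based_maps X Y" "based_homotopic X X (g \<circ> h) id"
    using weak_equivalence_right_inverse[OF Y X g(1) g_bij] by blast
  have "based_homotopic X Y (f \<circ> (g \<circ> h)) f"
    using based_homotopic_compose_left[OF h(2) f] by simp
  moreover have "based_homotopic X Y (f \<circ> (g \<circ> h)) h"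
    using based_homotopic_compose_right[OF g(2) h(1)] by (simp add: comp_assoc)
  ultimately have "based_homotopic X Y f h"
    using based_homotopic_sym based_homotopic_trans by blast
  then have "based_homotopic X X (g \<circ> f) id"
    using based_homotopic_compose_left[OF _ g(1)] based_homotopic_trans h(2) by blast
  with f g show ?thesis
    unfolding homotopy_equivalence_def by blast
qed

section \<open>Endomorphisms of products of groups\<close>

locale group_product = P: group P + G: group G + H: group H
  for P (structure) and G and H +
  fixes pX pY iX iY
  assumes pX: "pX \<in> hom P G" and pY: "pY \<in> hom P H" and iX: "iX \<in> hom G P" and iY: "iY \<in> hom H P"
    and pX_iX: "\<And>x. x \<in> carrier G \<Longrightarrow> pX (iX x) = x"
    and pY_iX: "\<And>x. x \<in> carrier G \<Longrightarrow> pY (iX x) = \<one>\<^bsub>H\<^esub>"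
    and pX_iY: "\<And>y. y \<in> carrier H \<Longrightarrow> pX (iY y) = \<one>\<^bsub>G\<^esub>"
    and pY_iY: "\<And>y. y \<in> carrier H \<Longrightarrow> pY (iY y) = y"
    and ext: "\<And>z z'. \<lbrakk>z \<in> carrier P; z' \<in> carrier P; pX z = pX z'; pY z = pY z'\<rbrakk> \<Longrightarrow> z = z'"
begin

lemma closed [simp]:
  "z \<in> carrier P \<Longrightarrow> pX z \<in> carrier G" "z \<in> carrier P \<Longrightarrow> pY z \<in> carrier H"
  "x \<in> carrier G \<Longrightarrow> iX x \<in> carrier P" "y \<in> carrier H \<Longrightarrow> iY y \<in> carrier P"
  using pX pY iX iY by (auto simp: hom_def)

lemma proj_mult [simp]:
  assumes "z \<in> carrier P" "z' \<in> carrier P"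
  shows "pX (z \<otimes> z') = pX z \<otimes>\<^bsub>G\<^esub> pX z'" "pY (z \<otimes> z') = pY z \<otimes>\<^bsub>H\<^esub> pY z'"
  using assms pX pY by (auto simp: hom_def)

lemma split: "z \<in> carrier P \<Longrightarrow> z = iX (pX z) \<otimes> iY (pY z)"
  by (rule ext) (simp_all add: pX_iX pY_iX pX_iY pY_iY)

lemma inclusions_commute:
  "\<lbrakk>x \<in> carrier G; y \<in> carrier H\<rbrakk> \<Longrightarrow> iX x \<otimes> iY y = iY y \<otimes> iX x"
  by (rule ext) (simp_all add: pX_iX pY_iX pX_iY pY_iY)

lemma swapped: "group_product P H G pY pX iY iX"
  by unfold_locales (use pX pY iX iY pX_iX pY_iX pX_iY pY_iY ext in auto)

text \<open>\<open>T\<close> maps each fibre of \<open>pX\<close> to itself and acts on the fibre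
  over \<open>x\<close> as \<open>d\<close> followed by left translation by \<open>c x\<close>,
  which is a bijection.\<close>

lemma bij_triangular_iff:
  assumes T: "T \<in> carrier P \<rightarrow> carrier P" and TX: "\<And>z. z \<in> carrier P \<Longrightarrow> pX (T z) = pX z"
    and TY: "\<And>z. z \<in> carrier P \<Longrightarrow> pY (T z) = c (pX z) \<otimes>\<^bsub>H\<^esub> d (pY z)"
    and c: "c \<in> carrier G \<rightarrow> carrier H" "c \<one>\<^bsub>G\<^esub> = \<one>\<^bsub>H\<^esub>" and d: "d \<in> carrier H \<rightarrow> carrier H"
  shows "bij_betw T (carrier P) (carrier P) \<longleftrightarrow> bij_betw d (carrier H) (carrier H)"
proof
  assume bij: "bij_betw T (carrier P) (carrier P)"
  have T_iY: "T (iY y) = iY (d y)" if "y \<in> carrier H" for y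
    by (rule ext) (use that T d c in \<open>auto simp: TX TY pX_iY pY_iY Pi_iff\<close>)
  show "bij_betw d (carrier H) (carrier H)"
    unfolding bij_betw_def
  proof (intro conjI inj_onI equalityI subsetI)
    fix y y' assume y: "y \<in> carrier H" "y' \<in> carrier H" "d y = d y'"
    then have "T (iY y) = T (iY y')" by (simp add: T_iY)
    then have "iY y = iY y'"
      using inj_onD[OF bij_betw_imp_inj_on[OF bij]] y by simp
    then show "y = y'" using pY_iY y by metis
  next
    fix h assume h: "h \<in> carrier H"
    then have "iY h \<in> T ` carrier P" using bij_betw_imp_surj_on[OF bij] by simp
    then obtain z where z: "z \<in> carrier P" "iY h = T z" by blast
    then have "pX z = \<one>\<^bsub>G\<^esub>" "h = c (pX z) \<otimes>\<^bsub>H\<^esub> d (pY z)"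
      using TX[OF z(1)] TY[OF z(1)] pX_iY[OF h] pY_iY[OF h] by simp_all
    then have "h = d (pY z)" using c d z by (simp add: Pi_iff)
    then show "h \<in> d ` carrier H" using z by simp
  qed (use d in auto)
next
  assume bij: "bij_betw d (carrier H) (carrier H)"
  show "bij_betw T (carrier P) (carrier P)"
    unfolding bij_betw_def
  proof (intro conjI inj_onI equalityI subsetI)
    fix z z' assume z: "z \<in> carrier P" "z' \<in> carrier P" and eq: "T z = T z'"
    have X: "pX z = pX z'" using TX z eq by metis
    have "c (pX z) \<otimes>\<^bsub>H\<^esub> d (pY z) = c (pX z) \<otimes>\<^bsub>H\<^esub> d (pY z')" using TY z eq X by metis
    then have "d (pY z) = d (pY z')" using c d z by (simp add: Pi_iff)
    then have "pY z = pY z'" using inj_onD[OF bij_betw_imp_inj_on[OF bij]] z by simp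
    with X z show "z = z'" by (intro ext)
  next
    fix w assume w: "w \<in> carrier P"
    have cw: "c (pX w) \<in> carrier H" using c w by auto
    then have "inv\<^bsub>H\<^esub> c (pX w) \<otimes>\<^bsub>H\<^esub> pY w \<in> d ` carrier H"
      using bij_betw_imp_surj_on[OF bij] w by simp
    then obtain y where y: "y \<in> carrier H" "d y = inv\<^bsub>H\<^esub> c (pX w) \<otimes>\<^bsub>H\<^esub> pY w" by (metis imageE)
    let ?z = "iX (pX w) \<otimes> iY y"
    have z: "?z \<in> carrier P" "pX ?z = pX w" "pY ?z = y"
      using w y by (simp_all add: pX_iX pY_iX pX_iY pY_iY)
    have "c (pX w) \<otimes>\<^bsub>H\<^esub> d y = pY w"
      using cw w by (simp add: y(2) flip: H.m_assoc)
    then have "T ?z = w"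
      using T z w by (intro ext) (auto simp: TX TY)
    with z(1) show "w \<in> T ` carrier P" by (metis imageI)
  qed (use T in auto)
qed

end

section \<open>Perturbation by nilpotent or radical endomorphisms\<close>

lemma funpow_closed: "\<lbrakk>N \<in> A \<rightarrow> A; y \<in> A\<rbrakk> \<Longrightarrow> (N ^^ j) y \<in> A"
  by (induction j) auto

lemma hom_funpow: "N \<in> hom G G \<Longrightarrow> N ^^ j \<in> hom G G"
proof (induction j)
  case (Suc j)
  then show ?case using hom_compose[of "N ^^ j" G G N G] by (simp add: o_def)
qed (simp add: id_def hom_def)

lemma bij_betw_nilpotent_perturbation:
  assumes H: "group H" and N: "N \<in> hom H H" and D: "D \<in> hom H H"
    and S: "bij_betw S (carrier H) (carrier H)"
    and S_def: "\<And>y. y \<in> carrier H \<Longrightarrow> S y = inv\<^bsub>H\<^esub> (N y) \<otimes>\<^bsub>H\<^esub> D y"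
    and nil: "\<And>y. y \<in> carrier H \<Longrightarrow> (N ^^ m) y = \<one>\<^bsub>H\<^esub>"
    and ND: "\<And>y. y \<in> carrier H \<Longrightarrow> N (D y) = D (N y)"
  shows "bij_betw D (carrier H) (carrier H)"
proof -
  interpret H: group H by (fact H)
  interpret N: group_hom H H N by unfold_locales (fact N)
  interpret D: group_hom H H D by unfold_locales (fact D)
  have N_fun: "N \<in> carrier H \<rightarrow> carrier H" by auto
  \<comment> \<open>As \<open>N\<close> and \<open>D\<close> commute, all \<open>(N ^^ j) y\<close>
    lie in the kernel of \<open>D\<close>, where \<open>S\<close> reduces to the inverse of the
    value of \<open>N\<close>. Injectivity of \<open>S\<close> then passes triviality from
    \<open>(N ^^ Suc j) y\<close> down to \<open>(N ^^ j) y\<close>.\<close>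
  have kernel: "y = \<one>\<^bsub>H\<^esub>" if "y \<in> carrier H" "D y = \<one>\<^bsub>H\<^esub>" for y
  proof -
    have DN: "D ((N ^^ j) y) = \<one>\<^bsub>H\<^esub>" for j
    proof (induction j)
      case (Suc j)
      then show ?case
        using ND[OF funpow_closed[OF N_fun that(1)], of j] by simp
    qed (use that in simp)
    have "(N ^^ j) y = \<one>\<^bsub>H\<^esub> \<Longrightarrow> y = \<one>\<^bsub>H\<^esub>" for j
    proof (induction j)
      case (Suc j)
      have c: "(N ^^ j) y \<in> carrier H" by (rule funpow_closed[OF N_fun that(1)])
      have "S ((N ^^ j) y) = S \<one>\<^bsub>H\<^esub>"
        using Suc.prems DN[of j] c by (simp add: S_def)
      then have "(N ^^ j) y = \<one>\<^bsub>H\<^esub>"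
        using inj_onD[OF bij_betw_imp_inj_on[OF S]] c by simp
      then show ?case by (rule Suc.IH)
    qed simp
    then show ?thesis using nil[OF that(1)] by blast
  qed
  have comm: "(N ^^ j) (D y) = D ((N ^^ j) y)" if "y \<in> carrier H" for j y
    using that by (induction j) (simp_all add: ND funpow_closed[OF N_fun])
  \<comment> \<open>With \<open>j = m - i\<close>, the image of \<open>N ^^ j\<close> lies in that
    of \<open>D\<close>, for \<open>j\<close> going down from \<open>m\<close> to 0. Writing
    \<open>u = S v\<close> makes \<open>(N ^^ j) u\<close> the product of the inverse of
    \<open>(N ^^ Suc j) v\<close>, covered by the preceding case, and
    \<open>D ((N ^^ j) v)\<close>.\<close>
  have image: "(N ^^ (m - i)) u \<in> D ` carrier H" if "i \<le> m" "u \<in> carrier H" for i u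
    using that
  proof (induction i arbitrary: u)
    case 0
    then show ?case using nil D.hom_one by (metis H.one_closed diff_zero imageI)
  next
    case (Suc i)
    define j where "j = m - Suc i"
    have j: "m - i = Suc j" using Suc.prems(1) by (simp add: j_def)
    interpret Nj: group_hom H H "N ^^ j" by unfold_locales (rule hom_funpow[OF N])
    obtain v where v: "v \<in> carrier H" "u = S v"
      using bij_betw_imp_surj_on[OF S] Suc.prems(2) by blast
    obtain x where x: "x \<in> carrier H" "(N ^^ j) (N v) = D x"
      using Suc.IH[OF _ v(1)] Suc.prems(1) by (auto simp: j funpow_swap1)
    have "(N ^^ j) u = inv\<^bsub>H\<^esub> (D x) \<otimes>\<^bsub>H\<^esub> D ((N ^^ j) v)"
      using v x by (simp add: S_def comm)
    also have "\<dots> = D (inv\<^bsub>H\<^esub> x \<otimes>\<^bsub>H\<^esub> (N ^^ j) v)"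
      using v x by simp
    finally have "(N ^^ j) u = D (inv\<^bsub>H\<^esub> x \<otimes>\<^bsub>H\<^esub> (N ^^ j) v)" .
    moreover have "inv\<^bsub>H\<^esub> x \<otimes>\<^bsub>H\<^esub> (N ^^ j) v \<in> carrier H"
      using v x by simp
    ultimately show ?case
      unfolding j_def[symmetric] by (metis imageI)
  qed
  have "inj_on D (carrier H)"
    using kernel by (simp add: D.inj_on_one_iff)
  moreover have "D ` carrier H = carrier H"
    using image[of m] by auto
  ultimately show ?thesis by (simp add: bij_betw_def)
qed

lemma bij_betw_radical_perturbation:
  assumes H: "comm_group H" and N: "N \<in> jacobson_radical (End_ring H)" and D: "D \<in> hom H H"
    and S: "bij_betw S (carrier H) (carrier H)"
    and S_def: "\<And>y. y \<in> carrier H \<Longrightarrow> S y = inv\<^bsub>H\<^esub> (N y) \<otimes>\<^bsub>H\<^esub> D y"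
  shows "bij_betw D (carrier H) (carrier H)"
proof -
  interpret H: comm_group H by (fact H)
  let ?E = "End_ring H"
  have N_hom: "N \<in> hom H H" and N_ext: "N \<in> extensional (carrier H)"
    using N by (auto simp: jacobson_radical_def End_ring_def)
  interpret N: group_hom H H N by unfold_locales (fact N_hom)
  interpret D: group_hom H H D by unfold_locales (fact D)
  \<comment> \<open>Commutativity of the group enters here: it makes the quotient of two
    endomorphisms an endomorphism.\<close>
  have S_hom: "S \<in> hom H H"
  proof (rule homI)
    fix x y assume "x \<in> carrier H" "y \<in> carrier H"
    then show "S (x \<otimes>\<^bsub>H\<^esub> y) = S x \<otimes>\<^bsub>H\<^esub> S y"
      by (simp add: S_def H.inv_mult H.m_ac)
  qed (simp add: S_def)
  \<comment> \<open>The restriction makes the inverse of \<open>S\<close> extensional, as elements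
    of \<open>End_ring\<close> are.\<close>
  define R where "R = restrict (inv_into (carrier H) S) (carrier H)"
  have "S \<in> iso H H" using S_hom S by (simp add: iso_def)
  then have "inv_into (carrier H) S \<in> hom H H"
    using H.iso_set_sym unfolding iso_def by blast
  then have R: "R \<in> carrier ?E"
    by (auto simp: End_ring_def R_def hom_def)
  have SR: "S (R y) = y" if "y \<in> carrier H" for y
    using that S by (simp add: R_def bij_betw_def f_inv_into_f)
  have one: "\<one>\<^bsub>?E\<^esub> \<in> carrier ?E"
    by (auto simp: End_ring_def hom_def)
  \<comment> \<open>The condition defining the radical, with the inverse of \<open>S\<close> as left
    factor and 1 as right factor.\<close>
  define U where "U = \<one>\<^bsub>?E\<^esub> \<oplus>\<^bsub>?E\<^esub> R \<otimes>\<^bsub>?E\<^esub> N \<otimes>\<^bsub>?E\<^esub> \<one>\<^bsub>?E\<^esub>"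
  have "U \<in> Units ?E"
    using N R one unfolding U_def jacobson_radical_def by blast
  then obtain V where V: "V \<in> carrier ?E" "V \<otimes>\<^bsub>?E\<^esub> U = \<one>\<^bsub>?E\<^esub>" "U \<otimes>\<^bsub>?E\<^esub> V = \<one>\<^bsub>?E\<^esub>" and U: "U \<in> carrier ?E"
    unfolding Units_def by blast
  have UV: "V (U y) = y" "U (V y) = y" if "y \<in> carrier H" for y
    using V(2,3) that by (auto simp: End_ring_def compose_def fun_eq_iff split: if_splits)
  have UV_fun: "U \<in> carrier H \<rightarrow> carrier H" "V \<in> carrier H \<rightarrow> carrier H"
    using U V(1) by (auto simp: End_ring_def hom_def)
  have "bij_betw U (carrier H) (carrier H)"
    by (rule bij_betw_byWitness[where f' = V]) (use UV UV_fun in auto)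
  then have "bij_betw (S \<circ> U) (carrier H) (carrier H)"
    using S by (rule bij_betw_trans)
  moreover have "(S \<circ> U) y = D y" if y: "y \<in> carrier H" for y
  proof -
    have RN: "R (N y) \<in> carrier H"
      using R y by (auto simp: End_ring_def hom_def)
    have "U y = y \<otimes>\<^bsub>H\<^esub> R (N y)"
      using y by (simp add: U_def End_ring_def compose_def)
    then have "S (U y) = S y \<otimes>\<^bsub>H\<^esub> N y"
      using S_hom y RN by (simp add: hom_mult SR)
    also have "\<dots> = D y"
      using y by (simp add: S_def H.m_ac)
    finally show ?thesis by simp
  qed
  ultimately show ?thesis
    using bij_betw_cong by blast
qed

context group_product
begin

text \<open>In terms of the components \<open>A, B, C, D\<close> of \<open>F\<close>, where \<open>E\<close> inverts \<open>A\<close>, the map is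
  \<open>y \<mapsto> (C A\<inverse> B y)\<inverse> D y\<close>.\<close>

lemma bij_Schur_complement:
  assumes F: "F \<in> hom P P" "bij_betw F (carrier P) (carrier P)"
    and E: "E \<in> hom G G" and AE: "\<And>x. x \<in> carrier G \<Longrightarrow> pX (F (iX (E x))) = x"
    and A: "inj_on (\<lambda>x. pX (F (iX x))) (carrier G)"
  shows "bij_betw (\<lambda>y. inv\<^bsub>H\<^esub> (pY (F (iX (E (pX (F (iY y))))))) \<otimes>\<^bsub>H\<^esub> pY (F (iY y))) (carrier H) (carrier H)"
    (is "bij_betw ?S _ _")
proof -
  interpret F: group_hom P P F by unfold_locales (fact F)
  interpret E: group_hom G G E by unfold_locales (fact E)
  interpret pX: group_hom P G pX by unfold_locales (fact pX)
  interpret pY: group_hom P H pY by unfold_locales (fact pY)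
  interpret iX: group_hom G P iX by unfold_locales (fact iX)
  interpret iY: group_hom H P iY by unfold_locales (fact iY)
  let ?A = "\<lambda>x. pX (F (iX x))" and ?B = "\<lambda>y. pX (F (iY y))"
  \<comment> \<open>The first coordinate is chosen such that \<open>F (?w y)\<close> has trivial
    \<open>pX\<close>; so \<open>F\<close> takes \<open>?w y\<close> to \<open>iY (?S y)\<close>,
    and bijectivity of \<open>F\<close> is inherited by \<open>?S\<close>.\<close>
  let ?e = "\<lambda>y. inv\<^bsub>G\<^esub> E (?B y)"
  let ?w = "\<lambda>y. iX (?e y) \<otimes> iY y"
  have w: "?w y \<in> carrier P" "pY (?w y) = y" if "y \<in> carrier H" for y
    using that by (simp_all add: pY_iX pY_iY)
  have Fw: "F (?w y) = iY (?S y)" if "y \<in> carrier H" for y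
    by (rule ext) (use that in \<open>simp_all add: AE pX_iY pY_iY\<close>)
  show ?thesis
    unfolding bij_betw_def
  proof (intro conjI inj_onI equalityI subsetI)
    fix y y' assume y: "y \<in> carrier H" "y' \<in> carrier H" and "?S y = ?S y'"
    then have "F (?w y) = F (?w y')" by (simp only: Fw)
    then have "?w y = ?w y'"
      using inj_onD[OF bij_betw_imp_inj_on[OF F(2)]] y w by blast
    then show "y = y'" using w y by metis
  next
    fix h assume h: "h \<in> carrier H"
    then have "iY h \<in> F ` carrier P"
      using bij_betw_imp_surj_on[OF F(2)] by simp
    then obtain z where z: "z \<in> carrier P" "iY h = F z" by blast
    let ?x = "pX z" and ?y = "pY z"
    have "F z = F (iX ?x \<otimes> iY ?y)"
      using arg_cong[OF split[OF z(1)], of F] .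
    also have "\<dots> = F (iX ?x) \<otimes> F (iY ?y)"
      using z(1) by simp
    finally have "pX (F (iX ?x) \<otimes> F (iY ?y)) = \<one>\<^bsub>G\<^esub>"
      using pX_iY[OF h] z(2) by simp
    then have "?A ?x \<otimes>\<^bsub>G\<^esub> ?B ?y = \<one>\<^bsub>G\<^esub>"
      using z(1) by simp
    \<comment> \<open>A preimage \<open>z\<close> of \<open>iY h\<close> has its first coordinate
      forced by injectivity of \<open>?A\<close>, so \<open>z\<close> is \<open>?w\<close> of its
      second coordinate.\<close>
    then have "?A ?x = inv\<^bsub>G\<^esub> ?B ?y"
      using z(1) by (intro G.inv_equality[symmetric]) simp_all
    also have "\<dots> = ?A (?e ?y)"
      using z(1) by (simp add: AE)
    finally have "?x = ?e ?y"
      using inj_onD[OF A] z(1) by simp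
    then have "?w ?y = z"
      using split[OF z(1)] by simp
    then have "iY h = iY (?S ?y)"
      using Fw[of ?y] z by (simp only: closed)
    then have "pY (iY h) = pY (iY (?S ?y))"
      by (rule arg_cong)
    then have "h = ?S ?y"
      using h z(1) by (simp add: pY_iY)
    then show "h \<in> ?S ` carrier H"
      by (rule image_eqI) (simp add: z(1))
  qed auto
qed

end

section \<open>Self-maps of products of spaces\<close>

lemma fst_based: "fst \<in> based_maps (X \<times>\<^sub>b Y) X" and snd_based: "snd \<in> based_maps (X \<times>\<^sub>b Y) Y"
  by (simp_all add: based_maps_def based_prod_def continuous_map_fst continuous_map_snd)

lemma pair_based:
  "\<lbrakk>f \<in> based_maps Z X; g \<in> based_maps Z Y\<rbrakk> \<Longrightarrow> (\<lambda>z. (f z, g z)) \<in> based_maps Z (X \<times>\<^sub>b Y)"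
  by (simp add: based_maps_def based_prod_def continuous_map_paired)

lemma const_based: "snd Y \<in> topspace (fst Y) \<Longrightarrow> (\<lambda>_. snd Y) \<in> based_maps X Y"
  by (simp add: based_maps_def)

lemma inl_based: "snd Y \<in> topspace (fst Y) \<Longrightarrow> (\<lambda>x. (x, snd Y)) \<in> based_maps X (X \<times>\<^sub>b Y)"
  using pair_based[OF id_based const_based] by simp

lemma inr_based: "snd X \<in> topspace (fst X) \<Longrightarrow> (\<lambda>y. (snd X, y)) \<in> based_maps Y (X \<times>\<^sub>b Y)"
  using pair_based[OF const_based id_based] by simp

lemma homotopy_map_const:
  assumes "snd Y \<in> topspace (fst Y)" "A \<in> carrier (homotopy_group k X)"
  shows "homotopy_map k X Y (\<lambda>_. snd Y) A = \<one>\<^bsub>homotopy_group k Y\<^esub>"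
  using assms by (auto simp: carrier_homotopy_group homotopy_map_class const_based one_homotopy_group o_def)

lemma homotopy_group_prod_ext:
  assumes "A \<in> carrier (homotopy_group k (X \<times>\<^sub>b Y))" "B \<in> carrier (homotopy_group k (X \<times>\<^sub>b Y))"
    and X: "homotopy_map k (X \<times>\<^sub>b Y) X fst A = homotopy_map k (X \<times>\<^sub>b Y) X fst B"
    and Y: "homotopy_map k (X \<times>\<^sub>b Y) Y snd A = homotopy_map k (X \<times>\<^sub>b Y) Y snd B"
  shows "A = B"
proof -
  obtain a b where ab: "a \<in> spheroids k (X \<times>\<^sub>b Y)" "b \<in> spheroids k (X \<times>\<^sub>b Y)"
    and AB: "A = spheroid_class k (X \<times>\<^sub>b Y) a" "B = spheroid_class k (X \<times>\<^sub>b Y) b"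
    using assms by (auto simp: carrier_homotopy_group)
  have "spheroid_homotopic k X (fst \<circ> a) (fst \<circ> b)" "spheroid_homotopic k Y (snd \<circ> a) (snd \<circ> b)"
    using X Y ab spheroid_compose[OF fst_based ab(1)] spheroid_compose[OF snd_based ab(1)]
    by (simp_all add: AB homotopy_map_class fst_based snd_based flip: spheroid_class_eq_iff)
  then obtain h h' where h: "continuous_map (prism k) (fst X) h" "\<And>x. h (0, x) = (fst \<circ> a) x" "\<And>x. h (1, x) = (fst \<circ> b) x"
      "\<And>t x. \<lbrakk>t \<in> {0..1}; x \<in> cube_boundary k\<rbrakk> \<Longrightarrow> h (t, x) = snd X"
    and h': "continuous_map (prism k) (fst Y) h'" "\<And>x. h' (0, x) = (snd \<circ> a) x" "\<And>x. h' (1, x) = (snd \<circ> b) x"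
      "\<And>t x. \<lbrakk>t \<in> {0..1}; x \<in> cube_boundary k\<rbrakk> \<Longrightarrow> h' (t, x) = snd Y"
    by (elim spheroid_homotopicE) blast
  have "spheroid_homotopic k (X \<times>\<^sub>b Y) a b"
    by (rule spheroid_homotopicI[where h = "\<lambda>z. (h z, h' z)"])
      (simp_all add: based_prod_def continuous_map_paired h h')
  then show ?thesis
    unfolding AB by (rule spheroid_class_eqI)
qed

lemma based_prod_base:
  "\<lbrakk>snd X \<in> topspace (fst X); snd Y \<in> topspace (fst Y)\<rbrakk> \<Longrightarrow> snd (X \<times>\<^sub>b Y) \<in> topspace (fst (X \<times>\<^sub>b Y))"
  by (simp add: based_prod_def)

lemma homotopy_group_product:
  assumes k: "0 < k" and X: "snd X \<in> topspace (fst X)" and Y: "snd Y \<in> topspace (fst Y)"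
  shows "group_product (homotopy_group k (X \<times>\<^sub>b Y)) (homotopy_group k X) (homotopy_group k Y)
    (homotopy_map k (X \<times>\<^sub>b Y) X fst) (homotopy_map k (X \<times>\<^sub>b Y) Y snd)
    (homotopy_map k X (X \<times>\<^sub>b Y) (\<lambda>x. (x, snd Y))) (homotopy_map k Y (X \<times>\<^sub>b Y) (\<lambda>y. (snd X, y)))"
proof -
  note based = inl_based[OF Y, of X] inr_based[OF X, of Y]
  interpret P: group "homotopy_group k (X \<times>\<^sub>b Y)"
    by (rule homotopy_group_is_group[OF k based_prod_base[OF X Y]])
  interpret G: group "homotopy_group k X" by (rule homotopy_group_is_group[OF k X])
  interpret H: group "homotopy_group k Y" by (rule homotopy_group_is_group[OF k Y])
  show ?thesis
  proof
    show "homotopy_map k (X \<times>\<^sub>b Y) X fst (homotopy_map k X (X \<times>\<^sub>b Y) (\<lambda>x. (x, snd Y)) A) = A"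
      "homotopy_map k (X \<times>\<^sub>b Y) Y snd (homotopy_map k X (X \<times>\<^sub>b Y) (\<lambda>x. (x, snd Y)) A) = \<one>\<^bsub>homotopy_group k Y\<^esub>"
      if "A \<in> carrier (homotopy_group k X)" for A
      using homotopy_map_compose[OF based(1) fst_based that] homotopy_map_compose[OF based(1) snd_based that]
        homotopy_map_id[OF that] homotopy_map_const[OF Y that]
      by (simp_all add: o_def id_def)
    show "homotopy_map k (X \<times>\<^sub>b Y) X fst (homotopy_map k Y (X \<times>\<^sub>b Y) (\<lambda>y. (snd X, y)) B) = \<one>\<^bsub>homotopy_group k X\<^esub>"
      "homotopy_map k (X \<times>\<^sub>b Y) Y snd (homotopy_map k Y (X \<times>\<^sub>b Y) (\<lambda>y. (snd X, y)) B) = B"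
      if "B \<in> carrier (homotopy_group k Y)" for B
      using homotopy_map_compose[OF based(2) fst_based that] homotopy_map_compose[OF based(2) snd_based that]
        homotopy_map_id[OF that] homotopy_map_const[OF X that]
      by (simp_all add: o_def id_def)
  qed (intro homotopy_map_hom[OF k] fst_based snd_based based | rule homotopy_group_prod_ext; assumption)+
qed

text \<open>Both orders are valid because the images of the two inclusions commute, even where the
  groups of the factors are nonabelian. The second order is the one required when the factors are
  exchanged.\<close>

lemma homotopy_map_prod:
  assumes k: "0 < k" and X: "snd X \<in> topspace (fst X)" and Y: "snd Y \<in> topspace (fst Y)"
    and g: "g \<in> based_maps (X \<times>\<^sub>b Y) V" and z: "z \<in> carrier (homotopy_group k (X \<times>\<^sub>b Y))"
  defines "gX \<equiv> homotopy_map k X V (g \<circ> (\<lambda>x. (x, snd Y))) (homotopy_map k (X \<times>\<^sub>b Y) X fst z)"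
    and "gY \<equiv> homotopy_map k Y V (g \<circ> (\<lambda>y. (snd X, y))) (homotopy_map k (X \<times>\<^sub>b Y) Y snd z)"
  shows "homotopy_map k (X \<times>\<^sub>b Y) V g z = gX \<otimes>\<^bsub>homotopy_group k V\<^esub> gY"
    and "homotopy_map k (X \<times>\<^sub>b Y) V g z = gY \<otimes>\<^bsub>homotopy_group k V\<^esub> gX"
proof -
  let ?P = "X \<times>\<^sub>b Y"
  let ?iX = "homotopy_map k X ?P (\<lambda>x. (x, snd Y))" and ?iY = "homotopy_map k Y ?P (\<lambda>y. (snd X, y))"
  let ?pX = "homotopy_map k ?P X fst" and ?pY = "homotopy_map k ?P Y snd"
  interpret group_product "homotopy_group k ?P" "homotopy_group k X" "homotopy_group k Y" ?pX ?pY ?iX ?iY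
    by (rule homotopy_group_product[OF k X Y])
  have gX: "gX = homotopy_map k ?P V g (?iX (?pX z))" and gY: "gY = homotopy_map k ?P V g (?iY (?pY z))"
    using z unfolding gX_def gY_def
    by (simp_all only: homotopy_map_compose[OF inl_based[OF Y] g] homotopy_map_compose[OF inr_based[OF X] g] closed)
  have "homotopy_map k ?P V g z = homotopy_map k ?P V g (?iX (?pX z) \<otimes>\<^bsub>homotopy_group k ?P\<^esub> ?iY (?pY z))"
    using arg_cong[OF split[OF z], of "homotopy_map k ?P V g"] .
  then show "homotopy_map k ?P V g z = gX \<otimes>\<^bsub>homotopy_group k V\<^esub> gY"
    using z by (simp add: gX gY hom_mult[OF homotopy_map_hom[OF k g]])
  have "homotopy_map k ?P V g z = homotopy_map k ?P V g (?iY (?pY z) \<otimes>\<^bsub>homotopy_group k ?P\<^esub> ?iX (?pX z))"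
    using arg_cong[OF split[OF z], of "homotopy_map k ?P V g"] inclusions_commute[of "?pX z" "?pY z"] z by simp
  then show "homotopy_map k ?P V g z = gY \<otimes>\<^bsub>homotopy_group k V\<^esub> gX"
    using z by (simp add: gX gY hom_mult[OF homotopy_map_hom[OF k g]])
qed

text \<open>This links \<open>reducible\<close> to the diagonal components, one degree at a time.
  The second equivalence is the triangular case with the two factors exchanged.\<close>

lemma bij_betw_fix_coordinate_iff:
  assumes k: "0 < k" and X: "snd X \<in> topspace (fst X)" and Y: "snd Y \<in> topspace (fst Y)"
    and f: "f \<in> based_maps (X \<times>\<^sub>b Y) (X \<times>\<^sub>b Y)"
  defines "P \<equiv> homotopy_group k (X \<times>\<^sub>b Y)"
  shows "bij_betw (homotopy_map k (X \<times>\<^sub>b Y) (X \<times>\<^sub>b Y) (\<lambda>z. (fst z, snd (f z)))) (carrier P) (carrier P) \<longleftrightarrow>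
      bij_betw (homotopy_map k Y Y (snd \<circ> f \<circ> (\<lambda>y. (snd X, y)))) (carrier (homotopy_group k Y)) (carrier (homotopy_group k Y))"
    and "bij_betw (homotopy_map k (X \<times>\<^sub>b Y) (X \<times>\<^sub>b Y) (\<lambda>z. (fst (f z), snd z))) (carrier P) (carrier P) \<longleftrightarrow>
      bij_betw (homotopy_map k X X (component_XX Y f)) (carrier (homotopy_group k X)) (carrier (homotopy_group k X))"
proof -
  let ?P = "X \<times>\<^sub>b Y"
  interpret group_product P "homotopy_group k X" "homotopy_group k Y"
      "homotopy_map k ?P X fst" "homotopy_map k ?P Y snd"
      "homotopy_map k X ?P (\<lambda>x. (x, snd Y))" "homotopy_map k Y ?P (\<lambda>y. (snd X, y))"
    unfolding P_def by (rule homotopy_group_product[OF k X Y])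
  interpret swapped: group_product P "homotopy_group k Y" "homotopy_group k X"
      "homotopy_map k ?P Y snd" "homotopy_map k ?P X fst"
      "homotopy_map k Y ?P (\<lambda>y. (snd X, y))" "homotopy_map k X ?P (\<lambda>x. (x, snd Y))"
    by (rule swapped)
  note based = inl_based[OF Y, of X] inr_based[OF X, of Y] fst_based[of X Y] snd_based[of X Y]
  have fX: "fst \<circ> f \<in> based_maps ?P X" and fY: "snd \<circ> f \<in> based_maps ?P Y"
    by (intro based_compose[OF f] based)+
  have F1: "(\<lambda>z. (fst z, snd (f z))) \<in> based_maps ?P ?P" and F2: "(\<lambda>z. (fst (f z), snd z)) \<in> based_maps ?P ?P"
    using pair_based[OF fst_based fY] pair_based[OF fX snd_based] by (simp_all add: o_def)
  show "bij_betw (homotopy_map k ?P ?P (\<lambda>z. (fst z, snd (f z)))) (carrier P) (carrier P) \<longleftrightarrow>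
      bij_betw (homotopy_map k Y Y (snd \<circ> f \<circ> (\<lambda>y. (snd X, y)))) (carrier (homotopy_group k Y)) (carrier (homotopy_group k Y))"
  proof (rule bij_triangular_iff)
    let ?c = "homotopy_map k X Y (snd \<circ> f \<circ> (\<lambda>x. (x, snd Y)))"
    have c: "snd \<circ> f \<circ> (\<lambda>x. (x, snd Y)) \<in> based_maps X Y" and d: "snd \<circ> f \<circ> (\<lambda>y. (snd X, y)) \<in> based_maps Y Y"
      by (intro based_compose[OF _ fY] based)+
    show "?c \<in> carrier (homotopy_group k X) \<rightarrow> carrier (homotopy_group k Y)"
      using homotopy_map_closed[OF c] by blast
    show "homotopy_map k Y Y (snd \<circ> f \<circ> (\<lambda>y. (snd X, y))) \<in> carrier (homotopy_group k Y) \<rightarrow> carrier (homotopy_group k Y)"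
      using homotopy_map_closed[OF d] by blast
    show "?c \<one>\<^bsub>homotopy_group k X\<^esub> = \<one>\<^bsub>homotopy_group k Y\<^esub>"
      by (rule hom_one[OF homotopy_map_hom[OF k c] G.is_group H.is_group])
    show "homotopy_map k ?P ?P (\<lambda>z. (fst z, snd (f z))) \<in> carrier P \<rightarrow> carrier P"
      using homotopy_map_closed[OF F1] unfolding P_def by blast
    fix z assume "z \<in> carrier P"
    then have z: "z \<in> carrier (homotopy_group k ?P)" by (simp add: P_def)
    show "homotopy_map k ?P X fst (homotopy_map k ?P ?P (\<lambda>z. (fst z, snd (f z))) z) = homotopy_map k ?P X fst z"
      using homotopy_map_compose[OF F1 fst_based z] by (simp add: o_def)
    show "homotopy_map k ?P Y snd (homotopy_map k ?P ?P (\<lambda>z. (fst z, snd (f z))) z) =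
        ?c (homotopy_map k ?P X fst z) \<otimes>\<^bsub>homotopy_group k Y\<^esub>
        homotopy_map k Y Y (snd \<circ> f \<circ> (\<lambda>y. (snd X, y))) (homotopy_map k ?P Y snd z)"
      using homotopy_map_compose[OF F1 snd_based z] homotopy_map_prod(1)[OF k X Y fY z] by (simp add: o_def)
  qed
  show "bij_betw (homotopy_map k ?P ?P (\<lambda>z. (fst (f z), snd z))) (carrier P) (carrier P) \<longleftrightarrow>
      bij_betw (homotopy_map k X X (component_XX Y f)) (carrier (homotopy_group k X)) (carrier (homotopy_group k X))"
  proof (rule swapped.bij_triangular_iff)
    let ?c = "homotopy_map k Y X (fst \<circ> f \<circ> (\<lambda>y. (snd X, y)))"
    have c: "fst \<circ> f \<circ> (\<lambda>y. (snd X, y)) \<in> based_maps Y X" and d: "component_XX Y f \<in> based_maps X X"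
      unfolding component_XX_def by (intro based_compose[OF _ fX] based)+
    show "?c \<in> carrier (homotopy_group k Y) \<rightarrow> carrier (homotopy_group k X)"
      using homotopy_map_closed[OF c] by blast
    show "homotopy_map k X X (component_XX Y f) \<in> carrier (homotopy_group k X) \<rightarrow> carrier (homotopy_group k X)"
      using homotopy_map_closed[OF d] by blast
    show "?c \<one>\<^bsub>homotopy_group k Y\<^esub> = \<one>\<^bsub>homotopy_group k X\<^esub>"
      by (rule hom_one[OF homotopy_map_hom[OF k c] H.is_group G.is_group])
    show "homotopy_map k ?P ?P (\<lambda>z. (fst (f z), snd z)) \<in> carrier P \<rightarrow> carrier P"
      using homotopy_map_closed[OF F2] unfolding P_def by blast
    fix z assume "z \<in> carrier P"
    then have z: "z \<in> carrier (homotopy_group k ?P)" by (simp add: P_def)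
    show "homotopy_map k ?P Y snd (homotopy_map k ?P ?P (\<lambda>z. (fst (f z), snd z)) z) = homotopy_map k ?P Y snd z"
      using homotopy_map_compose[OF F2 snd_based z] by (simp add: o_def)
    show "homotopy_map k ?P X fst (homotopy_map k ?P ?P (\<lambda>z. (fst (f z), snd z)) z) =
        ?c (homotopy_map k ?P Y snd z) \<otimes>\<^bsub>homotopy_group k X\<^esub>
        homotopy_map k X X (component_XX Y f) (homotopy_map k ?P X fst z)"
      using homotopy_map_compose[OF F2 fst_based z] homotopy_map_prod(2)[OF k X Y fX z]
      by (simp add: o_def component_XX_def)
  qed
qed

text \<open>Since \<open>g\<close> induces the inverse of the map induced by f_XX, the composite
  \<open>h\<close> of f_XY, \<open>g\<close> and f_YX induces exactly the term by which the Schur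
  complement differs from the map induced by f_YY.\<close>

lemma bij_betw_component_YY:
  assumes k: "0 < k" and X: "snd X \<in> topspace (fst X)" and Y: "snd Y \<in> topspace (fst Y)"
    and f: "f \<in> based_maps (X \<times>\<^sub>b Y) (X \<times>\<^sub>b Y)"
    and f_bij: "bij_betw (homotopy_map k (X \<times>\<^sub>b Y) (X \<times>\<^sub>b Y) f)
      (carrier (homotopy_group k (X \<times>\<^sub>b Y))) (carrier (homotopy_group k (X \<times>\<^sub>b Y)))"
    and g: "g \<in> based_maps X X" and gf: "based_homotopic X X (g \<circ> component_XX Y f) id"
    and fg: "based_homotopic X X (component_XX Y f \<circ> g) id"
  defines "h \<equiv> (snd \<circ> f \<circ> (\<lambda>x. (x, snd Y)) \<circ> g) \<circ> (fst \<circ> f \<circ> (\<lambda>y. (snd X, y)))"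
  assumes h: "nilpotent_central_map k Y h \<or> radical_map k Y h"
  shows "bij_betw (homotopy_map k Y Y (snd \<circ> f \<circ> (\<lambda>y. (snd X, y))))
    (carrier (homotopy_group k Y)) (carrier (homotopy_group k Y))"
proof -
  let ?P = "X \<times>\<^sub>b Y"
  let ?iX = "\<lambda>x. (x, snd Y)" and ?iY = "\<lambda>y. (snd X, y)"
  let ?G = "homotopy_group k X" and ?H = "homotopy_group k Y"
  interpret group_product "homotopy_group k ?P" ?G ?H
      "homotopy_map k ?P X fst" "homotopy_map k ?P Y snd" "homotopy_map k X ?P ?iX" "homotopy_map k Y ?P ?iY"
    by (rule homotopy_group_product[OF k X Y])
  note based = inl_based[OF Y, of X] inr_based[OF X, of Y] fst_based[of X Y] snd_based[of X Y]
  have fX: "fst \<circ> f \<in> based_maps ?P X" and fY: "snd \<circ> f \<in> based_maps ?P Y"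
    by (intro based_compose[OF f] based)+
  have fXX: "component_XX Y f \<in> based_maps X X" and fXY: "fst \<circ> f \<circ> ?iY \<in> based_maps Y X"
    and fYX: "snd \<circ> f \<circ> ?iX \<in> based_maps X Y" and fYY: "snd \<circ> f \<circ> ?iY \<in> based_maps Y Y"
    unfolding component_XX_def by (intro based_compose[OF _ fX] based_compose[OF _ fY] based)+
  have h_based: "h \<in> based_maps Y Y"
    unfolding h_def by (intro based_compose[OF fXY] based_compose[OF g] fYX)
  let ?F = "homotopy_map k ?P ?P f" and ?E = "homotopy_map k X X g"
  let ?N = "homotopy_map k Y Y h" and ?D = "homotopy_map k Y Y (snd \<circ> f \<circ> ?iY)"
  have comp: "homotopy_map k ?P X fst (?F (homotopy_map k X ?P ?iX x)) = homotopy_map k X X (component_XX Y f) x"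
    "homotopy_map k ?P Y snd (?F (homotopy_map k X ?P ?iX x)) = homotopy_map k X Y (snd \<circ> f \<circ> ?iX) x"
    if "x \<in> carrier ?G" for x
    using that unfolding component_XX_def
    by (simp_all only: homotopy_map_compose[OF based(1) fX] homotopy_map_compose[OF based(1) fY]
        homotopy_map_compose[OF f based(3)] homotopy_map_compose[OF f based(4)] closed)
  have comp': "homotopy_map k ?P X fst (?F (homotopy_map k Y ?P ?iY y)) = homotopy_map k Y X (fst \<circ> f \<circ> ?iY) y"
    "homotopy_map k ?P Y snd (?F (homotopy_map k Y ?P ?iY y)) = ?D y"
    if "y \<in> carrier ?H" for y
    using that
    by (simp_all only: homotopy_map_compose[OF based(2) fX] homotopy_map_compose[OF based(2) fY]
        homotopy_map_compose[OF f based(3)] homotopy_map_compose[OF f based(4)] closed)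
  define S where "S = (\<lambda>y. inv\<^bsub>?H\<^esub> homotopy_map k ?P Y snd (?F (homotopy_map k X ?P ?iX (?E
    (homotopy_map k ?P X fst (?F (homotopy_map k Y ?P ?iY y)))))) \<otimes>\<^bsub>?H\<^esub>
    homotopy_map k ?P Y snd (?F (homotopy_map k Y ?P ?iY y)))"
  have S: "bij_betw S (carrier ?H) (carrier ?H)"
    unfolding S_def
  proof (rule bij_Schur_complement[OF homotopy_map_hom[OF k f] f_bij homotopy_map_hom[OF k g]])
    show "homotopy_map k ?P X fst (?F (homotopy_map k X ?P ?iX (?E x))) = x" if "x \<in> carrier ?G" for x
      using homotopy_map_compose[OF g fXX that] homotopy_map_homotopic[OF fg, of k] homotopy_map_id[OF that]
        homotopy_map_closed[OF g that] by (simp add: comp)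
    have "inj_on (homotopy_map k X X (component_XX Y f)) (carrier ?G)"
      by (rule bij_betw_imp_inj_on[OF homotopy_equivalence_bij_betw[OF fXX g gf fg]])
    then show "inj_on (\<lambda>x. homotopy_map k ?P X fst (?F (homotopy_map k X ?P ?iX x))) (carrier ?G)"
      by (simp add: comp cong: inj_on_cong)
  qed
  have S_eq: "S y = inv\<^bsub>?H\<^esub> (?N y) \<otimes>\<^bsub>?H\<^esub> ?D y" if y: "y \<in> carrier ?H" for y
  proof -
    have x: "homotopy_map k Y X (fst \<circ> f \<circ> ?iY) y \<in> carrier ?G"
      by (rule homotopy_map_closed[OF fXY y])
    have "?N y = homotopy_map k X Y (snd \<circ> f \<circ> ?iX) (?E (homotopy_map k Y X (fst \<circ> f \<circ> ?iY) y))"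
      unfolding h_def
      by (simp only: homotopy_map_compose[OF fXY based_compose[OF g fYX] y] homotopy_map_compose[OF g fYX x])
    then show ?thesis
      using y x homotopy_map_closed[OF g x] by (simp add: S_def comp comp')
  qed
  show ?thesis
    using h
  proof
    assume "nilpotent_central_map k Y h"
    \<comment> \<open>Centrality of \<open>h\<close> is applied to the component f_YY.\<close>
    then obtain m where "trivial_homomorphism ?H ?H (?N ^^ m)"
      and "\<And>y. y \<in> carrier ?H \<Longrightarrow> ?N (?D y) = ?D (?N y)"
      using fYY unfolding nilpotent_central_map_def by blast
    then show ?thesis
      by (intro bij_betw_nilpotent_perturbation[OF H.is_group homotopy_map_hom[OF k h_based]
            homotopy_map_hom[OF k fYY] S S_eq]) (auto simp: trivial_homomorphism_def)
  next
    assume "radical_map k Y h"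
    then show ?thesis
      unfolding radical_map_def
      by (intro bij_betw_radical_perturbation[OF _ _ homotopy_map_hom[OF k fYY] S S_eq]) auto
  qed
qed

section \<open>Homotopy classes and the self-closeness number\<close>

lemma hclass_eq_iff:
  assumes "f \<in> based_maps X Y"
  shows "hclass X Y f = hclass X Y g \<longleftrightarrow> based_homotopic X Y f g"
proof
  assume "hclass X Y f = hclass X Y g"
  moreover have "f \<in> hclass X Y f" using assms by (simp add: hclass_def based_homotopic_refl)
  ultimately show "based_homotopic X Y f g" by (simp add: hclass_def based_homotopic_sym)
next
  assume "based_homotopic X Y f g"
  then show "hclass X Y f = hclass X Y g"
    unfolding hclass_def by (blast intro: based_homotopic_trans based_homotopic_sym)
qed

text \<open>Membership of a class provides only some representative with the property; it passes to
  \<open>f\<close> because homotopic maps induce the same homomorphisms.\<close>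

lemma hclass_A_sharp_iff:
  assumes f: "f \<in> based_maps X X"
  shows "hclass X X f \<in> A_sharp n X \<longleftrightarrow>
    (\<forall>k. 1 \<le> k \<and> enat k \<le> n \<longrightarrow> bij_betw (homotopy_map k X X f) (carrier (homotopy_group k X)) (carrier (homotopy_group k X)))"
proof -
  have "hclass X X f \<in> A_sharp n X \<longleftrightarrow>
    (\<forall>k. 1 \<le> k \<and> enat k \<le> n \<longrightarrow> homotopy_map k X X f \<in> iso (homotopy_group k X) (homotopy_group k X))"
  proof
    assume "hclass X X f \<in> A_sharp n X"
    then obtain f' where "based_homotopic X X f f'" and
      "\<forall>k. 1 \<le> k \<and> enat k \<le> n \<longrightarrow> homotopy_map k X X f' \<in> iso (homotopy_group k X) (homotopy_group k X)"
      unfolding A_sharp_def using hclass_eq_iff[OF f] by blast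
    then show "\<forall>k. 1 \<le> k \<and> enat k \<le> n \<longrightarrow> homotopy_map k X X f \<in> iso (homotopy_group k X) (homotopy_group k X)"
      using homotopy_map_homotopic[of X X f f'] by simp
  qed (use f in \<open>auto simp: A_sharp_def\<close>)
  with homotopy_map_iso_iff[OF _ f] show ?thesis by simp
qed

lemma homotopy_equivalence_homotopic:
  assumes "homotopy_equivalence X Y f" "based_homotopic X Y f f'"
  shows "homotopy_equivalence X Y f'"
proof -
  obtain g where g: "g \<in> based_maps Y X" "based_homotopic X X (g \<circ> f) id" "based_homotopic Y Y (f \<circ> g) id"
    using assms(1) by (auto simp: homotopy_equivalence_def)
  have "based_homotopic X X (g \<circ> f') (g \<circ> f)" "based_homotopic Y Y (f' \<circ> g) (f \<circ> g)"
    using assms(2) g(1) based_homotopic_compose_left based_homotopic_compose_right based_homotopic_sym by metis+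
  with g based_homotopic_maps(2)[OF assms(2)] show ?thesis
    unfolding homotopy_equivalence_def by (blast intro: based_homotopic_trans)
qed

lemma hclass_self_equivalences_iff:
  assumes "f \<in> based_maps X X"
  shows "hclass X X f \<in> self_equivalences X \<longleftrightarrow> homotopy_equivalence X X f"
proof
  assume "hclass X X f \<in> self_equivalences X"
  then obtain f' where "homotopy_equivalence X X f'" "based_homotopic X X f f'"
    using assms by (auto simp: self_equivalences_def hclass_eq_iff)
  then show "homotopy_equivalence X X f"
    using homotopy_equivalence_homotopic based_homotopic_sym by blast
qed (auto simp: self_equivalences_def)

lemma A_sharp_infinity:
  assumes "connected_based_CW_complex X"
  shows "A_sharp \<infinity> X = self_equivalences X"
proof (intro equalityI subsetI)
  fix a assume a: "a \<in> A_sharp \<infinity> X"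
  then obtain f where f: "f \<in> based_maps X X" "a = hclass X X f" by (auto simp: A_sharp_def)
  with a have "homotopy_equivalence X X f"
    by (intro whitehead[OF assms assms]) (auto simp: hclass_A_sharp_iff Suc_le_eq)
  with f show "a \<in> self_equivalences X" by (simp add: hclass_self_equivalences_iff)
next
  fix a assume "a \<in> self_equivalences X"
  then obtain f g where "a = hclass X X f" "f \<in> based_maps X X" "g \<in> based_maps X X"
    "based_homotopic X X (g \<circ> f) id" "based_homotopic X X (f \<circ> g) id"
    by (auto simp: self_equivalences_def homotopy_equivalence_def)
  then show "a \<in> A_sharp \<infinity> X"
    using homotopy_equivalence_bij_betw[of f X X g] by (simp add: hclass_A_sharp_iff)
qed

lemma A_sharp_antimono: "m \<le> n \<Longrightarrow> A_sharp n X \<subseteq> A_sharp m X"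
  unfolding A_sharp_def by (blast intro: order_trans)

text \<open>By Whitehead's theorem \<infinity> satisfies the condition under \<open>LEAST\<close>,
  so the least value satisfies it too. For larger \<open>n\<close>, \<open>A_sharp n X\<close> is
  squeezed between its values at the self-closeness number and at \<infinity>.\<close>

lemma A_sharp_eq_self_equivalences:
  assumes X: "connected_based_CW_complex X" and n: "self_closeness_number X \<le> n"
  shows "A_sharp n X = self_equivalences X"
proof -
  have "A_sharp (self_closeness_number X) X = self_equivalences X"
    unfolding self_closeness_number_def by (rule LeastI) (rule A_sharp_infinity[OF X])
  then show ?thesis
    using A_sharp_antimono[OF n, of X] A_sharp_antimono[of n \<infinity> X] A_sharp_infinity[OF X] by auto
qed

theorem theorem4p2:
  fixes X :: "'a based" and Y :: "'b based" and n :: enat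
  assumes "connected_based_CW_complex X" and "connected_based_CW_complex Y"
    and "self_closeness_number X \<le> n"
    and "\<And>h k. \<lbrakk>h \<in> based_maps Y Y; factors_through X Y h; 1 \<le> k; enat k \<le> n\<rbrakk>
           \<Longrightarrow> nilpotent_central_map k Y h \<or> radical_map k Y h"
  shows "reducible n X Y \<longleftrightarrow>
    (\<forall>f \<in> based_maps (X \<times>\<^sub>b Y) (X \<times>\<^sub>b Y).
       hclass (X \<times>\<^sub>b Y) (X \<times>\<^sub>b Y) f \<in> A_sharp n (X \<times>\<^sub>b Y) \<longrightarrow>
       hclass X X (component_XX Y f) \<in> self_equivalences X)"
proof -
  have X: "snd X \<in> topspace (fst X)" and Y: "snd Y \<in> topspace (fst Y)"
    using assms(1,2) by (auto elim: connected_based_CW_complexE)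
  let ?P = "X \<times>\<^sub>b Y"
  let ?iX = "\<lambda>x. (x, snd Y) :: 'a \<times> 'b" and ?iY = "\<lambda>y. (snd X, y) :: 'a \<times> 'b"
  note based = inl_based[OF Y, of X] inr_based[OF X, of Y] fst_based[of X Y] snd_based[of X Y]
  show ?thesis
  proof (intro iffI ballI impI)
    fix f assume red: "reducible n X Y" and f: "f \<in> based_maps ?P ?P" and fn: "hclass ?P ?P f \<in> A_sharp n ?P"
    have fXX: "component_XX Y f \<in> based_maps X X"
      unfolding component_XX_def by (intro based_compose[OF based(1)] based_compose[OF f] based)
    have f2: "(\<lambda>z. (fst (f z), snd z)) \<in> based_maps ?P ?P"
      using pair_based[OF based_compose[OF f fst_based] snd_based] by (simp add: o_def)
    have "hclass ?P ?P (\<lambda>z. (fst (f z), snd z)) \<in> A_sharp n ?P"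
      using red f fn by (simp add: reducible_def)
    then have "hclass X X (component_XX Y f) \<in> A_sharp n X"
      using bij_betw_fix_coordinate_iff(2)[OF _ X Y f] by (simp add: hclass_A_sharp_iff[OF f2] hclass_A_sharp_iff[OF fXX])
    \<comment> \<open>Here \<open>n\<close> being at least the self-closeness number turns
      bijectivity up to degree \<open>n\<close> into a homotopy equivalence.\<close>
    then show "hclass X X (component_XX Y f) \<in> self_equivalences X"
      using A_sharp_eq_self_equivalences[OF assms(1,3)] by simp
  next
    assume *: "\<forall>f\<in>based_maps ?P ?P. hclass ?P ?P f \<in> A_sharp n ?P \<longrightarrow> hclass X X (component_XX Y f) \<in> self_equivalences X"
    show "reducible n X Y"
      unfolding reducible_def
    proof (intro ballI impI)
      fix f assume f: "f \<in> based_maps ?P ?P" and fn: "hclass ?P ?P f \<in> A_sharp n ?P"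
      have fXX: "component_XX Y f \<in> based_maps X X"
        unfolding component_XX_def by (intro based_compose[OF based(1)] based_compose[OF f] based)
      have f1: "(\<lambda>z. (fst z, snd (f z))) \<in> based_maps ?P ?P"
        using pair_based[OF fst_based based_compose[OF f snd_based]] by (simp add: o_def)
      have f2: "(\<lambda>z. (fst (f z), snd z)) \<in> based_maps ?P ?P"
        using pair_based[OF based_compose[OF f fst_based] snd_based] by (simp add: o_def)
      have f_bij: "bij_betw (homotopy_map k ?P ?P f) (carrier (homotopy_group k ?P)) (carrier (homotopy_group k ?P))"
        if "1 \<le> k" "enat k \<le> n" for k
        using fn that by (simp add: hclass_A_sharp_iff[OF f])
      have "homotopy_equivalence X X (component_XX Y f)"
        using * f fn unfolding hclass_self_equivalences_iff[OF fXX, symmetric] by blast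
      then obtain g where g: "g \<in> based_maps X X" "based_homotopic X X (g \<circ> component_XX Y f) id"
        "based_homotopic X X (component_XX Y f \<circ> g) id"
        by (auto simp: homotopy_equivalence_def)
      have XX_bij: "bij_betw (homotopy_map k X X (component_XX Y f)) (carrier (homotopy_group k X)) (carrier (homotopy_group k X))" for k
        by (rule homotopy_equivalence_bij_betw[OF fXX g])
      have fXY: "fst \<circ> f \<circ> ?iY \<in> based_maps Y X" and fYX: "snd \<circ> f \<circ> ?iX \<in> based_maps X Y"
        by (intro based_compose[OF based(1)] based_compose[OF based(2)] based_compose[OF f] based)+
      \<comment> \<open>One map serves all degrees \<open>k\<close>. It factors through X as f_XY
        followed by the composite of \<open>g\<close> and f_YX.\<close>
      define h where "h = (snd \<circ> f \<circ> ?iX \<circ> g) \<circ> (fst \<circ> f \<circ> ?iY)"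
      have h: "h \<in> based_maps Y Y"
        unfolding h_def by (intro based_compose[OF fXY] based_compose[OF g(1)] fYX)
      have h_factors: "factors_through X Y h"
        unfolding factors_through_def
        by (intro bexI[OF _ fXY] bexI[OF _ based_compose[OF g(1) fYX]])
          (use h in \<open>simp add: h_def based_homotopic_refl\<close>)
      have "bij_betw (homotopy_map k Y Y (snd \<circ> f \<circ> ?iY)) (carrier (homotopy_group k Y)) (carrier (homotopy_group k Y))"
        if k: "1 \<le> k" "enat k \<le> n" for k
        using bij_betw_component_YY[OF _ X Y f f_bij[OF k] g] assms(4)[OF h h_factors k] k
        unfolding h_def by simp
      then show "hclass ?P ?P (\<lambda>z. (fst z, snd (f z))) \<in> A_sharp n ?P \<and> hclass ?P ?P (\<lambda>z. (fst (f z), snd z)) \<in> A_sharp n ?P"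
        using bij_betw_fix_coordinate_iff[OF _ X Y f] XX_bij
        by (simp add: hclass_A_sharp_iff[OF f1] hclass_A_sharp_iff[OF f2])
    qed
  qed
qed

end
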